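(* Let $1<p<\infty$ and let $\mathcal{C}$ be the Cesàro operator acting on the Hardy space $H^p$ of the unit disc. Then: 1. $\sigma_{\mathcal{C}}(f)=\sigma(\mathcal{C};H^p)$ for every $f\in H^p\setminus\{0\}$. 2. $r_{\mathcal{C}}(f)=r(\mathcal{C};H^p)$ for every $f\in H^p\setminus\{0\}$. 3. $H^p_{\mathcal{C}}(F)=\{0\}$ for every closed subset $F\subsetneq\sigma(\mathcal{C};H^p)$. 4. If $M$ is a non-trivial closed invariant subspace of $\mathcal{C}$ in $H^p$, then $\sigma(\mathcal{C}|_M)=\sigma(\mathcal{C};H^p)$.
   Context: The Cesàro operator acts on $f(z)=\sum_{k\ge0}a_kz^k\in H^p$ by $$\mathcal{C}(f)(z)=\sum_{n=0}^\infty\left(\frac1{n+1}\sum_{k=0}^na_k\right)z^n,\qquad |z|<1,$$ and is a bounded operator on $H^p$. $\sigma(\mathcal{C};H^p)$ and $r(\mathcal{C};H^p)$ denote the spectrum and spectral radius of $\mathcal{C}$ as an operator on $H^p$, and $\sigma(\mathcal{C}|_M)$ is the spectrum of the restriction $\mathcal{C}|_M:M\to M$. For a bounded operator $T$ on a complex Banach space $X$ and $x\in X$: the local resolvent $\rho_T(x)$ is the union of all open sets $U\subset\mathbb{C}$ for which there is an analytic $f_x:U\to X$ with $(T-zI)f_x(z)=x$ for $z\in U$; the local spectrum is $\sigma_T(x)=\mathbb{C}\setminus\rho_T(x)$; the local spectral radius is $r_T(x)=\limsup_{n\to\infty}\|T^nx\|^{1/n}$; for $A\subset\mathbb{C}$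 the spectral subspace is $X_T(A)=\{x\in X:\sigma_T(x)\subseteq A\}$ (here $X=H^p$). A subspace is non-trivial if it is neither $\{0\}$ nor the whole space. *)

theory Defs
  imports "HOL-Complex_Analysis.Complex_Analysis" "HOL-Library.Function_Algebras"
begin

text \<open>
  The Hardy spaces depend on a real parameter, so complex normed spaces are given by a
  carrier \<open>X\<close> of complex-valued functions (with pointwise operations) together with a norm
  \<open>N\<close> on it. A closed subspace is then a smaller carrier with the same norm, and the
  restriction of an operator \<open>T\<close> to it is \<open>T\<close> considered on the smaller carrier.
\<close>

definition cscale :: "complex \<Rightarrow> ('a \<Rightarrow> complex) \<Rightarrow> 'a \<Rightarrow> complex"
  where "cscale c f = (\<lambda>z. c * f z)"

definition bounded_op_on ::
    "('a \<Rightarrow> complex) set \<Rightarrow> (('a \<Rightarrow> complex) \<Rightarrow> real) \<Rightarrow> (('a \<Rightarrow> complex) \<Rightarrow> ('a \<Rightarrow> complex)) \<Rightarrow> bool"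
  where "bounded_op_on X N T \<longleftrightarrow>
    (\<forall>f\<in>X. T f \<in> X) \<and>
    (\<forall>f\<in>X. \<forall>g\<in>X. T (f + g) = T f + T g) \<and>
    (\<forall>c. \<forall>f\<in>X. T (cscale c f) = cscale c (T f)) \<and>
    (\<exists>K. \<forall>f\<in>X. N (T f) \<le> K * N f)"

definition op_spectrum ::
    "('a \<Rightarrow> complex) set \<Rightarrow> (('a \<Rightarrow> complex) \<Rightarrow> real) \<Rightarrow> (('a \<Rightarrow> complex) \<Rightarrow> ('a \<Rightarrow> complex)) \<Rightarrow> complex set"
  where "op_spectrum X N T =
    {z. \<not> (\<exists>R. bounded_op_on X N R \<and>
          (\<forall>f\<in>X. R (T f - cscale z f) = f \<and> T (R f) - cscale z (R f) = f))}"

definition spectral_radius ::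
    "('a \<Rightarrow> complex) set \<Rightarrow> (('a \<Rightarrow> complex) \<Rightarrow> real) \<Rightarrow> (('a \<Rightarrow> complex) \<Rightarrow> ('a \<Rightarrow> complex)) \<Rightarrow> ereal"
  where "spectral_radius X N T = (SUP z\<in>op_spectrum X N T. ereal (norm z))"

text \<open>Complex differentiability, with respect to the norm \<open>N\<close>, at every point of \<open>U\<close>; used
  for open \<open>U\<close> only.\<close>

definition analytic_into ::
    "('a \<Rightarrow> complex) set \<Rightarrow> (('a \<Rightarrow> complex) \<Rightarrow> real) \<Rightarrow> complex set \<Rightarrow> (complex \<Rightarrow> 'a \<Rightarrow> complex) \<Rightarrow> bool"
  where "analytic_into X N U F \<longleftrightarrow>
    (\<forall>w\<in>U. F w \<in> X) \<and>
    (\<forall>w\<in>U. \<exists>D\<in>X. ((\<lambda>z. N (cscale (1 / (z - w)) (F z - F w) - D)) \<longlongrightarrow> 0) (at w within U))"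

definition local_resolvent ::
    "('a \<Rightarrow> complex) set \<Rightarrow> (('a \<Rightarrow> complex) \<Rightarrow> real) \<Rightarrow> (('a \<Rightarrow> complex) \<Rightarrow> ('a \<Rightarrow> complex))
      \<Rightarrow> ('a \<Rightarrow> complex) \<Rightarrow> complex set"
  where "local_resolvent X N T x =
    \<Union>{U. open U \<and> (\<exists>F. analytic_into X N U F \<and> (\<forall>z\<in>U. T (F z) - cscale z (F z) = x))}"

definition local_spectrum ::
    "('a \<Rightarrow> complex) set \<Rightarrow> (('a \<Rightarrow> complex) \<Rightarrow> real) \<Rightarrow> (('a \<Rightarrow> complex) \<Rightarrow> ('a \<Rightarrow> complex))
      \<Rightarrow> ('a \<Rightarrow> complex) \<Rightarrow> complex set"
  where "local_spectrum X N T x = - local_resolvent X N T x"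

definition local_spectral_radius ::
    "(('a \<Rightarrow> complex) \<Rightarrow> real) \<Rightarrow> (('a \<Rightarrow> complex) \<Rightarrow> ('a \<Rightarrow> complex)) \<Rightarrow> ('a \<Rightarrow> complex) \<Rightarrow> ereal"
  where "local_spectral_radius N T x = limsup (\<lambda>n. ereal (root n (N ((T ^^ n) x))))"

definition spectral_subspace ::
    "('a \<Rightarrow> complex) set \<Rightarrow> (('a \<Rightarrow> complex) \<Rightarrow> real) \<Rightarrow> (('a \<Rightarrow> complex) \<Rightarrow> ('a \<Rightarrow> complex))
      \<Rightarrow> complex set \<Rightarrow> ('a \<Rightarrow> complex) set"
  where "spectral_subspace X N T A = {x\<in>X. local_spectrum X N T x \<subseteq> A}"

definition closed_subspace ::
    "('a \<Rightarrow> complex) set \<Rightarrow> (('a \<Rightarrow> complex) \<Rightarrow> real) \<Rightarrow> ('a \<Rightarrow> complex) set \<Rightarrow> bool"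
  where "closed_subspace X N M \<longleftrightarrow>
    module.subspace cscale M \<and> M \<subseteq> X \<and>
    (\<forall>f\<in>X. (\<forall>e>0. \<exists>g\<in>M. N (f - g) < e) \<longrightarrow> f \<in> M)"

definition integral_mean :: "real \<Rightarrow> real \<Rightarrow> (complex \<Rightarrow> complex) \<Rightarrow> real"
  where "integral_mean p r f =
    (1 / (2 * pi) * integral {0..2 * pi} (\<lambda>t. norm (f (of_real r * cis t)) powr p)) powr (1 / p)"

text \<open>Functions on the unit disc are extended by \<open>0\<close> to the whole plane, so that equality in
  the space is equality of functions.\<close>

definition hardy_space :: "real \<Rightarrow> (complex \<Rightarrow> complex) set"
  where "hardy_space p =
    {f. f holomorphic_on ball 0 1 \<and> (\<forall>z. z \<notin> ball 0 1 \<longrightarrow> f z = 0) \<and>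
        bdd_above ((\<lambda>r. integral_mean p r f) ` {0..<1})}"

definition hardy_norm :: "real \<Rightarrow> (complex \<Rightarrow> complex) \<Rightarrow> real"
  where "hardy_norm p f = (SUP r\<in>{0..<1}. integral_mean p r f)"

definition taylor_coeff :: "(complex \<Rightarrow> complex) \<Rightarrow> nat \<Rightarrow> complex"
  where "taylor_coeff f k = (deriv ^^ k) f 0 / fact k"

definition cesaro :: "(complex \<Rightarrow> complex) \<Rightarrow> complex \<Rightarrow> complex"
  where "cesaro f = (\<lambda>z. if z \<in> ball 0 1
    then (\<Sum>n. (1 / of_nat (n + 1) * (\<Sum>k\<le>n. taylor_coeff f k)) * z ^ n) else 0)"

end

theory Submission
  imports Defs
begin

text \<open>
  Write \<open>s = 1/\<lambda>\<close>, and call the closed disc with centre and radius \<open>p/2\<close> the spectral disc; a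
  nonzero \<open>\<lambda>\<close> lies in its interior exactly if \<open>Re s > 1/p\<close>, and outside of it exactly if
  \<open>Re s < 1/p\<close>. All four claims follow from two facts about the Cesaro operator \<open>C\<close>.

  \<^item> If \<open>\<lambda>\<close> is outside the spectral disc, then \<open>C - \<lambda>\<close> has a bounded inverse on \<open>H\<^sup>p\<close>
    (\<open>cesaro_regular_outside_disc\<close>).
  \<^item> If \<open>(C - \<lambda>) g = f\<close> has a solution \<open>g\<close> in \<open>H\<^sup>p\<close> for every \<open>\<lambda>\<close> in a nonempty open subset of
    the spectral disc, then \<open>f = 0\<close> (\<open>solvable_on_open_set_imp_zero\<close>).

  The second fact says that the local spectrum of a nonzero \<open>f\<close> contains the spectral disc, and
  that so does the spectrum of \<open>C\<close> on every nonzero closed invariant subspace \<open>M\<close>, because a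
  regular point has a neighbourhood on which the resolvent is analytic (\<open>local_solution\<close>). The
  first fact gives the opposite inclusion in \<open>H\<^sup>p\<close>. In \<open>M\<close> the opposite inclusion holds because
  regularity for \<open>M\<close> is an open and closed condition in the complement of the disc, which is
  connected, and it holds for large \<open>\<lambda>\<close> (\<open>regular_point_subspace\<close>). The local spectral radius
  cannot be less than \<open>p\<close>, as the Neumann series would then solve the equation near \<open>\<lambda> = p\<close>; it
  is at most \<open>p\<close> by Cauchy's estimates for the resolvent on circles of radius \<open>R > p\<close>.

  For the first fact, \<open>C k\<close> is determined by the differential equation
  \<open>(1 - z) (z (C k)' + C k) = k\<close>, so that inverting \<open>C - \<lambda>\<close> amounts to solving
  \<open>(1 - z) (z k' + k) = s k + f\<close>. There is a unique analytic solution in the disc as soon as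
  \<open>Re s < 1\<close>. Its integral means are bounded by an energy argument: integrating the angular
  derivative of \<open>Im z |k|\<^sup>p\<close> over a circle gives \<open>0\<close>, but by the equation this derivative is at
  least a positive multiple of \<open>|k|\<^sup>p\<close> near the point \<open>1\<close>, up to a multiple of \<open>|f| |k|\<^sup>p\<^sup>-\<^sup>1\<close>, because
  \<open>p Re s < 1\<close>. Away from
  \<open>1\<close> the means of \<open>|k|\<^sup>p\<close> are controlled by those of \<open>|1 - z|\<^sup>2 |k|\<^sup>p\<close>, whose radial derivative is
  again bounded through the equation, and Gronwall's inequality closes the estimate
  (\<open>energy_estimate\<close>).

  For the second fact, the adjoint of \<open>C\<close> has the eigenvector \<open>(1 - z)\<^sup>s\<^sup>-\<^sup>1\<close> to the eigenvalue
  \<open>\<lambda>\<close>; if \<open>f\<close> is in the range of \<open>C - \<lambda>\<close>, its pairing with this eigenvector vanishes. The pairing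
  is analytic in \<open>s\<close> on the half-plane \<open>Re s > 1/p\<close> because the partial sums of the Taylor
  coefficients of \<open>f\<close> are \<open>O(n\<^sup>1\<^sup>/\<^sup>p)\<close> (\<open>partial_sum_growth\<close>). Hence it vanishes on the whole
  half-plane. At \<open>s = 1, 2, 3, \<dots>\<close> the eigenvector is a polynomial of degree \<open>s - 1\<close>, and the
  vanishing of all these pairings says successively that all Taylor coefficients of \<open>f\<close> vanish.
\<close>

section \<open>Bounded inverses and local solutions\<close>

lemma cscale_apply: "cscale c f z = c * f z"
  by (simp add: cscale_def)

(* In goals about elements of the space, sums and differences of functions must stay unevaluated;
   otherwise eta-expanded terms are rewritten pointwise and no longer match the norm rules. *)
declare plus_fun_apply [simp del] minus_apply [simp del] uminus_apply [simp del] zero_fun_apply [simp del]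

lemmas pointwise = fun_eq_iff plus_fun_apply minus_apply uminus_apply zero_fun_apply cscale_apply

lemma module_cscale: "module (cscale :: complex \<Rightarrow> ('a \<Rightarrow> complex) \<Rightarrow> 'a \<Rightarrow> complex)"
  by unfold_locales (auto simp: pointwise algebra_simps)

lemma cscale_simps:
  "cscale 1 f = f" "cscale 0 f = 0" "cscale c 0 = 0"
  "cscale a (cscale b f) = cscale (a * b) f"
  "cscale c (f + g) = cscale c f + cscale c g"
  "cscale c (f - g) = cscale c f - cscale c g"
  by (auto simp: pointwise algebra_simps)

lemma shifted_operator_eq_iff:
  "T g - cscale z g = f \<longleftrightarrow> T g = f + cscale z g"
  by (metis add_diff_cancel diff_add_cancel)

text \<open>Closed subspaces of Hardy spaces are treated as spaces in their own right, so completeness is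
  stated for a carrier with a norm.\<close>

locale function_banach =
  fixes X :: "('a \<Rightarrow> complex) set" and N :: "('a \<Rightarrow> complex) \<Rightarrow> real"
  assumes zero_mem: "0 \<in> X"
    and add_mem: "\<And>f g. f \<in> X \<Longrightarrow> g \<in> X \<Longrightarrow> f + g \<in> X"
    and scale_mem: "\<And>c f. f \<in> X \<Longrightarrow> cscale c f \<in> X"
    and norm_add: "\<And>f g. f \<in> X \<Longrightarrow> g \<in> X \<Longrightarrow> N (f + g) \<le> N f + N g"
    and norm_scale: "\<And>c f. f \<in> X \<Longrightarrow> N (cscale c f) = norm c * N f"
    and norm_eq_0: "\<And>f. f \<in> X \<Longrightarrow> N f = 0 \<Longrightarrow> f = 0"
    and complete: "\<And>u. (\<And>n. u n \<in> X) \<Longrightarrow> (\<And>e. e > 0 \<Longrightarrow> \<exists>K. \<forall>m\<ge>K. \<forall>n\<ge>K. N (u m - u n) < e)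
      \<Longrightarrow> \<exists>g\<in>X. (\<lambda>n. N (u n - g)) \<longlonglongrightarrow> 0"
begin

lemma uminus_mem: "f \<in> X \<Longrightarrow> - f \<in> X"
proof -
  assume "f \<in> X"
  then have "cscale (-1) f \<in> X" by (rule scale_mem)
  also have "cscale (-1) f = - f" by (auto simp: pointwise)
  finally show ?thesis .
qed

lemma diff_mem: "f \<in> X \<Longrightarrow> g \<in> X \<Longrightarrow> f - g \<in> X"
  by (metis add_mem uminus_mem diff_conv_add_uminus)

lemma norm_zero: "N 0 = 0"
  using norm_scale[OF zero_mem, of 0] by (simp add: cscale_simps)

lemma norm_minus: "f \<in> X \<Longrightarrow> N (- f) = N f"
proof -
  assume "f \<in> X"
  then have "N (cscale (-1) f) = N f" by (simp add: norm_scale)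
  also have "cscale (-1) f = - f" by (auto simp: pointwise)
  finally show ?thesis .
qed

lemma norm_diff: "f \<in> X \<Longrightarrow> g \<in> X \<Longrightarrow> N (f - g) \<le> N f + N g"
  using norm_add[of f "- g"] by (simp add: uminus_mem norm_minus)

lemma norm_diff_commute: "f \<in> X \<Longrightarrow> g \<in> X \<Longrightarrow> N (f - g) = N (g - f)"
  using norm_minus[of "f - g"] by (simp add: diff_mem)

lemma norm_triangle: "f \<in> X \<Longrightarrow> g \<in> X \<Longrightarrow> h \<in> X \<Longrightarrow> N (f - h) \<le> N (f - g) + N (g - h)"
  using norm_add[of "f - g" "g - h"] by (simp add: diff_mem)

lemma norm_nonneg: "f \<in> X \<Longrightarrow> 0 \<le> N f"
  using norm_diff[of f f] by (simp add: norm_zero)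

lemma norm_le_of_limit:
  assumes "u \<in> X" "v \<in> X" and t: "w \<longlonglongrightarrow> 0" and le: "\<And>n. N (u - v) \<le> w n"
  shows "u = v"
proof -
  have "N (u - v) \<le> 0"
    using t le by (intro LIMSEQ_le_const[OF t]) auto
  then have "N (u - v) = 0" using norm_nonneg[of "u - v"] assms by (simp add: diff_mem)
  then show ?thesis using norm_eq_0[of "u - v"] assms by (simp add: diff_mem)
qed

lemma geometric_steps_converge:
  assumes u: "\<And>n. u n \<in> X" and q: "0 \<le> q" "q < 1"
    and step: "\<And>n. N (u (Suc n) - u n) \<le> B * q ^ n"
  shows "\<exists>g\<in>X. (\<lambda>n. N (u n - g)) \<longlonglongrightarrow> 0"
proof (rule complete[OF u])
  fix e :: real assume e: "e > 0"
  have B: "0 \<le> B"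
    using step[of 0] norm_nonneg[of "u 1 - u 0"] u by (simp add: diff_mem)
  have dist: "N (u (n + k) - u n) \<le> (\<Sum>i<k. B * q ^ (n + i))" for n k
  proof -
    define D where "D k = N (u (n + k) - u n)" for k
    have "D k \<le> (\<Sum>i<k. B * q ^ (n + i))"
    proof (induction k)
      case 0 then show ?case by (simp add: D_def norm_zero)
    next
      case (Suc k)
      have "D (Suc k) \<le> N (u (Suc (n + k)) - u (n + k)) + D k"
        using norm_triangle[OF u u u] by (simp add: D_def)
      then show ?case using Suc step[of "n + k"] by simp
    qed
    then show ?thesis by (simp add: D_def)
  qed
  have tail: "N (u (n + k) - u n) \<le> B * q ^ n / (1 - q)" for n k
  proof -
    have "(\<Sum>i<k. q ^ i) \<le> 1 / (1 - q)"
      using q sum_le_suminf[of "\<lambda>i. q ^ i" "{..<k}"] by (simp add: suminf_geometric summable_geometric)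
    then have "B * q ^ n * (\<Sum>i<k. q ^ i) \<le> B * q ^ n * (1 / (1 - q))"
      using B q by (intro mult_left_mono) auto
    then show ?thesis using dist[where n=n and k=k]
      by (simp add: power_add sum_distrib_left mult.assoc)
  qed
  have "(\<lambda>n. B * q ^ n / (1 - q)) \<longlonglongrightarrow> B * 0 / (1 - q)"
    using q by (intro tendsto_intros LIMSEQ_power_zero) auto
  then obtain K where K: "\<And>n. n \<ge> K \<Longrightarrow> B * q ^ n / (1 - q) < e / 2"
    using order_tendstoD(2)[of "\<lambda>n. B * q ^ n / (1 - q)" 0 sequentially "e / 2"] e
    by (auto simp: eventually_sequentially)
  have "N (u m - u n) < e" if "m \<ge> K" "n \<ge> K" for m n
  proof -
    have "N (u m - u n) \<le> N (u m - u K) + N (u K - u n)"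
      using norm_triangle[OF u u u] .
    also have "N (u K - u n) = N (u n - u K)"
      using norm_diff_commute[OF u u] .
    also have "N (u m - u K) + N (u n - u K) \<le> B * q ^ K / (1 - q) + B * q ^ K / (1 - q)"
      using tail[of K "m - K"] tail[of K "n - K"] that by (intro add_mono) auto
    also have "\<dots> < e" using K[of K] by linarith
    finally show ?thesis .
  qed
  then show "\<exists>K. \<forall>m\<ge>K. \<forall>n\<ge>K. N (u m - u n) < e" by blast
qed

text \<open>Both small perturbations of an invertible operator and resolvents at large points are solved by
  iteration; this is the common source of surjectivity.\<close>

lemma contraction_fixed_point:
  assumes A: "\<And>f. f \<in> X \<Longrightarrow> A f \<in> X"
    and lip: "\<And>f g. f \<in> X \<Longrightarrow> g \<in> X \<Longrightarrow> N (A f - A g) \<le> q * N (f - g)"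
    and q: "0 \<le> q" "q < 1"
  shows "\<exists>g\<in>X. A g = g"
proof -
  define u where "u n = (A ^^ n) 0" for n
  have u: "u n \<in> X" for n
    by (induction n) (auto simp: u_def zero_mem A)
  define d where "d n = N (u (Suc n) - u n)" for n
  have d: "d n \<le> d 0 * q ^ n" for n
  proof (induction n)
    case (Suc n)
    have "d (Suc n) \<le> q * d n"
      using lip[OF u[of "Suc n"] u[of n]] by (simp add: u_def d_def)
    also have "\<dots> \<le> q * (d 0 * q ^ n)"
      using Suc q by (intro mult_left_mono) auto
    finally show ?case by (simp add: mult_ac)
  qed simp
  have "N (u (Suc n) - u n) \<le> d 0 * q ^ n" for n
    using d[of n] by (simp only: d_def)
  from geometric_steps_converge[OF u q this] obtain g where g: "g \<in> X" "(\<lambda>n. N (u n - g)) \<longlonglongrightarrow> 0"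
    by blast
  have "A g = g"
  proof (rule norm_le_of_limit)
    have "(\<lambda>n. q * N (u n - g) + N (u (Suc n) - g)) \<longlonglongrightarrow> q * 0 + 0"
      using g(2) LIMSEQ_Suc[OF g(2)] by (intro tendsto_intros)
    then show "(\<lambda>n. q * N (u n - g) + N (u (Suc n) - g)) \<longlonglongrightarrow> 0" by simp
    show "N (A g - g) \<le> q * N (u n - g) + N (u (Suc n) - g)" for n
    proof -
      have "N (A g - g) \<le> N (A g - u (Suc n)) + N (u (Suc n) - g)"
        using norm_triangle[OF A[OF g(1)] u g(1)] .
      also have "N (A g - u (Suc n)) \<le> q * N (g - u n)"
        using lip[OF g(1) u[of n]] by (simp add: u_def)
      also have "N (g - u n) = N (u n - g)" using norm_diff_commute[OF g(1) u] .
      finally show ?thesis by simp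
    qed
  qed (use g A in auto)
  then show ?thesis using g by blast
qed

end

locale function_operator = function_banach +
  fixes T :: "('a \<Rightarrow> complex) \<Rightarrow> 'a \<Rightarrow> complex"
  assumes T_mem: "\<And>f. f \<in> X \<Longrightarrow> T f \<in> X"
    and T_add: "\<And>f g. f \<in> X \<Longrightarrow> g \<in> X \<Longrightarrow> T (f + g) = T f + T g"
    and T_scale: "\<And>c f. f \<in> X \<Longrightarrow> T (cscale c f) = cscale c (T f)"
begin

text \<open>Bounded invertibility of \<open>T - z\<close>, split into surjectivity and a lower bound. The lower bound
  passes to subspaces without change, surjectivity does not.\<close>

definition regular_point :: "complex \<Rightarrow> real \<Rightarrow> bool"
  where "regular_point z K \<longleftrightarrow> 0 \<le> K \<and>
    (\<forall>f\<in>X. \<exists>g\<in>X. T g - cscale z g = f) \<and> (\<forall>g\<in>X. N g \<le> K * N (T g - cscale z g))"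

lemma T_diff: "f \<in> X \<Longrightarrow> g \<in> X \<Longrightarrow> T (f - g) = T f - T g"
  using T_add[of "f - g" g] by (simp add: diff_mem)

lemma T_zero: "T 0 = 0"
  using T_scale[OF zero_mem, of 0] by (simp add: cscale_simps)

lemma shift_mem: "g \<in> X \<Longrightarrow> T g - cscale z g \<in> X"
  by (intro diff_mem T_mem scale_mem)

lemma shift_add: "f \<in> X \<Longrightarrow> g \<in> X \<Longrightarrow>
  T (f + g) - cscale z (f + g) = (T f - cscale z f) + (T g - cscale z g)"
  by (simp add: T_add cscale_simps)

lemma shift_diff: "f \<in> X \<Longrightarrow> g \<in> X \<Longrightarrow>
  T (f - g) - cscale z (f - g) = (T f - cscale z f) - (T g - cscale z g)"
  by (simp add: T_diff cscale_simps)

lemma shift_scale: "f \<in> X \<Longrightarrow>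
  T (cscale c f) - cscale z (cscale c f) = cscale c (T f - cscale z f)"
  by (simp add: T_scale cscale_simps mult.commute)

lemma regular_point_inj:
  assumes "regular_point z K" "f \<in> X" "g \<in> X" "T f - cscale z f = T g - cscale z g"
  shows "f = g"
proof -
  have "N (f - g) \<le> K * N 0"
    using assms shift_diff[of f g z] unfolding regular_point_def by (metis diff_mem diff_self)
  then have "N (f - g) = 0" using norm_nonneg[of "f - g"] assms by (simp add: diff_mem norm_zero)
  then show ?thesis using norm_eq_0[of "f - g"] assms by (simp add: diff_mem)
qed

lemma not_in_spectrum_iff: "z \<notin> op_spectrum X N T \<longleftrightarrow> (\<exists>K. regular_point z K)"
proof
  assume "z \<notin> op_spectrum X N T"
  then obtain R K where R: "\<And>f. f \<in> X \<Longrightarrow> R f \<in> X" "\<And>f. f \<in> X \<Longrightarrow> N (R f) \<le> K * N f"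
    "\<And>f. f \<in> X \<Longrightarrow> R (T f - cscale z f) = f" "\<And>f. f \<in> X \<Longrightarrow> T (R f) - cscale z (R f) = f"
    unfolding op_spectrum_def bounded_op_on_def by blast
  have "N g \<le> max 0 K * N (T g - cscale z g)" if "g \<in> X" for g
  proof -
    have "N g \<le> K * N (T g - cscale z g)"
      using R(2)[OF shift_mem[OF that, of z]] R(3)[OF that] by simp
    also have "\<dots> \<le> max 0 K * N (T g - cscale z g)"
      using that by (intro mult_right_mono norm_nonneg shift_mem) auto
    finally show ?thesis .
  qed
  then have "regular_point z (max 0 K)"
    using R unfolding regular_point_def by (meson max.cobounded1)
  then show "\<exists>K. regular_point z K" by blast
next
  assume "\<exists>K. regular_point z K"
  then obtain K where K: "regular_point z K" by blast
  obtain R where R: "\<And>f. f \<in> X \<Longrightarrow> R f \<in> X \<and> T (R f) - cscale z (R f) = f"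
    using K unfolding regular_point_def by metis
  have eq: "R f = g" if "g \<in> X" "T g - cscale z g = f" for f g
  proof (rule regular_point_inj[OF K _ that(1)])
    have "f \<in> X" using that shift_mem[of g z] by simp
    then show "R f \<in> X" "T (R f) - cscale z (R f) = T g - cscale z g" using R that by simp_all
  qed
  have "bounded_op_on X N R"
    unfolding bounded_op_on_def
  proof (intro conjI ballI allI)
    fix f assume "f \<in> X" then show "R f \<in> X" using R by blast
  next
    fix f g assume "f \<in> X" "g \<in> X"
    then show "R (f + g) = R f + R g"
      using R by (intro eq add_mem) (simp_all add: shift_add)
  next
    fix c f assume "f \<in> X"
    then show "R (cscale c f) = cscale c (R f)"
      using R by (intro eq scale_mem) (simp_all only: shift_scale)
  next
    have "N (R f) \<le> K * N f" if "f \<in> X" for f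
      using K R[OF that] unfolding regular_point_def by metis
    then show "\<exists>K. \<forall>f\<in>X. N (R f) \<le> K * N f" by blast
  qed
  moreover have "R (T f - cscale z f) = f \<and> T (R f) - cscale z (R f) = f" if "f \<in> X" for f
    using R[OF that] eq[OF that] by simp
  ultimately show "z \<notin> op_spectrum X N T"
    unfolding op_spectrum_def by auto
qed

text \<open>The equation for \<open>T - (z + h)\<close> reads \<open>g = R (f + h g)\<close> with \<open>R = (T - z)\<^sup>-\<^sup>1\<close>, and the right-hand
  side is a contraction in \<open>g\<close> because \<open>\<parallel>R\<parallel> \<le> K\<close> and \<open>|h| K < 1\<close>.\<close>

lemma regular_point_perturb:
  assumes K: "regular_point z K" and h: "norm h * K < 1"
  shows "regular_point (z + h) (K / (1 - norm h * K))"
proof -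
  have K0: "0 \<le> K" using K by (simp add: regular_point_def)
  obtain R where R: "\<And>f. f \<in> X \<Longrightarrow> R f \<in> X" "\<And>f. f \<in> X \<Longrightarrow> T (R f) - cscale z (R f) = f"
    using K unfolding regular_point_def by metis
  have split: "T g - cscale (z + h) g = (T g - cscale z g) - cscale h g" for g
    by (auto simp: pointwise algebra_simps)
  have lower: "N g \<le> K / (1 - norm h * K) * N (T g - cscale (z + h) g)" if g: "g \<in> X" for g
  proof -
    have "T g - cscale z g = (T g - cscale (z + h) g) + cscale h g"
      by (auto simp: pointwise algebra_simps)
    then have "N (T g - cscale z g) \<le> N (T g - cscale (z + h) g) + norm h * N g"
      using norm_add[OF shift_mem[OF g] scale_mem[OF g], of "z + h" h] norm_scale[OF g, of h]
      by (simp only:)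
    moreover have "N g \<le> K * N (T g - cscale z g)" using K g by (simp add: regular_point_def)
    ultimately have "N g \<le> K * (N (T g - cscale (z + h) g) + norm h * N g)"
      using K0 by (meson mult_left_mono order_trans)
    then have "(1 - norm h * K) * N g \<le> K * N (T g - cscale (z + h) g)"
      by (simp add: algebra_simps)
    then show ?thesis using h by (simp add: field_simps)
  qed
  have "\<exists>g\<in>X. T g - cscale (z + h) g = f" if f: "f \<in> X" for f
  proof -
    have "\<exists>g\<in>X. R (f + cscale h g) = g"
    proof (rule contraction_fixed_point[where q = "norm h * K"])
      fix a b assume a: "a \<in> X" and b: "b \<in> X"
      let ?d = "R (f + cscale h a) - R (f + cscale h b)"
      have fa: "f + cscale h a \<in> X" and fb: "f + cscale h b \<in> X"
        using a b f by (auto intro: add_mem scale_mem)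
      have "T ?d - cscale z ?d = cscale h (a - b)"
        using R fa fb by (simp only: shift_diff) (auto simp: pointwise algebra_simps)
      moreover have "?d \<in> X" using R fa fb by (intro diff_mem) auto
      ultimately have "N ?d \<le> K * N (cscale h (a - b))"
        using K unfolding regular_point_def by metis
      then show "N ?d \<le> norm h * K * N (a - b)"
        using a b by (simp add: norm_scale diff_mem mult_ac)
    qed (use R f K0 h in \<open>auto intro: add_mem scale_mem\<close>)
    then obtain g where g: "g \<in> X" "R (f + cscale h g) = g" by blast
    then have "T g - cscale z g = f + cscale h g"
      using R(2)[of "f + cscale h g"] f by (simp add: add_mem scale_mem)
    then show ?thesis using g(1) by (intro bexI[of _ g]) (simp_all add: split)
  qed
  then show ?thesis using lower K0 h by (simp add: regular_point_def)
qed

text \<open>Here the equation reads \<open>g = (T g - f) / z\<close>.\<close>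

lemma regular_point_outside:
  assumes K: "0 \<le> K" "\<And>f. f \<in> X \<Longrightarrow> N (T f) \<le> K * N f" and z: "K < norm z"
  shows "\<exists>L. regular_point z L"
proof -
  have nz: "z \<noteq> 0" using K z by auto
  have lower: "N g \<le> 1 / (norm z - K) * N (T g - cscale z g)" if g: "g \<in> X" for g
  proof -
    have "cscale z g = T g - (T g - cscale z g)" by simp
    then have "norm z * N g \<le> N (T g) + N (T g - cscale z g)"
      using norm_diff[OF T_mem[OF g] shift_mem[OF g, of z]] norm_scale[OF g, of z] by simp
    then have "(norm z - K) * N g \<le> N (T g - cscale z g)"
      using K(2)[OF g] by (simp add: algebra_simps)
    then show ?thesis using z by (simp add: field_simps)
  qed
  have "\<exists>g\<in>X. T g - cscale z g = f" if f: "f \<in> X" for f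
  proof -
    have "\<exists>g\<in>X. cscale (1 / z) (T g - f) = g"
    proof (rule contraction_fixed_point[where q = "K / norm z"])
      fix a b assume a: "a \<in> X" and b: "b \<in> X"
      have "cscale (1 / z) (T a - f) - cscale (1 / z) (T b - f) = cscale (1 / z) (T (a - b))"
        using a b by (simp add: T_diff cscale_simps)
      then show "N (cscale (1 / z) (T a - f) - cscale (1 / z) (T b - f)) \<le> K / norm z * N (a - b)"
        using K(2)[OF diff_mem[OF a b]] nz a b
        by (simp add: norm_scale T_mem diff_mem norm_divide divide_simps)
    qed (use f K z nz in \<open>auto intro: diff_mem scale_mem T_mem\<close>)
    then obtain g where g: "g \<in> X" "cscale (1 / z) (T g - f) = g" by blast
    have "cscale z g = T g - f"
      using arg_cong[OF g(2), of "cscale z"] nz by (simp add: cscale_simps)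
    then show ?thesis using g(1) by (intro bexI[of _ g]) simp_all
  qed
  then have "regular_point z (1 / (norm z - K))" using lower z by (simp add: regular_point_def)
  then show ?thesis by blast
qed

lemma regular_point_nbhd:
  assumes K: "regular_point z K"
  shows "\<exists>r>0. \<exists>B. \<forall>w\<in>ball z r. regular_point w B"
proof -
  have K0: "0 \<le> K" using K by (simp add: regular_point_def)
  define r where "r = 1 / (2 * (K + 1))"
  have r: "0 < r" using K0 by (simp add: r_def)
  have "regular_point w (2 * K)" if "w \<in> ball z r" for w
  proof -
    have "norm (w - z) \<le> r" using that by (simp add: dist_norm norm_minus_commute)
    then have "norm (w - z) * K \<le> r * K" using K0 by (rule mult_right_mono)
    also have "r * K \<le> 1 / 2" using K0 by (simp add: r_def field_simps)
    finally have le: "norm (w - z) * K \<le> 1 / 2" .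
    then have reg: "regular_point w (K / (1 - norm (w - z) * K))"
      using regular_point_perturb[OF K, of "w - z"] by simp
    have fac: "K / (1 - norm (w - z) * K) \<le> K / (1 / 2)"
      using le K0 by (intro divide_left_mono) auto
    have "N g \<le> 2 * K * N (T g - cscale w g)" if "g \<in> X" for g
    proof -
      have "N g \<le> K / (1 - norm (w - z) * K) * N (T g - cscale w g)"
        using reg that by (simp add: regular_point_def)
      also have "\<dots> \<le> K / (1 / 2) * N (T g - cscale w g)"
        using fac norm_nonneg[OF shift_mem[OF that]]
        by (rule mult_right_mono)
      finally show ?thesis by (simp add: mult.commute)
    qed
    then show ?thesis using reg K0 unfolding regular_point_def by simp
  qed
  then show ?thesis using r by blast
qed

text \<open>Near a regular point the resolvents \<open>R\<^sub>w\<close> are uniformly bounded, and the resolvent identity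
  \<open>R\<^sub>v f - R\<^sub>w f = (v - w) R\<^sub>w R\<^sub>v f\<close> exhibits \<open>R\<^sub>w R\<^sub>w f\<close> as the derivative of \<open>w \<mapsto> R\<^sub>w f\<close>.\<close>

lemma local_solution:
  assumes z: "z \<notin> op_spectrum X N T" and f: "f \<in> X"
  shows "\<exists>U F. open U \<and> z \<in> U \<and> analytic_into X N U F \<and> (\<forall>w\<in>U. T (F w) - cscale w (F w) = f)"
proof -
  obtain r B where r: "0 < r" and B: "\<And>w. w \<in> ball z r \<Longrightarrow> regular_point w B"
    using z regular_point_nbhd not_in_spectrum_iff by meson
  have B0: "0 \<le> B" using B[of z] r by (simp add: regular_point_def)
  have "\<forall>w f. \<exists>g. w \<in> ball z r \<and> f \<in> X \<longrightarrow> g \<in> X \<and> T g - cscale w g = f"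
  proof (intro allI)
    fix w f show "\<exists>g. w \<in> ball z r \<and> f \<in> X \<longrightarrow> g \<in> X \<and> T g - cscale w g = f"
      using B[of w] unfolding regular_point_def by (cases "w \<in> ball z r \<and> f \<in> X") blast+
  qed
  then obtain R where R: "\<And>w f. w \<in> ball z r \<Longrightarrow> f \<in> X \<Longrightarrow> R w f \<in> X"
    "\<And>w f. w \<in> ball z r \<Longrightarrow> f \<in> X \<Longrightarrow> T (R w f) - cscale w (R w f) = f"
    by metis
  have bound: "N g \<le> B * N (T g - cscale w g)" if "w \<in> ball z r" "g \<in> X" for w g
    using B[OF that(1)] that(2) by (simp add: regular_point_def)
  define F where "F w = R w f" for w
  have F: "F w \<in> X" "T (F w) - cscale w (F w) = f" "N (F w) \<le> B * N f" if "w \<in> ball z r" for w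
    using R[OF that f] bound[OF that, of "F w"] by (auto simp: F_def)
  have step: "T (F v - F w) - cscale w (F v - F w) = cscale (v - w) (F v)"
    if "v \<in> ball z r" "w \<in> ball z r" for v w
  proof -
    have "T (F v) = f + cscale v (F v)" "T (F w) = f + cscale w (F w)"
      using F that by (simp_all add: shifted_operator_eq_iff)
    then show ?thesis using F that by (simp add: T_diff pointwise algebra_simps)
  qed
  have lip: "N (F v - F w) \<le> B * (norm (v - w) * (B * N f))"
    if "v \<in> ball z r" "w \<in> ball z r" for v w
  proof -
    have "N (F v - F w) \<le> B * N (cscale (v - w) (F v))"
      using bound[OF that(2), of "F v - F w"] step[OF that] F that by (simp add: diff_mem)
    also have "N (cscale (v - w) (F v)) = norm (v - w) * N (F v)"
      using F that by (simp add: norm_scale)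
    also have "\<dots> \<le> norm (v - w) * (B * N f)"
      using F that by (intro mult_left_mono) auto
    finally show ?thesis using B0 by (simp add: mult_left_mono)
  qed
  have "analytic_into X N (ball z r) F"
    unfolding analytic_into_def
  proof (intro conjI ballI)
    fix w assume w: "w \<in> ball z r"
    define D where "D = R w (F w)"
    have D: "D \<in> X" "T D - cscale w D = F w" using R[OF w F(1)[OF w]] by (auto simp: D_def)
    have est: "N (cscale (1 / (v - w)) (F v - F w) - D) \<le> B * (B * (norm (v - w) * (B * N f)))"
      if v: "v \<in> ball z r" "v \<noteq> w" for v
    proof -
      let ?q = "cscale (1 / (v - w)) (F v - F w)"
      have q: "?q \<in> X" using F v w by (intro scale_mem diff_mem) auto
      have "T ?q - cscale w ?q = cscale (1 / (v - w)) (cscale (v - w) (F v))"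
        using F v w step[OF v(1) w] by (simp add: shift_scale diff_mem)
      then have "T ?q - cscale w ?q = F v" using v by (simp add: cscale_simps)
      then have "T (?q - D) - cscale w (?q - D) = F v - F w"
        using D q by (simp add: shift_diff)
      then have "N (?q - D) \<le> B * N (F v - F w)"
        using bound[OF w diff_mem[OF q D(1)]] by simp
      also have "\<dots> \<le> B * (B * (norm (v - w) * (B * N f)))"
        using lip[OF v(1) w] B0 by (rule mult_left_mono)
      finally show ?thesis .
    qed
    have ev: "\<forall>\<^sub>F v in at w within ball z r. v \<in> ball z r \<and> v \<noteq> w"
      by (auto simp: eventually_at_filter)
    have "((\<lambda>v. N (cscale (1 / (v - w)) (F v - F w) - D)) \<longlongrightarrow> 0) (at w within ball z r)"
    proof (rule tendsto_sandwich)
      show "\<forall>\<^sub>F v in at w within ball z r. 0 \<le> N (cscale (1 / (v - w)) (F v - F w) - D)"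
        using ev by eventually_elim (intro norm_nonneg diff_mem scale_mem F(1) w D(1), simp)
      show "\<forall>\<^sub>F v in at w within ball z r.
          N (cscale (1 / (v - w)) (F v - F w) - D) \<le> B * (B * (norm (v - w) * (B * N f)))"
        using ev by eventually_elim (intro est, simp_all)
      have "((\<lambda>v. B * (B * (norm (v - w) * (B * N f)))) \<longlongrightarrow> B * (B * (norm (w - w) * (B * N f))))
          (at w within ball z r)"
        by (intro tendsto_intros)
      then show "((\<lambda>v. B * (B * (norm (v - w) * (B * N f)))) \<longlongrightarrow> 0) (at w within ball z r)"
        by simp
    qed simp
    then show "\<exists>D\<in>X. ((\<lambda>v. N (cscale (1 / (v - w)) (F v - F w) - D)) \<longlongrightarrow> 0) (at w within ball z r)"
      using D by blast
  qed (rule F(1))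
  then have "open (ball z r) \<and> z \<in> ball z r \<and> analytic_into X N (ball z r) F \<and>
      (\<forall>w\<in>ball z r. T (F w) - cscale w (F w) = f)"
    using F(2) r centre_in_ball open_ball by metis
  then show ?thesis by (intro exI[where x = "ball z r"] exI[where x = F])
qed

end

context function_operator
begin

text \<open>Since the lower bound is inherited from \<open>X\<close> with the same constant, the radius up to which
  regularity on \<open>Y\<close> can be continued is bounded from below near every point of \<open>S\<close>. So the set of
  points that are regular for \<open>Y\<close> is open and closed in \<open>S\<close>.\<close>

lemma regular_point_subspace:
  assumes sub: "function_operator Y N T" "Y \<subseteq> X" and S: "connected S"
    and reg: "\<And>z. z \<in> S \<Longrightarrow> \<exists>K. regular_point z K"
    and a: "a \<in> S" "\<exists>K. function_operator.regular_point Y N T a K" and b: "b \<in> S"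
  shows "\<exists>K. function_operator.regular_point Y N T b K"
proof -
  interpret Y: function_operator Y N T by (rule sub)
  show ?thesis
  proof (rule connected_induction_simple[where P = "\<lambda>z. \<exists>K. Y.regular_point z K", OF S a(1) b a(2)])
    fix z assume z: "z \<in> S"
    then obtain r B where r: "0 < r" and B: "\<And>w. w \<in> ball z r \<Longrightarrow> regular_point w B"
      using reg regular_point_nbhd by meson
    have B0: "0 \<le> B" using B[of z] r by (simp add: regular_point_def)
    define e where "e = min r (1 / (2 * (B + 1)))"
    have e: "0 < e" "e \<le> r" "2 * e * B < 1"
    proof -
      show "0 < e" "e \<le> r" using r B0 by (auto simp: e_def)
      have "2 * e * B \<le> 2 * (1 / (2 * (B + 1))) * B" using B0 by (intro mult_right_mono mult_left_mono) (auto simp: e_def)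
      also have "\<dots> < 1" using B0 by (simp add: field_simps)
      finally show "2 * e * B < 1" .
    qed
    have "\<exists>K. Y.regular_point y K"
      if xy: "x \<in> ball z e" "y \<in> ball z e" and x: "\<exists>K. Y.regular_point x K" for x y
    proof -
      have "regular_point x B" using B[of x] xy e by simp
      then have "Y.regular_point x B"
        using x sub(2) unfolding regular_point_def Y.regular_point_def by blast
      moreover have "norm (y - x) * B < 1"
      proof -
        have "norm (y - x) \<le> norm (y - z) + norm (z - x)" using norm_triangle_ineq[of "y - z" "z - x"] by simp
        also have "\<dots> \<le> e + e" using xy by (intro add_mono) (auto simp: dist_norm norm_minus_commute)
        finally have "norm (y - x) * B \<le> 2 * e * B" using B0 by (intro mult_right_mono) auto
        then show ?thesis using e by simp
      qed
      ultimately have "Y.regular_point (x + (y - x)) (B / (1 - norm (y - x) * B))"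
        by (rule Y.regular_point_perturb)
      then have "Y.regular_point y (B / (1 - norm (y - x) * B))"
        unfolding add_diff_eq add_diff_cancel_left' .
      then show ?thesis ..
    qed
    then have "\<forall>x\<in>S \<inter> ball z e. \<forall>y\<in>S \<inter> ball z e.
        (\<exists>K. Y.regular_point x K) \<longrightarrow> (\<exists>K. Y.regular_point y K)" by blast
    moreover have "openin (top_of_set S) (S \<inter> ball z e)" "z \<in> S \<inter> ball z e"
      using z e by (simp_all add: openin_open_Int)
    ultimately show "\<exists>T'. openin (top_of_set S) T' \<and> z \<in> T' \<and>
        (\<forall>x\<in>T'. \<forall>y\<in>T'. (\<exists>K. Y.regular_point x K) \<longrightarrow> (\<exists>K. Y.regular_point y K))"
      by blast
  qed
qed

context
  fixes K :: real
  assumes K0: "0 \<le> K" and T_bound: "\<And>f. f \<in> X \<Longrightarrow> N (T f) \<le> K * N f"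
begin

lemma iterate_mem: "f \<in> X \<Longrightarrow> (T ^^ n) f \<in> X"
  by (induction n) (auto intro: T_mem)

lemma iterate_bound: "f \<in> X \<Longrightarrow> N ((T ^^ n) f) \<le> K ^ n * N f"
proof -
  assume f: "f \<in> X"
  define d where "d n = N ((T ^^ n) f)" for n
  have "d n \<le> K ^ n * d 0" for n
  proof (induction n)
    case (Suc n)
    have "d (Suc n) \<le> K * d n" using T_bound[OF iterate_mem[OF f, of n]] by (simp add: d_def)
    also have "\<dots> \<le> K * (K ^ n * d 0)" using Suc K0 by (rule mult_left_mono)
    finally show ?case by simp
  qed simp
  then show ?thesis by (simp add: d_def)
qed

text \<open>The iteration \<open>g \<mapsto> (T g - f) / z\<close> started at \<open>0\<close> produces the partial sums of the Neumann series
  of \<open>f\<close>, so it converges as soon as this single orbit grows more slowly than \<open>|z|\<^sup>n\<close>.\<close>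

lemma Neumann_solution:
  assumes f: "f \<in> X" and growth: "\<And>n. N ((T ^^ n) f) \<le> B * R ^ n" and R: "0 < R" "R < norm z"
  shows "\<exists>g\<in>X. T g - cscale z g = f"
proof -
  have z: "z \<noteq> 0" using R by auto
  define A where "A g = cscale (1 / z) (T g - f)" for g
  define u where "u n = (A ^^ n) 0" for n
  have A: "A g \<in> X" if "g \<in> X" for g unfolding A_def by (intro scale_mem diff_mem T_mem that f)
  have u: "u n \<in> X" for n
    unfolding u_def by (induction n) (auto intro: A zero_mem)
  have A_diff: "A g - A h = cscale (1 / z) (T (g - h))" if "g \<in> X" "h \<in> X" for g h
    using that by (simp add: A_def T_diff cscale_simps)
  have step: "u (Suc n) - u n = cscale (- (1 / z ^ Suc n)) ((T ^^ n) f)" for n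
  proof (induction n)
    case 0
    show ?case by (simp add: u_def A_def T_zero) (auto simp: pointwise)
  next
    case (Suc n)
    have "u (Suc (Suc n)) - u (Suc n) = A (u (Suc n)) - A (u n)" by (simp add: u_def)
    also have "\<dots> = cscale (1 / z) (T (u (Suc n) - u n))" by (rule A_diff[OF u u])
    also have "\<dots> = cscale (1 / z) (T (cscale (- (1 / z ^ Suc n)) ((T ^^ n) f)))"
      by (rule arg_cong[of _ _ "\<lambda>h. cscale (1 / z) (T h)"]) (rule Suc)
    also have "\<dots> = cscale (- (1 / z ^ Suc (Suc n))) ((T ^^ Suc n) f)"
      using iterate_mem[OF f, of n] by (simp add: T_scale cscale_simps)
    finally show ?case .
  qed
  have "N (u (Suc n) - u n) \<le> B / norm z * (R / norm z) ^ n" for n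
  proof -
    have "N (u (Suc n) - u n) = N ((T ^^ n) f) / norm z ^ Suc n"
      unfolding step by (simp add: norm_scale iterate_mem f norm_divide norm_power norm_mult)
    also have "\<dots> \<le> B * R ^ n / norm z ^ Suc n" using growth z by (intro divide_right_mono) auto
    finally show ?thesis by (simp add: power_divide)
  qed
  moreover have "0 \<le> R / norm z" "R / norm z < 1" using R z by auto
  ultimately obtain g where g: "g \<in> X" "(\<lambda>n. N (u n - g)) \<longlonglongrightarrow> 0"
    using geometric_steps_converge[of u "R / norm z" "B / norm z"] u by blast
  have "A g = g"
  proof (rule norm_le_of_limit[OF A[OF g(1)] g(1)])
    have "(\<lambda>n. K / norm z * N (u n - g) + N (u (Suc n) - g)) \<longlonglongrightarrow> K / norm z * 0 + 0"
      using g(2) LIMSEQ_Suc[OF g(2)] by (intro tendsto_intros)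
    then show "(\<lambda>n. K / norm z * N (u n - g) + N (u (Suc n) - g)) \<longlonglongrightarrow> 0" by simp
    show "N (A g - g) \<le> K / norm z * N (u n - g) + N (u (Suc n) - g)" for n
    proof -
      have "N (A g - g) \<le> N (A g - A (u n)) + N (A (u n) - g)"
        by (rule norm_triangle[OF A[OF g(1)] A[OF u] g(1)])
      also have "N (A g - A (u n)) = N (T (g - u n)) / norm z"
        using g u by (simp add: A_diff norm_scale T_mem diff_mem norm_divide)
      also have "\<dots> \<le> K * N (g - u n) / norm z"
        using g u by (intro divide_right_mono T_bound diff_mem) auto
      also have "N (g - u n) = N (u n - g)" by (rule norm_diff_commute[OF g(1) u])
      also have "A (u n) = u (Suc n)" by (simp add: u_def)
      finally show ?thesis by simp
    qed
  qed
  then have "cscale z g = cscale z (A g)" by simp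
  also have "\<dots> = T g - f" using z by (simp add: A_def cscale_simps)
  finally show ?thesis using g(1) by (intro bexI[of _ g]) simp_all
qed

text \<open>Iterating \<open>g = f + w T g\<close> gives \<open>g = f + w T f + \<dots> + w\<^sup>m\<^sup>-\<^sup>1 T\<^sup>m\<^sup>-\<^sup>1 f + w\<^sup>m T\<^sup>m g\<close>, and the remainder
  tends to \<open>0\<close> under \<open>\<phi>\<close> if \<open>|w| K < 1\<close>.\<close>

lemma pencil_expansion:
  assumes f: "f \<in> X" and g: "g \<in> X" "g - cscale w (T g) = f"
    and \<phi>: "\<And>h h'. h \<in> X \<Longrightarrow> h' \<in> X \<Longrightarrow> \<phi> (h + h') = \<phi> h + \<phi> h'"
      "\<And>c h. h \<in> X \<Longrightarrow> \<phi> (cscale c h) = c * \<phi> h" "\<And>h. h \<in> X \<Longrightarrow> norm (\<phi> h :: complex) \<le> A * N h"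
    and w: "norm w * K < 1"
  shows "(\<lambda>n. \<phi> ((T ^^ n) f) * w ^ n) sums \<phi> g"
proof -
  have g_eq: "g = f + cscale w (T g)" using g(2) by (metis diff_add_cancel)
  have iter: "\<phi> ((T ^^ n) g) = \<phi> ((T ^^ n) f) + w * \<phi> ((T ^^ Suc n) g)" for n
  proof -
    have "(T ^^ n) (h + h') = (T ^^ n) h + (T ^^ n) h'" if "h \<in> X" "h' \<in> X" for h h'
      using that by (induction n arbitrary: h h') (simp_all add: funpow_Suc_right T_add T_mem del: funpow.simps(2))
    moreover have "(T ^^ n) (cscale c h) = cscale c ((T ^^ n) h)" if "h \<in> X" for c h
      using that by (induction n arbitrary: h) (simp_all add: funpow_Suc_right T_scale T_mem del: funpow.simps(2))
    ultimately have "(T ^^ n) (f + cscale w (T g)) = (T ^^ n) f + cscale w ((T ^^ n) (T g))"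
      using f g(1) by (simp add: scale_mem T_mem)
    then have "(T ^^ n) g = (T ^^ n) f + cscale w ((T ^^ Suc n) g)"
      using g_eq by (metis funpow_Suc_right comp_apply)
    then have "\<phi> ((T ^^ n) g) = \<phi> ((T ^^ n) f + cscale w ((T ^^ Suc n) g))" by (rule arg_cong)
    also have "\<dots> = \<phi> ((T ^^ n) f) + w * \<phi> ((T ^^ Suc n) g)"
      using \<phi>(1)[OF iterate_mem[OF f, of n] scale_mem[OF iterate_mem[OF g(1), of "Suc n"], of w]]
        \<phi>(2)[OF iterate_mem[OF g(1), of "Suc n"], of w] by simp
    finally show ?thesis .
  qed
  have partial: "\<phi> g = (\<Sum>n<m. \<phi> ((T ^^ n) f) * w ^ n) + w ^ m * \<phi> ((T ^^ m) g)" for m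
  proof (induction m)
    case (Suc m)
    have "w ^ m * \<phi> ((T ^^ m) g) = \<phi> ((T ^^ m) f) * w ^ m + w ^ Suc m * \<phi> ((T ^^ Suc m) g)"
      unfolding iter[of m] by (simp add: algebra_simps)
    then show ?case using Suc by simp
  qed simp
  have rest: "(\<lambda>m. w ^ m * \<phi> ((T ^^ m) g)) \<longlonglongrightarrow> 0"
  proof (rule Lim_null_comparison)
    have "norm (w ^ m * \<phi> ((T ^^ m) g)) \<le> (norm w * K) ^ m * (\<bar>A\<bar> * N g)" for m
    proof -
      have "norm (\<phi> ((T ^^ m) g)) \<le> A * N ((T ^^ m) g)" by (rule \<phi>(3)[OF iterate_mem[OF g(1)]])
      also have "\<dots> \<le> \<bar>A\<bar> * N ((T ^^ m) g)"
        using norm_nonneg[OF iterate_mem[OF g(1)]] by (intro mult_right_mono) auto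
      also have "\<dots> \<le> \<bar>A\<bar> * (K ^ m * N g)" using iterate_bound[OF g(1)] by (intro mult_left_mono) auto
      finally have "norm w ^ m * norm (\<phi> ((T ^^ m) g)) \<le> norm w ^ m * (\<bar>A\<bar> * (K ^ m * N g))"
        by (intro mult_left_mono) auto
      then show ?thesis by (simp add: norm_mult norm_power power_mult_distrib mult_ac)
    qed
    then show "\<forall>\<^sub>F m in sequentially. norm (w ^ m * \<phi> ((T ^^ m) g)) \<le> (norm w * K) ^ m * (\<bar>A\<bar> * N g)" by simp
    have "(\<lambda>m. (norm w * K) ^ m) \<longlonglongrightarrow> 0" using w K0 by (intro LIMSEQ_power_zero) simp
    then show "(\<lambda>m. (norm w * K) ^ m * (\<bar>A\<bar> * N g)) \<longlonglongrightarrow> 0" by (rule tendsto_mult_left_zero)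
  qed
  have "(\<lambda>m. \<phi> g - w ^ m * \<phi> ((T ^^ m) g)) \<longlonglongrightarrow> \<phi> g - 0"
    by (intro tendsto_intros rest)
  moreover have "\<phi> g - w ^ m * \<phi> ((T ^^ m) g) = (\<Sum>n<m. \<phi> ((T ^^ n) f) * w ^ n)" for m
    using partial[of m] by simp
  ultimately show ?thesis by (simp add: sums_def)
qed

text \<open>This replaces the spectral radius formula. With \<open>w = 1/z\<close> the solution \<open>E w\<close> of \<open>E - w T E = f\<close> is
  defined and depends analytically on \<open>w\<close> in the disc \<open>|w| < 1/s\<close>, and by \<open>pencil_expansion\<close> the Taylor
  coefficients of \<open>\<phi> (E w)\<close> at \<open>0\<close> are the numbers \<open>\<phi> (T\<^sup>n f)\<close>. Cauchy's estimate on the circle \<open>|w| = 1/R\<close>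
  bounds them. The constant \<open>B\<close> is the maximum of \<open>\<parallel>E w\<parallel>\<close> on that circle; it does not depend on
  \<open>\<phi>\<close> or \<open>n\<close>, which is what allows a norming functional of \<open>T\<^sup>n f\<close> to be inserted later.\<close>

lemma iterate_functional_bound:
  assumes reg: "\<And>z. s < norm z \<Longrightarrow> \<exists>L. regular_point z L" and s: "0 < s" and R: "s < R" and f: "f \<in> X"
  shows "\<exists>B\<ge>0. \<forall>\<phi> A n. 0 \<le> A \<longrightarrow> (\<forall>h\<in>X. \<forall>h'\<in>X. \<phi> (h + h') = \<phi> h + \<phi> h') \<longrightarrow>
    (\<forall>c. \<forall>h\<in>X. \<phi> (cscale c h) = c * \<phi> h) \<longrightarrow> (\<forall>h\<in>X. norm (\<phi> h :: complex) \<le> A * N h) \<longrightarrow>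
    norm (\<phi> ((T ^^ n) f)) \<le> A * B * R ^ n"
proof -
  let ?D = "ball (0::complex) (1 / s)"
  have pencil: "\<exists>L\<ge>0. (\<forall>h\<in>X. \<exists>g\<in>X. g - cscale w (T g) = h) \<and> (\<forall>g\<in>X. N g \<le> L * N (g - cscale w (T g)))"
    if w: "w \<in> ?D" for w
  proof (cases "w = 0")
    case True
    then show ?thesis by (intro exI[of _ 1]) (auto simp: cscale_simps)
  next
    case False
    have "s < norm (1 / w)" using w s False by (simp add: norm_divide field_simps)
    then obtain L where L: "regular_point (1 / w) L" using reg by blast
    have eq: "g - cscale w (T g) = cscale (- w) (T g - cscale (1 / w) g)" for g
      using False by (auto simp: pointwise field_simps)
    show ?thesis
    proof (intro exI[of _ "L / norm w"] conjI ballI)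
      show "0 \<le> L / norm w" using L by (simp add: regular_point_def)
      fix h assume "h \<in> X"
      then have "cscale (- 1 / w) h \<in> X" by (rule scale_mem)
      then obtain g where "g \<in> X" "T g - cscale (1 / w) g = cscale (- 1 / w) h"
        using L unfolding regular_point_def by blast
      then show "\<exists>g\<in>X. g - cscale w (T g) = h"
        using False by (intro bexI[of _ g]) (simp_all add: eq cscale_simps)
    next
      fix g assume g: "g \<in> X"
      have "N g \<le> L * N (T g - cscale (1 / w) g)" using L g by (simp add: regular_point_def)
      then show "N g \<le> L / norm w * N (g - cscale w (T g))"
        using False shift_mem[OF g, of "1 / w"] by (simp add: eq norm_scale)
    qed
  qed
  then obtain L where L: "\<And>w. w \<in> ?D \<Longrightarrow> 0 \<le> L w"
    "\<And>w h. w \<in> ?D \<Longrightarrow> h \<in> X \<Longrightarrow> \<exists>g\<in>X. g - cscale w (T g) = h"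
    "\<And>w g. w \<in> ?D \<Longrightarrow> g \<in> X \<Longrightarrow> N g \<le> L w * N (g - cscale w (T g))"
    by metis
  obtain E where E: "\<And>w. w \<in> ?D \<Longrightarrow> E w \<in> X" "\<And>w. w \<in> ?D \<Longrightarrow> E w - cscale w (T (E w)) = f"
    using L(2)[OF _ f] by metis
  have increment: "(E v - E w) - cscale w (T (E v - E w)) = cscale (v - w) (T (E v))"
    if "v \<in> ?D" "w \<in> ?D" for v w
  proof -
    have "E v - cscale v (T (E v)) = E w - cscale w (T (E w))" using E(2) that by simp
    then show ?thesis using E(1) that by (simp add: T_diff pointwise algebra_simps)
  qed
  have continuity: "((\<lambda>v. N (E v - E w)) \<longlongrightarrow> 0) (at w)" if w: "w \<in> ?D" for w
  proof -
    define c where "c = 1 / (2 * (L w * K + 1))"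
    have LK: "0 \<le> L w * K" using L(1)[OF w] K0 by simp
    have c: "0 < c" using LK by (simp add: c_def add_nonneg_pos)
    have dist: "N (E v - E w) \<le> L w * (norm (v - w) * (K * N (E v)))" if v: "v \<in> ?D" for v
    proof -
      have "N (E v - E w) \<le> L w * N (cscale (v - w) (T (E v)))"
        using L(3)[OF w diff_mem[OF E(1)[OF v] E(1)[OF w]]] unfolding increment[OF v w] .
      also have "N (cscale (v - w) (T (E v))) = norm (v - w) * N (T (E v))"
        by (rule norm_scale[OF T_mem[OF E(1)[OF v]]])
      also have "L w * (norm (v - w) * N (T (E v))) \<le> L w * (norm (v - w) * (K * N (E v)))"
        by (intro mult_left_mono T_bound E(1) v L(1) w) auto
      finally show ?thesis .
    qed
    have near: "N (E v - E w) \<le> (L w * K * (2 * N (E w))) * norm (v - w)" if v: "v \<in> ?D" "norm (v - w) < c" for v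
    proof -
      have "L w * K * norm (v - w) \<le> L w * K * c" using LK v by (intro mult_left_mono) auto
      also have "\<dots> \<le> 1 / 2" using LK by (simp add: c_def field_simps)
      finally have "L w * K * norm (v - w) * N (E v) \<le> 1 / 2 * N (E v)"
        using norm_nonneg[OF E(1)[OF v(1)]] by (rule mult_right_mono)
      then have "N (E v - E w) \<le> 1 / 2 * N (E v)" using dist[OF v(1)] by (simp add: mult_ac)
      moreover have "N (E v) \<le> N (E v - E w) + N (E w)"
        using norm_add[OF diff_mem[OF E(1)[OF v(1)] E(1)[OF w]] E(1)[OF w]] by simp
      ultimately have Ev: "N (E v) \<le> 2 * N (E w)" by simp
      have "L w * K * norm (v - w) * N (E v) \<le> L w * K * norm (v - w) * (2 * N (E w))"
        using Ev L(1)[OF w] K0 by (intro mult_left_mono mult_nonneg_nonneg) auto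
      then show ?thesis using dist[OF v(1)] by (simp add: mult_ac)
    qed
    have ev: "\<forall>\<^sub>F v in at w. v \<in> ?D \<and> norm (v - w) < c"
    proof -
      have "\<forall>\<^sub>F v in nhds w. v \<in> ?D \<inter> ball w c"
        by (rule eventually_nhds_in_open) (use w c in auto)
      then have "\<forall>\<^sub>F v in nhds w. v \<in> ?D \<and> norm (v - w) < c"
        by eventually_elim (auto simp: dist_norm norm_minus_commute)
      then show ?thesis unfolding eventually_nhds_conv_at by blast
    qed
    show ?thesis
    proof (rule tendsto_sandwich[OF _ _ tendsto_const])
      show "\<forall>\<^sub>F v in at w. 0 \<le> N (E v - E w)"
        using ev by eventually_elim (intro norm_nonneg diff_mem E(1) w, simp)
      show "\<forall>\<^sub>F v in at w. N (E v - E w) \<le> (L w * K * (2 * N (E w))) * norm (v - w)"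
        using ev by eventually_elim (intro near, simp_all)
      have "((\<lambda>v. (L w * K * (2 * N (E w))) * norm (v - w)) \<longlongrightarrow> (L w * K * (2 * N (E w))) * norm (w - w)) (at w)"
        by (intro tendsto_intros)
      then show "((\<lambda>v. (L w * K * (2 * N (E w))) * norm (v - w)) \<longlongrightarrow> 0) (at w)" by simp
    qed
  qed
  have R0: "0 < R" using s R by simp
  have "1 / R < 1 / s" using s R R0 by (intro divide_strict_left_mono) auto
  then have sphere: "sphere 0 (1 / R) \<subseteq> ?D" "cball 0 (1 / R) \<subseteq> ?D" by auto
  have "continuous_on (sphere 0 (1 / R)) (\<lambda>w. N (E w))"
  proof (rule continuous_at_imp_continuous_on, rule ballI)
    fix w :: complex assume "w \<in> sphere 0 (1 / R)"
    then have w: "w \<in> ?D" using sphere by blast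
    have "\<forall>\<^sub>F v in nhds w. v \<in> ?D" by (rule eventually_nhds_in_open) (use w in auto)
    then have ev: "\<forall>\<^sub>F v in at w. v \<in> ?D" unfolding eventually_nhds_conv_at by blast
    have "((\<lambda>v. N (E v) - N (E w)) \<longlongrightarrow> 0) (at w)"
    proof (rule Lim_null_comparison[OF _ continuity[OF w]])
      show "\<forall>\<^sub>F v in at w. norm (N (E v) - N (E w)) \<le> N (E v - E w)"
        using ev
      proof eventually_elim
        case (elim v)
        have "N (E v) \<le> N (E v - E w) + N (E w)" "N (E w) \<le> N (E w - E v) + N (E v)"
          using norm_add[OF diff_mem[OF E(1)[OF elim] E(1)[OF w]] E(1)[OF w]]
            norm_add[OF diff_mem[OF E(1)[OF w] E(1)[OF elim]] E(1)[OF elim]] by simp_all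
        then show ?case using norm_diff_commute[OF E(1)[OF elim] E(1)[OF w]] by simp
      qed
    qed
    then show "isCont (\<lambda>w. N (E w)) w" unfolding isCont_def by (rule LIM_zero_cancel)
  qed
  then have "bounded ((\<lambda>w. N (E w)) ` sphere 0 (1 / R))"
    by (intro compact_imp_bounded compact_continuous_image) auto
  then obtain B where "\<forall>x \<in> (\<lambda>w. N (E w)) ` sphere 0 (1 / R). norm x \<le> B"
    unfolding bounded_iff by blast
  then have B: "N (E w) \<le> B" if "w \<in> sphere 0 (1 / R)" for w
    using that abs_ge_self[of "N (E w)"] by force
  have B0: "0 \<le> B"
  proof -
    have "of_real (1 / R) \<in> sphere (0::complex) (1 / R)" using R0 by (simp add: norm_divide)
    then show ?thesis using B norm_nonneg[OF E(1)] sphere(1) by (meson order_trans subsetD)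
  qed
  show ?thesis
  proof (intro exI[of _ B] conjI B0 allI impI)
    fix \<phi> :: "('a \<Rightarrow> complex) \<Rightarrow> complex" and A n
    assume A: "0 \<le> A" and add: "\<forall>h\<in>X. \<forall>h'\<in>X. \<phi> (h + h') = \<phi> h + \<phi> h'"
      and scale: "\<forall>c. \<forall>h\<in>X. \<phi> (cscale c h) = c * \<phi> h"
      and bound: "\<forall>h\<in>X. norm (\<phi> h) \<le> A * N h"
    have diff: "\<phi> (h - h') = \<phi> h - \<phi> h'" if "h \<in> X" "h' \<in> X" for h h'
    proof -
      have "\<phi> ((h - h') + h') = \<phi> (h - h') + \<phi> h'" using add diff_mem[OF that] that(2) by blast
      then show ?thesis by simp
    qed
    have deriv: "((\<lambda>v. \<phi> (E v)) has_field_derivative \<phi> D) (at w)"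
      if w: "w \<in> ?D" and D: "D \<in> X" "D - cscale w (T D) = T (E w)" for w D
    proof -
      have "\<forall>\<^sub>F v in nhds w. v \<in> ?D" by (rule eventually_nhds_in_open) (use w in auto)
      then have "\<forall>\<^sub>F v in at w. v \<in> ?D" unfolding eventually_nhds_conv_at by blast
      then have ev: "\<forall>\<^sub>F v in at w. v \<in> ?D \<and> v \<noteq> w"
        by (intro eventually_conj) (auto simp: eventually_at_filter)
      have "((\<lambda>v. (\<phi> (E v) - \<phi> (E w)) / (v - w) - \<phi> D) \<longlongrightarrow> 0) (at w)"
      proof (rule Lim_null_comparison)
        show "\<forall>\<^sub>F v in at w. norm ((\<phi> (E v) - \<phi> (E w)) / (v - w) - \<phi> D) \<le> \<bar>A\<bar> * (L w * (K * N (E v - E w)))"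
          using ev
        proof eventually_elim
          case (elim v)
          then have v: "v \<in> ?D" "v \<noteq> w" by auto
          let ?q = "cscale (1 / (v - w)) (E v - E w)"
          have q: "?q \<in> X" by (intro scale_mem diff_mem E(1) v w)
          have q_eq: "?q - cscale w (T ?q) = T (E v)"
          proof -
            have "T ?q = cscale (1 / (v - w)) (T (E v - E w))"
              by (rule T_scale[OF diff_mem[OF E(1)[OF v(1)] E(1)[OF w]]])
            then have "?q - cscale w (T ?q) = cscale (1 / (v - w)) ((E v - E w) - cscale w (T (E v - E w)))"
              by (simp only: cscale_simps mult.commute)
            also have "\<dots> = T (E v)" unfolding increment[OF v(1) w] using v by (simp add: cscale_simps)
            finally show ?thesis .
          qed
          have "(?q - D) - cscale w (T (?q - D)) = (?q - cscale w (T ?q)) - (D - cscale w (T D))"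
            using q D(1) by (simp add: T_diff cscale_simps)
          also have "\<dots> = T (E v - E w)" unfolding q_eq D(2) using E(1) v w by (simp add: T_diff)
          finally have "N (?q - D) \<le> L w * N (T (E v - E w))"
            using L(3)[OF w diff_mem[OF q D(1)]] by simp
          also have "\<dots> \<le> L w * (K * N (E v - E w))"
            by (intro mult_left_mono T_bound diff_mem E(1) L(1) v w)
          finally have qD: "N (?q - D) \<le> L w * (K * N (E v - E w))" .
          have "(\<phi> (E v) - \<phi> (E w)) / (v - w) - \<phi> D = \<phi> (?q - D)"
            using E(1) v w q D(1) scale by (simp add: diff diff_mem)
          also have "norm \<dots> \<le> A * N (?q - D)" using bound diff_mem[OF q D(1)] by blast
          also have "\<dots> \<le> \<bar>A\<bar> * N (?q - D)"
            using norm_nonneg[OF diff_mem[OF q D(1)]] by (intro mult_right_mono) auto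
          also have "\<dots> \<le> \<bar>A\<bar> * (L w * (K * N (E v - E w)))" using qD by (intro mult_left_mono) auto
          finally show ?case .
        qed
        have "((\<lambda>v. \<bar>A\<bar> * (L w * (K * N (E v - E w)))) \<longlongrightarrow> \<bar>A\<bar> * (L w * (K * 0))) (at w)"
          by (intro tendsto_intros continuity[OF w])
        then show "((\<lambda>v. \<bar>A\<bar> * (L w * (K * N (E v - E w)))) \<longlongrightarrow> 0) (at w)" by simp
      qed
      then show ?thesis
        unfolding has_field_derivative_iff by (rule LIM_zero_cancel)
    qed
    have hol: "(\<lambda>v. \<phi> (E v)) holomorphic_on ?D"
    proof (rule holomorphic_onI)
      fix w assume w: "w \<in> ?D"
      obtain D where "D \<in> X" "D - cscale w (T D) = T (E w)" using L(2)[OF w T_mem[OF E(1)[OF w]]] by blast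
      from deriv[OF w this] show "(\<lambda>v. \<phi> (E v)) field_differentiable (at w within ?D)"
        by (meson field_differentiable_at_within field_differentiable_def)
    qed
    have "(\<lambda>v. \<phi> (E v)) has_fps_expansion Abs_fps (\<lambda>n. \<phi> ((T ^^ n) f))"
    proof (rule has_fps_expansionI)
      have "\<forall>\<^sub>F w in nhds (0::complex). w \<in> ?D \<inter> ball 0 (1 / (K + 1))"
        by (rule eventually_nhds_in_open) (use s K0 in auto)
      then show "\<forall>\<^sub>F w in nhds 0. (\<lambda>n. fps_nth (Abs_fps (\<lambda>n. \<phi> ((T ^^ n) f))) n * w ^ n) sums \<phi> (E w)"
      proof eventually_elim
        case (elim w)
        then have w: "w \<in> ?D" "norm w < 1 / (K + 1)" by auto
        have "norm w * K \<le> 1 / (K + 1) * K" using w K0 by (intro mult_right_mono) auto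
        also have "\<dots> < 1" using K0 by (simp add: field_simps)
        finally have small: "norm w * K < 1" .
        have "(\<lambda>n. \<phi> ((T ^^ n) f) * w ^ n) sums \<phi> (E w)"
          by (rule pencil_expansion[OF f E(1)[OF w(1)] E(2)[OF w(1)] _ _ _ small]) (use add scale bound in blast)+
        then show ?case by simp
      qed
    qed
    from fps_nth_fps_expansion[OF this, of n]
    have coeff: "(deriv ^^ n) (\<lambda>v. \<phi> (E v)) 0 = fact n * \<phi> ((T ^^ n) f)" by simp
    have "norm ((deriv ^^ n) (\<lambda>v. \<phi> (E v)) 0) \<le> fact n * (\<bar>A\<bar> * B) / (1 / R) ^ n"
    proof (rule Cauchy_inequality)
      show "(\<lambda>v. \<phi> (E v)) holomorphic_on ball 0 (1 / R)"
        by (rule holomorphic_on_subset[OF hol]) (use sphere(2) in auto)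
      show "continuous_on (cball 0 (1 / R)) (\<lambda>v. \<phi> (E v))"
        by (rule continuous_on_subset[OF holomorphic_on_imp_continuous_on[OF hol] sphere(2)])
      show "0 < 1 / R" using R0 by simp
      fix v :: complex assume "norm (0 - v) = 1 / R"
      then have v: "v \<in> sphere 0 (1 / R)" by simp
      then have "norm (\<phi> (E v)) \<le> A * N (E v)" using bound E(1) sphere(1) by blast
      also have "\<dots> \<le> \<bar>A\<bar> * N (E v)"
        using norm_nonneg[OF E(1)] v sphere(1) by (intro mult_right_mono) auto
      also have "\<dots> \<le> \<bar>A\<bar> * B" using B[OF v] by (intro mult_left_mono) auto
      finally show "norm (\<phi> (E v)) \<le> \<bar>A\<bar> * B" .
    qed
    then have main: "norm (\<phi> ((T ^^ n) f)) \<le> \<bar>A\<bar> * B * R ^ n"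
      unfolding coeff using R0 by (simp add: norm_mult power_one_over field_simps)
    then show "norm (\<phi> ((T ^^ n) f)) \<le> A * B * R ^ n" using A by simp
  qed
qed

end

end

declare plus_fun_apply [simp] minus_apply [simp] uminus_apply [simp] zero_fun_apply [simp] cscale_apply [simp]

section \<open>Integral means on circles\<close>

definition circle_mean :: "real \<Rightarrow> (real \<Rightarrow> complex) \<Rightarrow> real"
  where "circle_mean p u = (1 / (2 * pi) * integral {0..2*pi} (\<lambda>t. norm (u t) powr p)) powr (1 / p)"

lemma integral_mean_eq: "integral_mean p r f = circle_mean p (\<lambda>t. f (of_real r * cis t))"
  by (simp add: integral_mean_def circle_mean_def)

lemma powr_convex_combination:
  fixes x y t p :: real
  assumes p: "1 \<le> p" and t: "0 \<le> t" "t \<le> 1" and xy: "0 \<le> x" "0 \<le> y"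
  shows "(t * x + (1 - t) * y) powr p \<le> t * x powr p + (1 - t) * y powr p"
proof -
  have le: "s powr p \<le> s" if "0 \<le> s" "s \<le> 1" for s :: real
    using powr_mono'[OF p, of s] that by (cases "s = 0") auto
  consider "x = 0" | "y = 0" | "0 < x" "0 < y" using xy by linarith
  then show ?thesis
  proof cases
    case 1
    then show ?thesis using le[of "1 - t"] t xy p by (simp add: powr_mult mult_right_mono)
  next
    case 2
    then show ?thesis using le[of t] t xy p by (simp add: powr_mult mult_right_mono)
  next
    case 3
    then show ?thesis using convex_onD[OF powr_convex[OF p], of "1 - t" x y] t
      by (simp add: add.commute)
  qed
qed

context
  fixes p :: real
  assumes p: "1 < p"
begin

lemma norm_powr_continuous:
  fixes u :: "'b::topological_space \<Rightarrow> complex"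
  assumes "continuous_on S u" "0 < q"
  shows "continuous_on S (\<lambda>t. norm (u t) powr q)"
  by (intro continuous_on_powr' continuous_intros assms) (use assms in auto)

lemma norm_powr_integrable:
  assumes "continuous_on {0..2*pi} u"
  shows "(\<lambda>t. c * norm (u t :: complex) powr p) integrable_on {0..2*pi}"
    "(\<lambda>t. norm (u t :: complex) powr p) integrable_on {0..2*pi}"
  by (intro integrable_continuous_real continuous_intros norm_powr_continuous assms; use p in simp)+

lemma integral_powr_nonneg: "0 \<le> integral {0..2*pi} (\<lambda>t. norm (u t :: complex) powr p)"
  by (cases "(\<lambda>t. norm (u t) powr p) integrable_on {0..2*pi}")
     (auto intro: integral_nonneg simp: not_integrable_integral)

lemma circle_mean_nonneg: "0 \<le> circle_mean p u"
  by (simp add: circle_mean_def)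

lemma integral_powr_eq: "integral {0..2*pi} (\<lambda>t. norm (u t) powr p) = 2 * pi * circle_mean p u powr p"
  using p integral_powr_nonneg[of u]
  by (simp add: circle_mean_def powr_powr)

lemma powr_nonneg_inject:
  fixes x y :: real
  assumes "0 \<le> x" "0 \<le> y" "x powr p = y powr p"
  shows "x = y"
  using assms p powr_less_mono2[of p x y] powr_less_mono2[of p y x] by linarith

lemma circle_mean_leI:
  assumes B: "0 \<le> B" and le: "integral {0..2*pi} (\<lambda>t. norm (u t) powr p) \<le> 2 * pi * B powr p"
  shows "circle_mean p u \<le> B"
proof -
  have "circle_mean p u powr p \<le> B powr p" using le by (simp add: integral_powr_eq)
  then show ?thesis using p powr_less_mono2[of p B "circle_mean p u"] B by linarith
qed

lemma circle_mean_le_sup: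
  assumes u: "continuous_on {0..2*pi} u" and B: "0 \<le> B" and le: "\<And>t. t \<in> {0..2*pi} \<Longrightarrow> norm (u t) \<le> B"
  shows "circle_mean p u \<le> B"
proof (rule circle_mean_leI[OF B])
  have "integral {0..2*pi} (\<lambda>t. norm (u t) powr p) \<le> integral {0..2*pi} (\<lambda>t. B powr p)"
    by (intro integral_le norm_powr_integrable u powr_mono2) (use p le in auto)
  then show "integral {0..2*pi} (\<lambda>t. norm (u t) powr p) \<le> 2 * pi * B powr p" by simp
qed

lemma circle_mean_mono:
  assumes u: "continuous_on {0..2*pi} u" and v: "continuous_on {0..2*pi} v" and B: "0 \<le> B"
    and le: "\<And>t. t \<in> {0..2*pi} \<Longrightarrow> norm (u t) \<le> B * norm (v t)"
  shows "circle_mean p u \<le> B * circle_mean p v"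
proof (rule circle_mean_leI)
  have "integral {0..2*pi} (\<lambda>t. norm (u t) powr p)
      \<le> integral {0..2*pi} (\<lambda>t. B powr p * norm (v t) powr p)"
  proof (intro integral_le norm_powr_integrable u)
    show "norm (u t) powr p \<le> B powr p * norm (v t) powr p" if "t \<in> {0..2*pi}" for t
      using powr_mono2[of p "norm (u t)", OF _ _ le[OF that]] p B by (simp add: powr_mult)
  qed (intro norm_powr_integrable v)
  then show "integral {0..2*pi} (\<lambda>t. norm (u t) powr p) \<le> 2 * pi * (B * circle_mean p v) powr p"
    using B circle_mean_nonneg[of v] by (simp add: integral_powr_eq powr_mult)
qed (use B circle_mean_nonneg in auto)

lemma circle_mean_scale: "circle_mean p (\<lambda>t. c * u t) = norm c * circle_mean p u"
proof -
  have "integral {0..2*pi} (\<lambda>t. norm (c * u t) powr p)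
      = norm c powr p * integral {0..2*pi} (\<lambda>t. norm (u t) powr p)"
    by (simp add: norm_mult powr_mult)
  then have "circle_mean p (\<lambda>t. c * u t) powr p = (norm c * circle_mean p u) powr p"
    using circle_mean_nonneg[of u] by (simp add: integral_powr_eq powr_mult)
  then show ?thesis
    using powr_nonneg_inject[OF circle_mean_nonneg[of "\<lambda>t. c * u t"], of "norm c * circle_mean p u"]
      circle_mean_nonneg[of u] by simp
qed

text \<open>Minkowski's inequality. With \<open>a > \<parallel>u\<parallel>\<close>, \<open>b > \<parallel>v\<parallel>\<close> and \<open>t = a/(a+b)\<close>, convexity of \<open>x\<^sup>p\<close> is applied to
  \<open>(|u| + |v|)/(a + b) = t |u|/a + (1 - t) |v|/b\<close>. Working with strict bounds \<open>a\<close>, \<open>b\<close> avoids a separate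
  treatment of vanishing means.\<close>

lemma circle_mean_triangle:
  assumes u: "continuous_on {0..2*pi} u" and v: "continuous_on {0..2*pi} v"
  shows "circle_mean p (\<lambda>t. u t + v t) \<le> circle_mean p u + circle_mean p v"
proof (rule field_le_epsilon)
  fix e :: real assume e: "0 < e"
  define a where "a = circle_mean p u + e / 2"
  define b where "b = circle_mean p v + e / 2"
  have a: "0 < a" "circle_mean p u \<le> a" and b: "0 < b" "circle_mean p v \<le> b"
    using e circle_mean_nonneg[of u] circle_mean_nonneg[of v] by (auto simp: a_def b_def)
  define t where "t = a / (a + b)"
  have t: "0 \<le> t" "t \<le> 1" "1 - t = b / (a + b)" using a b by (auto simp: t_def field_simps)
  define c where "c = (a + b) powr p"
  have c: "0 \<le> c" by (simp add: c_def)
  have pw: "norm (u s + v s) powr p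
      \<le> c * t * a powr (-p) * norm (u s) powr p + c * (1 - t) * b powr (-p) * norm (v s) powr p" for s
  proof -
    have "norm (u s + v s) \<le> (a + b) * (t * (norm (u s) / a) + (1 - t) * (norm (v s) / b))"
    proof -
      have "(a + b) * (t * (norm (u s) / a)) = norm (u s)" "(a + b) * ((1 - t) * (norm (v s) / b)) = norm (v s)"
        using a b unfolding t(3) by (simp_all add: t_def)
      then show ?thesis using norm_triangle_ineq[of "u s" "v s"] by (simp add: distrib_left)
    qed
    then have "norm (u s + v s) powr p
        \<le> ((a + b) * (t * (norm (u s) / a) + (1 - t) * (norm (v s) / b))) powr p"
      using p by (intro powr_mono2) auto
    also have "\<dots> = c * (t * (norm (u s) / a) + (1 - t) * (norm (v s) / b)) powr p"
      using a b t by (subst powr_mult) (auto simp: c_def)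
    also have "\<dots> \<le> c * (t * (norm (u s) / a) powr p + (1 - t) * (norm (v s) / b) powr p)"
      using c p t a b by (intro mult_left_mono powr_convex_combination) auto
    finally show ?thesis using a b by (simp add: powr_divide powr_minus field_simps)
  qed
  have "integral {0..2*pi} (\<lambda>s. norm (u s + v s) powr p)
      \<le> integral {0..2*pi} (\<lambda>s. c * t * a powr (-p) * norm (u s) powr p + c * (1 - t) * b powr (-p) * norm (v s) powr p)"
    by (intro integral_le norm_powr_integrable continuous_intros u v pw integrable_add )
  also have "\<dots> = c * t * a powr (-p) * integral {0..2*pi} (\<lambda>s. norm (u s) powr p)
      + c * (1 - t) * b powr (-p) * integral {0..2*pi} (\<lambda>s. norm (v s) powr p)"
    by (subst integral_add) (auto intro:  norm_powr_integrable u v)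
  also have "\<dots> \<le> c * t * a powr (-p) * (2 * pi * a powr p) + c * (1 - t) * b powr (-p) * (2 * pi * b powr p)"
    using a b t c p circle_mean_nonneg
    by (intro add_mono mult_left_mono) (auto simp: integral_powr_eq intro!: powr_mono2)
  also have "\<dots> = 2 * pi * c"
    using a b by (simp add: powr_minus field_simps)
  finally have "circle_mean p (\<lambda>t. u t + v t) \<le> a + b"
    using a b by (intro circle_mean_leI) (auto simp: c_def)
  then show "circle_mean p (\<lambda>t. u t + v t) \<le> circle_mean p u + circle_mean p v + e"
    by (simp add: a_def b_def)
qed

lemma Young_powr:
  fixes x y :: real
  assumes "0 \<le> x" "0 \<le> y"
  shows "x * y powr (p - 1) \<le> x powr p / p + (1 - 1 / p) * y powr p"
proof -
  have "x * y powr (p - 1) \<le> x powr p / p + (y powr (p - 1)) powr (p / (p - 1)) / (p / (p - 1))"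
    using p assms by (intro Youngs_inequality) (auto simp: field_simps)
  moreover have "(p - 1) * (p / (p - 1)) = p" "y powr p / (p / (p - 1)) = (1 - 1 / p) * y powr p"
    using p by (simp_all add: field_simps)
  ultimately show ?thesis by (simp only: powr_powr)
qed

text \<open>Hoelder's inequality in a form without conjugate exponent: integrate \<open>Young_powr\<close> after both
  functions are normalised by bounds slightly above their means.\<close>

lemma circle_mean_Holder:
  assumes u: "continuous_on {0..2*pi} u" and v: "continuous_on {0..2*pi} v"
  shows "integral {0..2*pi} (\<lambda>t. norm (u t) * norm (v t) powr (p - 1))
    \<le> 2 * pi * (circle_mean p u * circle_mean p v powr (p - 1))"
proof -
  define A where "A = circle_mean p u"
  define B where "B = circle_mean p v"
  have AB: "0 \<le> A" "0 \<le> B" using circle_mean_nonneg by (auto simp: A_def B_def)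
  have est: "integral {0..2*pi} (\<lambda>t. norm (u t) * norm (v t) powr (p - 1))
      \<le> 2 * pi * ((A + e) * (B + e) powr (p - 1))" if e: "0 < e" for e
  proof -
    define a where "a = A + e"
    define b where "b = B + e"
    have a: "0 < a" "A \<le> a" and b: "0 < b" "B \<le> b" using AB e by (auto simp: a_def b_def)
    let ?w = "a * b powr (p - 1)"
    have pw: "norm (u t) * norm (v t) powr (p - 1)
        \<le> ?w / p * a powr (-p) * norm (u t) powr p + ?w * (1 - 1/p) * b powr (-p) * norm (v t) powr p" for t
    proof -
      have "norm (u t) * norm (v t) powr (p - 1) = ?w * ((norm (u t) / a) * (norm (v t) / b) powr (p - 1))"
        using a b by (simp add: powr_divide)
      also have "\<dots> \<le> ?w * ((norm (u t) / a) powr p / p + (1 - 1 / p) * (norm (v t) / b) powr p)"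
        using a b by (intro mult_left_mono Young_powr) auto
      finally show ?thesis using a b by (simp add: powr_divide powr_minus field_simps)
    qed
    have "integral {0..2*pi} (\<lambda>t. norm (u t) * norm (v t) powr (p - 1))
        \<le> integral {0..2*pi} (\<lambda>t. ?w / p * a powr (-p) * norm (u t) powr p
             + ?w * (1 - 1/p) * b powr (-p) * norm (v t) powr p)"
      by (intro integral_le pw integrable_add  norm_powr_integrable u v
            integrable_continuous_real continuous_on_mult continuous_on_norm continuous_on_powr' continuous_on_const)
         (use p in auto)
    also have "\<dots> = ?w / p * a powr (-p) * integral {0..2*pi} (\<lambda>t. norm (u t) powr p)
        + ?w * (1 - 1/p) * b powr (-p) * integral {0..2*pi} (\<lambda>t. norm (v t) powr p)"
      by (subst integral_add, intro norm_powr_integrable u, intro norm_powr_integrable v, simp)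
    also have "\<dots> \<le> ?w / p * a powr (-p) * (2 * pi * a powr p) + ?w * (1 - 1/p) * b powr (-p) * (2 * pi * b powr p)"
      using a b p AB
      by (intro add_mono mult_left_mono) (auto simp: integral_powr_eq A_def[symmetric] B_def[symmetric] intro!: powr_mono2)
    also have "\<dots> = 2 * pi * ?w"
      using a b p by (simp add: powr_minus field_simps)
    finally show ?thesis by (simp add: a_def b_def)
  qed
  have "((\<lambda>e. 2 * pi * ((A + e) * (B + e) powr (p - 1))) \<longlongrightarrow> 2 * pi * ((A + 0) * (B + 0) powr (p - 1))) (at_right 0)"
    by (intro tendsto_intros tendsto_powr') (use p AB in \<open>auto simp: eventually_at_right_less intro: eventually_mono[OF eventually_at_right_less]\<close>)
  then have "integral {0..2*pi} (\<lambda>t. norm (u t) * norm (v t) powr (p - 1)) \<le> 2 * pi * ((A + 0) * (B + 0) powr (p - 1))"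
    by (rule tendsto_lowerbound) (use est in \<open>auto intro: eventually_mono[OF eventually_at_right_less]\<close>)
  then show ?thesis by (simp add: A_def B_def)
qed

lemma integral_norm_le_circle_mean:
  assumes u: "continuous_on {0..2*pi} u"
  shows "integral {0..2*pi} (\<lambda>t. norm (u t)) \<le> 2 * pi * circle_mean p u"
proof -
  have "circle_mean p (\<lambda>t. 1) = 1" using p by (simp add: circle_mean_def)
  then show ?thesis using circle_mean_Holder[OF u, of "\<lambda>t. 1"] by simp
qed

end

section \<open>Hardy spaces are Banach spaces\<close>

lemma circle_in_disc: "0 \<le> r \<Longrightarrow> r < 1 \<Longrightarrow> of_real r * cis t \<in> ball 0 1"
  by (simp add: norm_mult)

lemma continuous_on_circle:
  assumes "f holomorphic_on ball 0 1" "0 \<le> r" "r < 1"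
  shows "continuous_on S (\<lambda>t. f (of_real r * cis t))"
  by (rule continuous_on_compose2[OF holomorphic_on_imp_continuous_on[OF assms(1)]])
     (use circle_in_disc assms in \<open>auto intro!: continuous_intros\<close>)

lemma circlepath_integral_bound:
  assumes I: "(g has_contour_integral I) (circlepath 0 r)" and h: "h integrable_on {0..2*pi}"
    and le: "\<And>t. norm (g (of_real r * cis t)) * \<bar>r\<bar> \<le> h t"
  shows "norm I \<le> integral {0..2*pi} h"
proof -
  have "((\<lambda>t. g (of_real r * cis t) * of_real r * \<i> * cis t) has_integral I) {0..2*pi}"
    using I unfolding circlepath_def
    by (subst (asm) has_contour_integral_part_circlepath_iff) auto
  then have "integral {0..2*pi} (\<lambda>t. g (of_real r * cis t) * of_real r * \<i> * cis t) = I"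
    "(\<lambda>t. g (of_real r * cis t) * of_real r * \<i> * cis t) integrable_on {0..2*pi}"
    by (auto simp: has_integral_integrable_integral)
  then show ?thesis
    using integral_norm_bound_integral[of "\<lambda>t. g (of_real r * cis t) * of_real r * \<i> * cis t" "{0..2*pi}" h]
      h le by (auto simp: norm_mult)
qed

lemma Cauchy_point_bound:
  assumes f: "f holomorphic_on ball 0 1" and z: "norm z < r" and r: "r < 1"
  shows "norm (f z) \<le> r / (r - norm z) * (integral {0..2*pi} (\<lambda>t. norm (f (of_real r * cis t))) / (2 * pi))"
proof -
  have r0: "0 < r" using z norm_ge_zero[of z] by linarith
  have hol: "f holomorphic_on cball 0 r" by (rule holomorphic_on_subset[OF f]) (use r in auto)
  have I: "((\<lambda>u. f u / (u - z)) has_contour_integral (2 * of_real pi * \<i> * f z)) (circlepath 0 r)"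
    using Cauchy_integral_circlepath_simple[OF hol, of z] z by simp
  have "norm (2 * of_real pi * \<i> * f z)
      \<le> integral {0..2*pi} (\<lambda>t. r / (r - norm z) * norm (f (of_real r * cis t)))"
  proof (rule circlepath_integral_bound[OF I])
    show "(\<lambda>t. r / (r - norm z) * norm (f (of_real r * cis t))) integrable_on {0..2*pi}"
      by (intro integrable_continuous_real continuous_intros continuous_on_circle f) (use r r0 in auto)
    fix t
    have "r - norm z \<le> norm (of_real r * cis t - z)"
      using norm_triangle_ineq2[of "of_real r * cis t" z] r0 by (simp add: norm_mult)
    then have "norm (f (of_real r * cis t)) / norm (of_real r * cis t - z) \<le> norm (f (of_real r * cis t)) / (r - norm z)"
      using z by (intro divide_left_mono) (auto intro!: mult_pos_pos)
    then have "r * (norm (f (of_real r * cis t)) / norm (of_real r * cis t - z))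
        \<le> r * (norm (f (of_real r * cis t)) / (r - norm z))"
      using r0 by (intro mult_left_mono) auto
    then show "norm (f (of_real r * cis t) / (of_real r * cis t - z)) * \<bar>r\<bar>
        \<le> r / (r - norm z) * norm (f (of_real r * cis t))"
      using r0 by (simp add: norm_divide mult.commute)
  qed
  then have "norm (f z) * (2 * pi) \<le> r / (r - norm z) * integral {0..2*pi} (\<lambda>t. norm (f (of_real r * cis t)))"
    by (simp add: norm_mult mult.commute)
  then have "norm (f z) \<le> r / (r - norm z) * integral {0..2*pi} (\<lambda>t. norm (f (of_real r * cis t))) / (2 * pi)"
    by (subst pos_le_divide_eq) auto
  then show ?thesis by simp
qed

lemma taylor_coeff_bound:
  assumes f: "f holomorphic_on ball 0 1" and r: "0 < r" "r < 1"
  shows "norm (taylor_coeff f n) * r ^ n \<le> integral {0..2*pi} (\<lambda>t. norm (f (of_real r * cis t))) / (2 * pi)"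
proof -
  have I: "((\<lambda>u. f u / (u - 0) ^ Suc n) has_contour_integral (2 * pi * \<i>) / fact n * (deriv ^^ n) f 0) (circlepath 0 r)"
    by (rule Cauchy_has_contour_integral_higher_derivative_circlepath;
        (intro holomorphic_on_imp_continuous_on)?, (rule holomorphic_on_subset[OF f])?)
       (use r in auto)
  have "norm ((2 * pi * \<i>) / fact n * (deriv ^^ n) f 0)
      \<le> integral {0..2*pi} (\<lambda>t. 1 / r ^ n * norm (f (of_real r * cis t)))"
  proof (rule circlepath_integral_bound[OF I])
    show "(\<lambda>t. 1 / r ^ n * norm (f (of_real r * cis t))) integrable_on {0..2*pi}"
      by (intro integrable_continuous_real continuous_intros continuous_on_circle f) (use r in auto)
  qed (use r in \<open>simp add: norm_divide norm_mult norm_power\<close>)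
  then show ?thesis using r by (simp add: taylor_coeff_def norm_mult norm_divide field_simps)
qed

context
  fixes p :: real
  assumes p: "1 < p"
begin

lemma integral_mean_nonneg: "0 \<le> integral_mean p r f"
  by (simp add: integral_mean_def)

lemma integral_mean_point_bound:
  assumes f: "f holomorphic_on ball 0 1" and z: "norm z < r" and r: "r < 1"
  shows "norm (f z) \<le> r / (r - norm z) * integral_mean p r f"
proof -
  have r0: "0 < r" using z norm_ge_zero[of z] by linarith
  have "integral {0..2*pi} (\<lambda>t. norm (f (of_real r * cis t))) / (2 * pi) \<le> integral_mean p r f"
    using integral_norm_le_circle_mean[OF p continuous_on_circle[OF f]] r r0
    by (simp add: integral_mean_eq field_simps)
  then have "r / (r - norm z) * (integral {0..2*pi} (\<lambda>t. norm (f (of_real r * cis t))) / (2 * pi))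
      \<le> r / (r - norm z) * integral_mean p r f"
    using r0 z by (intro mult_left_mono) auto
  then show ?thesis using Cauchy_point_bound[OF f z r] by linarith
qed

lemma integral_mean_add:
  assumes "f holomorphic_on ball 0 1" "g holomorphic_on ball 0 1" "0 \<le> r" "r < 1"
  shows "integral_mean p r (f + g) \<le> integral_mean p r f + integral_mean p r g"
  using circle_mean_triangle[OF p continuous_on_circle continuous_on_circle] assms
  by (simp add: integral_mean_eq)

lemma hardy_spaceI:
  assumes "f holomorphic_on ball 0 1" "\<And>z. z \<notin> ball 0 1 \<Longrightarrow> f z = 0"
    "\<And>r. 0 \<le> r \<Longrightarrow> r < 1 \<Longrightarrow> integral_mean p r f \<le> B"
  shows "f \<in> hardy_space p" "hardy_norm p f \<le> B"
proof -
  show "f \<in> hardy_space p"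
    using assms by (auto simp: hardy_space_def intro!: bdd_aboveI2[of _ _ B])
  show "hardy_norm p f \<le> B"
    unfolding hardy_norm_def using assms by (intro cSUP_least) auto
qed

lemma hardy_spaceD:
  assumes "f \<in> hardy_space p"
  shows "f holomorphic_on ball 0 1" "\<And>z. z \<notin> ball 0 1 \<Longrightarrow> f z = 0"
    "\<And>r. 0 \<le> r \<Longrightarrow> r < 1 \<Longrightarrow> integral_mean p r f \<le> hardy_norm p f"
  using assms by (auto simp: hardy_space_def hardy_norm_def intro!: cSUP_upper)

lemma hardy_norm_nonneg: "f \<in> hardy_space p \<Longrightarrow> 0 \<le> hardy_norm p f"
  using hardy_spaceD(3)[of f 0] integral_mean_nonneg[of 0 f] by simp

text \<open>Point evaluations are bounded, by Cauchy's formula on the circle half-way to the boundary. This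
  turns convergence in norm into locally uniform convergence.\<close>

lemma hardy_point_bound:
  assumes f: "f \<in> hardy_space p" and z: "norm z < 1"
  shows "norm (f z) \<le> 2 / (1 - norm z) * hardy_norm p f"
proof -
  define r where "r = (1 + norm z) / 2"
  have r: "norm z < r" "r < 1" "0 < r" using z norm_ge_zero[of z] by (auto simp: r_def simp del: norm_ge_zero)
  have "norm (f z) \<le> r / (r - norm z) * integral_mean p r f"
    using integral_mean_point_bound[OF hardy_spaceD(1)[OF f]] r by simp
  also have "\<dots> \<le> 2 / (1 - norm z) * hardy_norm p f"
  proof (intro mult_mono)
    have "r / (r - norm z) = (1 + norm z) / (1 - norm z)" using z by (simp add: r_def field_simps)
    also have "\<dots> \<le> 2 / (1 - norm z)" using z by (intro divide_right_mono) auto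
    finally show "r / (r - norm z) \<le> 2 / (1 - norm z)" .
  qed (use hardy_spaceD(3)[OF f] r z integral_mean_nonneg in auto)
  finally show ?thesis .
qed

lemma hardy_scale:
  assumes "f \<in> hardy_space p"
  shows "cscale c f \<in> hardy_space p" "hardy_norm p (cscale c f) \<le> norm c * hardy_norm p f"
proof -
  note f = hardy_spaceD[OF assms]
  have "integral_mean p r (cscale c f) \<le> norm c * hardy_norm p f" if "0 \<le> r" "r < 1" for r
    using f(3)[OF that] by (simp add: integral_mean_eq circle_mean_scale[OF p] mult_left_mono)
  moreover have "cscale c f holomorphic_on ball 0 1"
    unfolding cscale_def by (intro holomorphic_intros f)
  ultimately show "cscale c f \<in> hardy_space p" "hardy_norm p (cscale c f) \<le> norm c * hardy_norm p f"
    using f(2) by (auto intro!: hardy_spaceI)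
qed

lemma hardy_add:
  assumes "f \<in> hardy_space p" "g \<in> hardy_space p"
  shows "f + g \<in> hardy_space p" "hardy_norm p (f + g) \<le> hardy_norm p f + hardy_norm p g"
proof -
  note f = hardy_spaceD[OF assms(1)] and g = hardy_spaceD[OF assms(2)]
  have "integral_mean p r (f + g) \<le> hardy_norm p f + hardy_norm p g" if "0 \<le> r" "r < 1" for r
    using integral_mean_add[OF f(1) g(1) that] f(3)[OF that] g(3)[OF that] by linarith
  moreover have "f + g holomorphic_on ball 0 1"
    unfolding plus_fun_def by (intro holomorphic_intros f g)
  ultimately show "f + g \<in> hardy_space p" "hardy_norm p (f + g) \<le> hardy_norm p f + hardy_norm p g"
    using f(2) g(2) by (auto intro!: hardy_spaceI)
qed

text \<open>A Cauchy sequence converges locally uniformly by \<open>hardy_point_bound\<close>, so its limit \<open>g\<close> is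
  analytic. On a fixed circle \<open>u m\<close> is uniformly close to \<open>g\<close> for large \<open>m\<close>, so the Cauchy bound for
  \<open>u n - u m\<close> passes to \<open>u n - g\<close>, with a constant independent of the circle.\<close>

lemma hardy_space_complete:
  assumes u: "\<And>n. u n \<in> hardy_space p"
    and Cauchy: "\<And>e. e > 0 \<Longrightarrow> \<exists>K. \<forall>m\<ge>K. \<forall>n\<ge>K. hardy_norm p (u m - u n) < e"
  shows "\<exists>g\<in>hardy_space p. (\<lambda>n. hardy_norm p (u n - g)) \<longlonglongrightarrow> 0"
proof -
  have diff: "u m - u n \<in> hardy_space p" for m n
  proof -
    have "u m - u n = u m + cscale (-1) (u n)" by (auto simp: fun_eq_iff)
    then show ?thesis using hardy_add(1)[OF u hardy_scale(1)[OF u]] by (simp only:)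
  qed
  define g where "g z = lim (\<lambda>n. u n z)" for z
  have unif: "uniform_limit (cball 0 \<rho>) u g sequentially" if \<rho>: "0 \<le> \<rho>" "\<rho> < 1" for \<rho>
  proof -
    have "uniformly_Cauchy_on (cball 0 \<rho>) u"
      unfolding uniformly_Cauchy_on_def
    proof (intro allI impI)
      fix e :: real assume e: "0 < e"
      then obtain K where K: "\<And>m n. m \<ge> K \<Longrightarrow> n \<ge> K \<Longrightarrow> hardy_norm p (u m - u n) < e * (1 - \<rho>) / 2"
        using Cauchy[of "e * (1 - \<rho>) / 2"] \<rho> by auto
      have "dist (u m z) (u n z) < e" if z: "z \<in> cball 0 \<rho>" and mn: "m \<ge> K" "n \<ge> K" for z m n
      proof -
        have "norm ((u m - u n) z) \<le> 2 / (1 - norm z) * hardy_norm p (u m - u n)"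
          using z \<rho> by (intro hardy_point_bound diff) auto
        also have "\<dots> \<le> 2 / (1 - \<rho>) * hardy_norm p (u m - u n)"
          using z \<rho> hardy_norm_nonneg[OF diff] by (intro mult_right_mono divide_left_mono) auto
        also have "\<dots> < 2 / (1 - \<rho>) * (e * (1 - \<rho>) / 2)"
          using K[OF mn] \<rho> by (intro mult_strict_left_mono) auto
        also have "\<dots> = e" using \<rho> by simp
        finally show ?thesis by (simp add: dist_norm)
      qed
      then show "\<exists>M. \<forall>x\<in>cball 0 \<rho>. \<forall>m\<ge>M. \<forall>n\<ge>M. dist (u m x) (u n x) < e" by blast
    qed
    then show ?thesis
      using Cauchy_uniformly_convergent unfolding uniformly_convergent_uniform_limit_iff g_def by blast
  qed
  have hol: "g holomorphic_on ball 0 1"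
  proof (rule holomorphic_uniform_sequence)
    show "u n holomorphic_on ball 0 1" for n using hardy_spaceD(1)[OF u] .
    fix x :: complex assume x: "x \<in> ball 0 1"
    define d where "d = (1 - norm x) / 2"
    have sub: "cball x d \<subseteq> cball 0 ((1 + norm x) / 2)"
    proof
      fix y assume "y \<in> cball x d"
      then have "norm (y - x) \<le> d" by (simp add: dist_norm norm_minus_commute)
      then show "y \<in> cball 0 ((1 + norm x) / 2)"
        using norm_triangle_ineq[of "y - x" x] by (simp add: d_def field_simps)
    qed
    have "uniform_limit (cball x d) u g sequentially"
      by (rule uniform_limit_on_subset[OF unif sub]) (use x in \<open>auto intro: add_nonneg_nonneg\<close>)
    moreover have "cball x d \<subseteq> ball 0 1" using sub x by (force simp: field_simps)
    moreover have "0 < d" using x by (simp add: d_def)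
    ultimately show "\<exists>d>0. cball x d \<subseteq> ball 0 1 \<and> uniform_limit (cball x d) u g sequentially" by blast
  qed simp
  have hold: "u n - g holomorphic_on ball 0 1" "g - u n holomorphic_on ball 0 1" for n
    unfolding fun_diff_def by (intro holomorphic_intros hol hardy_spaceD(1)[OF u])+
  have zero: "g z = 0" if "z \<notin> ball 0 1" for z
    unfolding g_def using hardy_spaceD(2)[OF u that] by simp
  have close: "integral_mean p r (u n - g) \<le> e"
    if e: "0 < e" and K: "\<And>m n. m \<ge> K \<Longrightarrow> n \<ge> K \<Longrightarrow> hardy_norm p (u m - u n) < e"
      and n: "n \<ge> K" and r: "0 \<le> r" "r < 1" for e K n r
  proof (rule field_le_epsilon)
    fix d :: real assume d: "0 < d"
    have "\<forall>\<^sub>F m in sequentially. \<forall>z\<in>cball 0 r. dist (u m z) (g z) < d"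
      using uniform_limitD[OF unif[OF r] d] .
    then obtain m where m: "m \<ge> K" "\<And>z. z \<in> cball 0 r \<Longrightarrow> dist (u m z) (g z) < d"
      by (metis (no_types, lifting) eventually_sequentially max.cobounded1 max.cobounded2)
    have "u n - g = (u n - u m) + (u m - g)" by simp
    then have "integral_mean p r (u n - g) \<le> integral_mean p r (u n - u m) + integral_mean p r (u m - g)"
      using integral_mean_add[OF hardy_spaceD(1)[OF diff] hold(1) r] by metis
    moreover have "integral_mean p r (u n - u m) \<le> e"
      using hardy_spaceD(3)[OF diff r, of n m] K[OF n m(1)] by linarith
    moreover have "integral_mean p r (u m - g) \<le> d"
      unfolding integral_mean_eq
    proof (rule circle_mean_le_sup[OF p continuous_on_circle[OF hold(1) r]])
      show "norm ((u m - g) (of_real r * cis t)) \<le> d" for t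
        using m(2)[of "of_real r * cis t"] r by (simp add: norm_mult dist_norm less_imp_le)
    qed (use d in simp)
    ultimately show "integral_mean p r (u n - g) \<le> e + d" by linarith
  qed
  have close_norm: "u n - g \<in> hardy_space p \<and> hardy_norm p (u n - g) \<le> e"
    if e: "0 < e" and K: "\<And>m n. m \<ge> K \<Longrightarrow> n \<ge> K \<Longrightarrow> hardy_norm p (u m - u n) < e"
      and n: "n \<ge> K" for e K n
    using hardy_spaceI[OF hold(1), of n e] zero hardy_spaceD(2)[OF u] close[OF e K n] by auto
  have "g \<in> hardy_space p"
  proof -
    obtain K where "\<And>m n. m \<ge> K \<Longrightarrow> n \<ge> K \<Longrightarrow> hardy_norm p (u m - u n) < 1"
      using Cauchy[of 1] by auto
    then have "u K - g \<in> hardy_space p" using close_norm[of 1 K K] by simp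
    then have "u K + cscale (-1) (u K - g) \<in> hardy_space p"
      by (intro hardy_add(1) hardy_scale(1) u)
    also have "u K + cscale (-1) (u K - g) = g" by (auto simp: fun_eq_iff)
    finally show ?thesis .
  qed
  moreover have "(\<lambda>n. hardy_norm p (u n - g)) \<longlonglongrightarrow> 0"
  proof (rule LIMSEQ_I)
    fix e :: real assume e: "0 < e"
    then obtain K where K: "\<And>m n. m \<ge> K \<Longrightarrow> n \<ge> K \<Longrightarrow> hardy_norm p (u m - u n) < e / 2"
      using Cauchy[of "e / 2"] by auto
    have "norm (hardy_norm p (u n - g) - 0) < e" if "n \<ge> K" for n
      using close_norm[OF _ K that] hardy_norm_nonneg[of "u n - g"] e by auto
    then show "\<exists>K. \<forall>n\<ge>K. norm (hardy_norm p (u n - g) - 0) < e" by blast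
  qed
  ultimately show ?thesis by blast
qed

lemma hardy_function_banach: "function_banach (hardy_space p) (hardy_norm p)"
proof
  show "0 \<in> hardy_space p"
  proof (rule hardy_spaceI)
    show "integral_mean p r 0 \<le> 0" for r using p by (simp add: integral_mean_def)
  qed (auto simp: zero_fun_def)
  show "hardy_norm p (cscale c f) = norm c * hardy_norm p f" if f: "f \<in> hardy_space p" for c f
  proof (cases "c = 0")
    case True
    then show ?thesis using hardy_scale[OF f, of 0] hardy_norm_nonneg[OF hardy_scale(1)[OF f, of 0]] by simp
  next
    case False
    have "cscale (1 / c) (cscale c f) = f" using False by (auto simp: fun_eq_iff)
    then have "hardy_norm p f \<le> hardy_norm p (cscale c f) / norm c"
      using hardy_scale(2)[OF hardy_scale(1)[OF f, of c], of "1 / c"] by (simp add: norm_divide)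
    then show ?thesis using hardy_scale(2)[OF f, of c] False by (simp add: field_simps)
  qed
  show "f = 0" if f: "f \<in> hardy_space p" and "hardy_norm p f = 0" for f
  proof
    fix z show "f z = 0 z"
      using hardy_point_bound[OF f, of z] hardy_spaceD(2)[OF f, of z] that by (cases "norm z < 1") auto
  qed
qed (use hardy_add hardy_scale hardy_space_complete in auto)

end

section \<open>The Cesaro operator and its resolvent as differential equations\<close>

lemma taylor_coeff_fps:
  assumes "f holomorphic_on ball 0 1"
  shows "f has_fps_expansion Abs_fps (taylor_coeff f)"
proof -
  have "f has_fps_expansion fps_expansion f 0"
    by (rule has_fps_expansion_fps_expansion[of "ball 0 1"]) (use assms in auto)
  then show ?thesis by (simp add: fps_expansion_def taylor_coeff_def[abs_def])
qed

lemma taylor_coeff_eqI: "f has_fps_expansion F \<Longrightarrow> taylor_coeff f n = fps_nth F n"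
  by (simp add: taylor_coeff_def fps_nth_fps_expansion)

lemma taylor_sums:
  "f holomorphic_on ball 0 1 \<Longrightarrow> norm z < 1 \<Longrightarrow> (\<lambda>n. taylor_coeff f n * z ^ n) sums f z"
  using holomorphic_power_series[of f 0 1 z] by (simp add: taylor_coeff_def)

lemma holomorphic_eqI_taylor:
  assumes "f holomorphic_on ball 0 1" "g holomorphic_on ball 0 1" "taylor_coeff f = taylor_coeff g" "norm z < 1"
  shows "f z = g z"
  using taylor_sums[OF assms(1,4)] taylor_sums[OF assms(2,4)] assms(3) by (simp add: sums_unique2)

lemma power_series_on_disc:
  assumes "\<And>z. norm z < 1 \<Longrightarrow> (\<lambda>n. c n * z ^ n) sums f z"
  shows "f holomorphic_on ball 0 1" "taylor_coeff f = c"
proof -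
  show "f holomorphic_on ball 0 1"
    using power_series_holomorphic[of 0 1 c f] assms by simp
  have "f has_fps_expansion Abs_fps c"
  proof (rule has_fps_expansionI)
    have "\<forall>\<^sub>F z in nhds (0::complex). z \<in> ball 0 1"
      by (rule eventually_nhds_in_open) auto
    then show "\<forall>\<^sub>F z in nhds 0. (\<lambda>n. fps_nth (Abs_fps c) n * z ^ n) sums f z"
      by eventually_elim (use assms in auto)
  qed
  then show "taylor_coeff f = c" by (auto simp: taylor_coeff_eqI)
qed

lemma taylor_coeff_linear:
  assumes "f holomorphic_on ball 0 1" "g holomorphic_on ball 0 1"
  shows "taylor_coeff (\<lambda>z. a * f z + b * g z) n = a * taylor_coeff f n + b * taylor_coeff g n"
proof -
  have "(\<lambda>z. a * f z + b * g z) has_fps_expansion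
      fps_const a * Abs_fps (taylor_coeff f) + fps_const b * Abs_fps (taylor_coeff g)"
    by (intro fps_expansion_intros taylor_coeff_fps assms)
  then show ?thesis by (simp add: taylor_coeff_eqI)
qed

lemma taylor_coeff_Euler:
  assumes f: "f holomorphic_on ball 0 1"
  shows "taylor_coeff (\<lambda>z. z * deriv f z + c * f z) n = (of_nat n + c) * taylor_coeff f n"
proof -
  have "(\<lambda>z. z * deriv f z + c * f z) has_fps_expansion
      fps_X * fps_deriv (Abs_fps (taylor_coeff f)) + fps_const c * Abs_fps (taylor_coeff f)"
    by (intro fps_expansion_intros taylor_coeff_fps f)
  then show ?thesis by (cases n) (simp_all add: taylor_coeff_eqI algebra_simps)
qed

lemma sum_taylor_coeff:
  assumes f: "f holomorphic_on ball 0 1"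
  shows "(\<Sum>k\<le>n. taylor_coeff f k) = taylor_coeff (\<lambda>z. f z / (1 - z)) n"
proof -
  define g where "g z = f z / (1 - z)" for z
  have g: "g holomorphic_on ball 0 1" unfolding g_def by (intro holomorphic_intros f) auto
  have "(\<lambda>z. (1 - z) * g z) has_fps_expansion (1 - fps_X) * Abs_fps (taylor_coeff g)"
    by (intro fps_expansion_intros taylor_coeff_fps g)
  moreover have "\<forall>\<^sub>F z in nhds 0. (1 - z) * g z = f z"
  proof -
    have "\<forall>\<^sub>F z in nhds (0::complex). z \<in> ball 0 1" by (rule eventually_nhds_in_open) auto
    then show ?thesis by eventually_elim (auto simp: g_def)
  qed
  ultimately have "f has_fps_expansion (1 - fps_X) * Abs_fps (taylor_coeff g)"
    using has_fps_expansion_cong[of "\<lambda>z. (1 - z) * g z" f] by simp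
  then have "taylor_coeff f k = taylor_coeff g k - (if k = 0 then 0 else taylor_coeff g (k - 1))" for k
    by (simp add: taylor_coeff_eqI left_diff_distrib)
  then have "(\<Sum>k\<le>n. taylor_coeff f k) = taylor_coeff g n" for n
    by (induction n) auto
  then show ?thesis by (simp add: g_def[abs_def])
qed

text \<open>The power series solution \<open>P\<close> of \<open>z P' + (1 - s) P = \<phi>\<close>. Its coefficients have no pole as long as
  \<open>s\<close> is not a positive integer.\<close>

definition Euler_solution :: "complex \<Rightarrow> (complex \<Rightarrow> complex) \<Rightarrow> complex \<Rightarrow> complex"
  where "Euler_solution s \<phi> z = (\<Sum>n. taylor_coeff \<phi> n / (of_nat (n + 1) - s) * z ^ n)"

lemma resonance_gap: "1 - Re s \<le> norm (of_nat (n + 1) - s)"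
proof -
  have "1 - Re s \<le> Re (of_nat (n + 1) - s)" by simp
  then show ?thesis using complex_Re_le_cmod[of "of_nat (n + 1) - s"] by linarith
qed

lemma no_resonance: "Re s < 1 \<Longrightarrow> of_nat (n + 1) - s \<noteq> 0"
  using resonance_gap[of s n] by force

context
  fixes s :: complex and \<phi> :: "complex \<Rightarrow> complex"
  assumes s: "Re s < 1" and \<phi>: "\<phi> holomorphic_on ball 0 1"
begin

lemma Euler_solution_sums:
  assumes z: "norm z < 1"
  shows "(\<lambda>n. taylor_coeff \<phi> n / (of_nat (n + 1) - s) * z ^ n) sums Euler_solution s \<phi> z"
proof -
  have "summable (\<lambda>n. norm (taylor_coeff \<phi> n * z ^ n))"
  proof -
    define r where "r = (1 + norm z) / 2"
    have "norm z < r" "r < 1" "0 \<le> r" using z norm_ge_zero[of z] by (auto simp: r_def simp del: norm_ge_zero)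
    then have r: "norm z < norm (of_real r :: complex)" "norm (of_real r :: complex) < 1" by auto
    have "summable (\<lambda>n. taylor_coeff \<phi> n * of_real r ^ n)"
      using taylor_sums[OF \<phi> r(2)] sums_summable by blast
    then show ?thesis using powser_insidea[OF _ r(1)] by blast
  qed
  then have "summable (\<lambda>n. 1 / (1 - Re s) * norm (taylor_coeff \<phi> n * z ^ n))"
    by (rule summable_mult)
  then have "summable (\<lambda>n. taylor_coeff \<phi> n / (of_nat (n + 1) - s) * z ^ n)"
  proof (rule summable_comparison_test'[where N = 0])
    fix n
    have "norm (taylor_coeff \<phi> n * z ^ n) / norm (of_nat (n + 1) - s) \<le> norm (taylor_coeff \<phi> n * z ^ n) / (1 - Re s)"
      using resonance_gap[of s n] s no_resonance[OF s, of n] by (intro divide_left_mono mult_pos_pos) auto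
    then show "norm (taylor_coeff \<phi> n / (of_nat (n + 1) - s) * z ^ n)
        \<le> 1 / (1 - Re s) * norm (taylor_coeff \<phi> n * z ^ n)"
      by (simp add: norm_mult norm_divide)
  qed
  then show ?thesis unfolding Euler_solution_def by (rule summable_sums)
qed

lemma Euler_solution_holomorphic: "Euler_solution s \<phi> holomorphic_on ball 0 1"
  and taylor_coeff_Euler_solution:
    "taylor_coeff (Euler_solution s \<phi>) = (\<lambda>n. taylor_coeff \<phi> n / (of_nat (n + 1) - s))"
  using power_series_on_disc[OF Euler_solution_sums] by auto

lemma Euler_solution_ode:
  assumes z: "norm z < 1"
  shows "z * deriv (Euler_solution s \<phi>) z + (1 - s) * Euler_solution s \<phi> z = \<phi> z"
proof -
  note hol = Euler_solution_holomorphic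
  show ?thesis
  proof (rule holomorphic_eqI_taylor[OF _ \<phi> _ z])
    show "(\<lambda>z. z * deriv (Euler_solution s \<phi>) z + (1 - s) * Euler_solution s \<phi> z) holomorphic_on ball 0 1"
      by (intro holomorphic_intros hol) auto
    have "(of_nat n + (1 - s)) * taylor_coeff (Euler_solution s \<phi>) n = taylor_coeff \<phi> n" for n
    proof -
      have "of_nat n + (1 - s) = of_nat (n + 1) - s" by simp
      then show ?thesis using no_resonance[OF s, of n] by (simp only: taylor_coeff_Euler_solution) simp
    qed
    then show "taylor_coeff (\<lambda>z. z * deriv (Euler_solution s \<phi>) z + (1 - s) * Euler_solution s \<phi> z) = taylor_coeff \<phi>"
      by (auto simp: taylor_coeff_Euler[OF hol])
  qed
qed

text \<open>Cauchy's inequality on the circle of radius \<open>3/4\<close> bounds the coefficients of \<open>\<phi>\<close> by \<open>B (4/3)\<^sup>n\<close>, which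
  leaves the ratio \<open>2/3\<close> for \<open>|z| \<le> 1/2\<close>.\<close>

lemma Euler_solution_bound:
  assumes B: "\<And>w. norm w = 3/4 \<Longrightarrow> norm (\<phi> w) \<le> B" and z: "norm z \<le> 1/2"
  shows "norm (Euler_solution s \<phi> z) \<le> 3 * B / (1 - Re s)"
proof -
  have B0: "0 \<le> B" using order_trans[OF norm_ge_zero B[of "3/4"]] by simp
  have coeff: "norm (taylor_coeff \<phi> n) \<le> B / (3/4) ^ n" for n
  proof -
    have "\<phi> holomorphic_on cball 0 (3/4)" by (rule holomorphic_on_subset[OF \<phi>]) auto
    then have "norm ((deriv ^^ n) \<phi> 0) \<le> fact n * B / (3/4) ^ n"
      by (intro Cauchy_inequality holomorphic_on_imp_continuous_on) (auto intro: holomorphic_on_subset B)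
    then show ?thesis by (simp add: taylor_coeff_def norm_divide field_simps)
  qed
  have bnd: "norm (taylor_coeff \<phi> n / (of_nat (n + 1) - s) * z ^ n) \<le> B / (1 - Re s) * (2/3) ^ n" for n
  proof -
    have "norm (taylor_coeff \<phi> n) * norm z ^ n \<le> B / (3/4) ^ n * (1/2) ^ n"
      using coeff[of n] z B0 by (intro mult_mono power_mono) auto
    also have "(1/2 :: real) ^ n = (3/4) ^ n * (2/3) ^ n" by (simp flip: power_mult_distrib)
    also have "B / (3/4) ^ n * ((3/4) ^ n * (2/3) ^ n) = B * (2/3) ^ n" by simp
    finally have "norm (taylor_coeff \<phi> n) * norm z ^ n / norm (of_nat (n + 1) - s) \<le> B * (2/3) ^ n / (1 - Re s)"
      using resonance_gap[of s n] s B0 by (intro frac_le) auto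
    then show ?thesis by (simp add: norm_mult norm_divide norm_power)
  qed
  have sums: "(\<lambda>n. B / (1 - Re s) * (2/3) ^ n) sums (B / (1 - Re s) * (1 / (1 - 2/3)))"
    by (intro sums_mult geometric_sums) auto
  have "norm (\<Sum>n. taylor_coeff \<phi> n / (of_nat (n + 1) - s) * z ^ n) \<le> (\<Sum>n. B / (1 - Re s) * (2/3) ^ n)"
    by (rule norm_suminf_le[OF bnd sums_summable[OF sums]])
  also have "\<dots> = B / (1 - Re s) * (1 / (1 - 2/3))"
    using sums_unique[OF sums] by (rule sym)
  finally show ?thesis by (simp add: Euler_solution_def mult.commute)
qed

end

lemma cesaro_outside: "z \<notin> ball 0 1 \<Longrightarrow> cesaro f z = 0"
  by (auto simp: cesaro_def)

text \<open>Dividing by \<open>1 - z\<close> sums Taylor coefficients, so the Cesaro operator is the case \<open>s = 0\<close> of the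
  Euler equation: \<open>z (C f)' + C f = f / (1 - z)\<close>.\<close>

lemma cesaro_eq_Euler_solution:
  assumes f: "f holomorphic_on ball 0 1" and z: "norm z < 1"
  shows "cesaro f z = Euler_solution 0 (\<lambda>z. f z / (1 - z)) z"
  using z by (simp add: cesaro_def Euler_solution_def sum_taylor_coeff[OF f])

lemma holomorphic_div_1_minus: "f holomorphic_on ball 0 1 \<Longrightarrow> (\<lambda>z. f z / (1 - z)) holomorphic_on ball 0 1"
  by (intro holomorphic_intros) auto

lemma cesaro_holomorphic:
  assumes f: "f holomorphic_on ball 0 1"
  shows "cesaro f holomorphic_on ball 0 1"
  by (subst holomorphic_cong[OF refl cesaro_eq_Euler_solution[OF f]])
     (auto intro!: Euler_solution_holomorphic holomorphic_div_1_minus f)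

lemma taylor_coeff_cesaro:
  assumes f: "f holomorphic_on ball 0 1"
  shows "taylor_coeff (cesaro f) n = (\<Sum>k\<le>n. taylor_coeff f k) / of_nat (n + 1)"
proof -
  have "(\<lambda>n. taylor_coeff (\<lambda>z. f z / (1 - z)) n / (of_nat (n + 1) - 0) * z ^ n) sums cesaro f z" if "norm z < 1" for z
    unfolding cesaro_eq_Euler_solution[OF f that]
    by (rule Euler_solution_sums) (use f that in \<open>auto intro: holomorphic_div_1_minus\<close>)
  from power_series_on_disc(2)[OF this] show ?thesis
    by (simp add: sum_taylor_coeff[OF f])
qed

lemma disc_function_eqI:
  assumes "f holomorphic_on ball 0 1" "g holomorphic_on ball 0 1" "\<And>n. taylor_coeff f n = taylor_coeff g n"
    "\<And>z. z \<notin> ball 0 1 \<Longrightarrow> f z = g z"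
  shows "f = g"
proof
  fix z show "f z = g z"
    using assms holomorphic_eqI_taylor[OF assms(1,2), of z] by (cases "norm z < 1") auto
qed

lemma cesaro_linear:
  assumes f: "f holomorphic_on ball 0 1" and g: "g holomorphic_on ball 0 1"
  shows "cesaro (\<lambda>z. a * f z + b * g z) = (\<lambda>z. a * cesaro f z + b * cesaro g z)"
proof (rule disc_function_eqI)
  have h: "(\<lambda>z. a * f z + b * g z) holomorphic_on ball 0 1"
    by (intro holomorphic_intros f g)
  show "cesaro (\<lambda>z. a * f z + b * g z) holomorphic_on ball 0 1"
    by (intro cesaro_holomorphic h)
  show "(\<lambda>z. a * cesaro f z + b * cesaro g z) holomorphic_on ball 0 1"
    by (intro holomorphic_intros cesaro_holomorphic f g)
  show "taylor_coeff (cesaro (\<lambda>z. a * f z + b * g z)) n = taylor_coeff (\<lambda>z. a * cesaro f z + b * cesaro g z) n" for n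
    using f g h
    by (simp add: taylor_coeff_cesaro taylor_coeff_linear cesaro_holomorphic sum.distrib sum_distrib_left
        add_divide_distrib del: of_nat_add of_nat_Suc)
qed (auto simp: cesaro_outside)

text \<open>The solution \<open>k\<close> of \<open>(1 - z) (z k' + k) = s k + f\<close>. The integrating factor \<open>(1 - z)\<^sup>s\<close> turns this
  equation into an Euler equation.\<close>

definition resolvent_kernel :: "complex \<Rightarrow> (complex \<Rightarrow> complex) \<Rightarrow> complex \<Rightarrow> complex"
  where "resolvent_kernel s f z = (if z \<in> ball 0 1
    then (1 - z) powr (- s) * Euler_solution s (\<lambda>w. (1 - w) powr (s - 1) * f w) z else 0)"

lemma one_minus_not_nonpos: "norm (z::complex) < 1 \<Longrightarrow> 1 - z \<notin> \<real>\<^sub>\<le>\<^sub>0"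
  using complex_Re_le_cmod[of z] by (auto simp: complex_nonpos_Reals_iff)

lemma holomorphic_one_minus_powr: "(\<lambda>z. (1 - z) powr a) holomorphic_on ball 0 1"
  by (intro holomorphic_intros) (use one_minus_not_nonpos in auto)

text \<open>The case \<open>a = s\<close> is the equation for \<open>resolvent_kernel\<close>. The case \<open>a = Re s\<close> differs from it by
  the factor \<open>(1 - z)\<close> to an imaginary power, which is bounded from above and below in the disc; it is the
  form in which the energy estimate works, as only the real part of \<open>s\<close> remains in front of the
  singular term \<open>1 / (1 - z)\<close>.\<close>

lemma weighted_Euler_solution_ode:
  fixes a s z :: complex
  assumes s: "Re s < 1" and f: "f holomorphic_on ball 0 1" and z: "norm z < 1"
  defines "P \<equiv> Euler_solution s (\<lambda>w. (1 - w) powr (s - 1) * f w)"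
  defines "k \<equiv> \<lambda>z. (1 - z) powr (- a) * P z"
  shows "k holomorphic_on ball 0 1"
    "z * deriv k z = - k z + (a / (1 - z) + (s - a)) * k z + (1 - z) powr (s - a) * f z / (1 - z)"
proof -
  have \<phi>: "(\<lambda>w. (1 - w) powr (s - 1) * f w) holomorphic_on ball 0 1"
    by (intro holomorphic_intros holomorphic_one_minus_powr f)
  have P: "P holomorphic_on ball 0 1"
    unfolding P_def by (rule Euler_solution_holomorphic[OF s \<phi>])
  show "k holomorphic_on ball 0 1"
    unfolding k_def by (intro holomorphic_intros holomorphic_one_minus_powr P)
  have nz: "1 - z \<noteq> 0" using z by auto
  have "(P has_field_derivative deriv P z) (at z)"
    using holomorphic_derivI[OF P open_ball] z by simp
  then have "(k has_field_derivative
      (- a) * (1 - z) powr (- a - 1) * (-1) * P z + (1 - z) powr (- a) * deriv P z) (at z)"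
    unfolding k_def using one_minus_not_nonpos[OF z]
    by (auto intro!: derivative_eq_intros)
  then have "deriv k z = a * (1 - z) powr (- a - 1) * P z + (1 - z) powr (- a) * deriv P z"
    by (simp add: DERIV_imp_deriv)
  also have "(1 - z) powr (- a - 1) = (1 - z) powr (- a) / (1 - z)"
    using nz by (simp add: powr_diff)
  finally have dk: "z * deriv k z = a * z / (1 - z) * k z + (1 - z) powr (- a) * (z * deriv P z)"
    by (simp add: k_def algebra_simps)
  have zP: "z * deriv P z = (1 - z) powr (s - 1) * f z - (1 - s) * P z"
    using Euler_solution_ode[OF s \<phi> z] by (simp add: P_def algebra_simps)
  have "(1 - z) powr (- a) * (z * deriv P z)
      = ((1 - z) powr (- a) * (1 - z) powr (s - 1)) * f z - (1 - s) * k z"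
    unfolding zP k_def by (simp add: algebra_simps)
  also have "(1 - z) powr (- a) * (1 - z) powr (s - 1) = (1 - z) powr (s - a) / (1 - z)"
    using nz by (simp add: powr_diff powr_minus field_simps)
  finally have "z * deriv k z = a * z / (1 - z) * k z + ((1 - z) powr (s - a) / (1 - z) * f z - (1 - s) * k z)"
    using dk by simp
  moreover have "a * z / (1 - z) = a / (1 - z) - a" using nz by (simp add: field_simps)
  ultimately show "z * deriv k z = - k z + (a / (1 - z) + (s - a)) * k z + (1 - z) powr (s - a) * f z / (1 - z)"
    by (simp add: algebra_simps)
qed

lemma resolvent_kernel_holomorphic:
  assumes s: "Re s < 1" and f: "f holomorphic_on ball 0 1"
  shows "resolvent_kernel s f holomorphic_on ball 0 1"
proof -
  have "(\<lambda>z. (1 - z) powr (- s) * Euler_solution s (\<lambda>w. (1 - w) powr (s - 1) * f w) z) holomorphic_on ball 0 1"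
    by (rule weighted_Euler_solution_ode(1)[OF s f, of 0]) simp
  then show ?thesis
    by (rule holomorphic_transform) (simp add: resolvent_kernel_def)
qed

text \<open>Both sides satisfy \<open>z u' + u = (s k + f) / (1 - z)\<close>, and this Euler equation determines all Taylor
  coefficients.\<close>

lemma resolvent_kernel_eq:
  assumes s: "Re s < 1" and f: "f holomorphic_on ball 0 1"
  shows "resolvent_kernel s f = cesaro (\<lambda>z. s * resolvent_kernel s f z + 1 * f z)"
proof -
  let ?k = "resolvent_kernel s f"
  let ?h = "\<lambda>z. s * ?k z + 1 * f z"
  have k: "?k holomorphic_on ball 0 1" using resolvent_kernel_holomorphic[OF s f] .
  have h: "?h holomorphic_on ball 0 1" by (intro holomorphic_intros k f)
  have ode: "z * deriv ?k z + 1 * ?k z = ?h z / (1 - z)" if z: "norm z < 1" for z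
  proof -
    let ?q = "\<lambda>z. (1 - z) powr (- s) * Euler_solution s (\<lambda>w. (1 - w) powr (s - 1) * f w) z"
    have "\<forall>\<^sub>F w in nhds z. ?k w = ?q w"
    proof -
      have "\<forall>\<^sub>F w in nhds z. w \<in> ball 0 1" by (rule eventually_nhds_in_open) (use z in auto)
      then show ?thesis by eventually_elim (simp add: resolvent_kernel_def)
    qed
    then have "deriv ?k z = deriv ?q z" "?k z = ?q z"
      by (auto intro!: deriv_cong_ev dest: eventually_nhds_x_imp_x)
    then have "z * deriv ?k z = - ?k z + (s / (1 - z) + (s - s)) * ?k z + (1 - z) powr (s - s) * f z / (1 - z)"
      using weighted_Euler_solution_ode(2)[OF s f z, of s] by (simp only:)
    moreover have "1 - z \<noteq> 0" using z by auto
    ultimately have "z * deriv ?k z = - ?k z + s / (1 - z) * ?k z + f z / (1 - z)" by simp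
    then show ?thesis by (simp add: add_divide_distrib)
  qed
  show ?thesis
  proof (rule disc_function_eqI[OF k cesaro_holomorphic[OF h]])
    fix n
    have "taylor_coeff (\<lambda>z. z * deriv ?k z + 1 * ?k z) = taylor_coeff (\<lambda>z. ?h z / (1 - z))"
    proof -
      have hol: "(\<lambda>z. z * deriv ?k z + 1 * ?k z) holomorphic_on ball 0 1"
        by (intro holomorphic_intros k) auto
      show ?thesis
        by (rule power_series_on_disc(2)) (use taylor_sums[OF holomorphic_div_1_minus[OF h]] ode in simp)
    qed
    then have "(of_nat n + 1) * taylor_coeff ?k n = taylor_coeff (\<lambda>z. ?h z / (1 - z)) n"
      using taylor_coeff_Euler[OF k, of 1 n] by simp
    moreover have "of_nat n + 1 \<noteq> (0::complex)" by (metis of_nat_Suc of_nat_neq_0 add.commute)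
    ultimately show "taylor_coeff ?k n = taylor_coeff (cesaro ?h) n"
      unfolding taylor_coeff_cesaro[OF h] sum_taylor_coeff[OF h] by (simp add: field_simps)
  qed (simp_all add: resolvent_kernel_def cesaro_outside)
qed

text \<open>By \<open>resolvent_kernel_eq\<close>, \<open>K = resolvent_kernel s\<close> satisfies \<open>K = C + s C K\<close>; hence
  \<open>- s - s\<^sup>2 K\<close> is a right inverse of \<open>C - 1/s\<close>.\<close>

lemma resolvent_solution:
  assumes s: "Re s < 1" "s \<noteq> 0" and f: "f holomorphic_on ball 0 1"
  defines "g \<equiv> \<lambda>z. - s * f z + - s\<^sup>2 * resolvent_kernel s f z"
  shows "cesaro g z - 1 / s * g z = f z"
proof -
  note k = resolvent_kernel_holomorphic[OF s(1) f]
  have K: "resolvent_kernel s f z = s * cesaro (resolvent_kernel s f) z + 1 * cesaro f z"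
    using resolvent_kernel_eq[OF s(1) f] cesaro_linear[OF k f, of s 1] by metis
  have "1 / s * g z = - f z - s * resolvent_kernel s f z"
    using s(2) by (simp add: g_def field_simps power2_eq_square)
  moreover have "cesaro g z = - s * cesaro f z + - s\<^sup>2 * cesaro (resolvent_kernel s f) z"
    unfolding g_def cesaro_linear[OF f k] ..
  ultimately have "cesaro g z - 1 / s * g z = - s * cesaro f z + - s\<^sup>2 * cesaro (resolvent_kernel s f) z
      - (- f z - s * (s * cesaro (resolvent_kernel s f) z + 1 * cesaro f z))"
    using K by (simp only:)
  then show ?thesis by (simp add: algebra_simps power2_eq_square)
qed

text \<open>\<open>C\<close> acts on Taylor coefficients by a lower triangular matrix with diagonal entries
  \<open>1/(n+1)\<close>, none of which equals \<open>1/s\<close>.\<close>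

lemma cesaro_eigenfunction_trivial:
  assumes s: "Re s < 1" "s \<noteq> 0" and g: "g holomorphic_on ball 0 1" "\<And>z. z \<notin> ball 0 1 \<Longrightarrow> g z = 0"
    and eq: "\<And>z. cesaro g z = 1 / s * g z"
  shows "g = 0"
proof -
  have coeff: "of_nat (n + 1) * taylor_coeff g n = s * (\<Sum>k\<le>n. taylor_coeff g k)" for n
  proof -
    have "cesaro g = (\<lambda>z. 1 / s * g z + 0 * g z)" using eq by auto
    then have "taylor_coeff (cesaro g) n = 1 / s * taylor_coeff g n"
      by (simp only: taylor_coeff_linear[OF g(1) g(1)]) simp
    then show ?thesis using taylor_coeff_cesaro[OF g(1), of n] s(2)
      by (simp add: field_simps del: of_nat_Suc of_nat_add)
  qed
  have "taylor_coeff g n = 0" for n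
  proof (induction n rule: less_induct)
    case (less n)
    have "(\<Sum>k\<le>n. taylor_coeff g k) = taylor_coeff g n"
      using less by (simp add: lessThan_Suc_atMost[symmetric])
    then have "(of_nat (n + 1) - s) * taylor_coeff g n = 0" using coeff[of n] by (simp add: left_diff_distrib)
    then show ?case using no_resonance[OF s(1), of n] by simp
  qed
  moreover have "taylor_coeff 0 n = 0" for n
    by (subst taylor_coeff_eqI[of _ 0]) (auto simp: zero_fun_def)
  ultimately show ?thesis
    by (intro disc_function_eqI g) (use g(2) in \<open>auto simp: zero_fun_def\<close>)
qed

section \<open>An energy estimate for the resolvent equation\<close>

text \<open>At zeros the derivative is \<open>0\<close> because \<open>p > 1\<close>, and there the default value \<open>0 powr (p - 2) = 0\<close>
  makes the formula correct.\<close>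

lemma norm_powr_has_derivative:
  fixes x :: complex
  assumes p: "1 < p"
  shows "((\<lambda>x. norm x powr p) has_derivative (\<lambda>h. p * norm x powr (p - 2) * (x \<bullet> h))) (at x)"
proof (cases "x = 0")
  case False
  have "((\<lambda>x. norm x powr p) has_derivative (\<lambda>h. p * norm x powr (p - 1) * (h \<bullet> sgn x))) (at x)"
    by (rule has_derivative_eq_rhs[OF DERIV_compose_FDERIV[OF has_real_derivative_powr has_derivative_norm]])
       (use False in \<open>auto simp: fun_eq_iff\<close>)
  moreover have "norm x powr (p - 1) * (h \<bullet> sgn x) = norm x powr (p - 2) * (x \<bullet> h)" for h
  proof -
    have "norm x powr (p - 1) = norm x powr (p - 2) * norm x"
      using False powr_add[of "norm x" "p - 2" 1] by simp
    then show ?thesis using False by (simp add: sgn_div_norm inner_commute)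
  qed
  ultimately show ?thesis by (simp add: mult.assoc)
next
  case True
  have "((\<lambda>h. norm h powr (p - 1)) \<longlongrightarrow> 0) (at (0::complex))"
    using p by (intro tendsto_zero_powrI tendsto_norm_zero tendsto_ident_at tendsto_const) auto
  moreover have "\<forall>\<^sub>F h in at (0::complex). norm h powr (p - 1) = norm (norm h powr p) / norm h"
    by (auto simp: eventually_at_filter powr_diff)
  ultimately have "((\<lambda>h. norm (norm h powr p) / norm h) \<longlongrightarrow> 0) (at (0::complex))"
    using tendsto_cong by fastforce
  then show ?thesis using True by (simp add: has_derivative_at)
qed

lemma norm_powr_has_real_derivative:
  fixes x :: "real \<Rightarrow> complex"
  assumes p: "1 < p" and x: "(x has_vector_derivative x') (at t within S)"
  shows "((\<lambda>t. norm (x t) powr p) has_real_derivative p * norm (x t) powr (p - 2) * (x t \<bullet> x')) (at t within S)"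
proof -
  have "((\<lambda>t. norm (x t) powr p) has_derivative (\<lambda>h. p * norm (x t) powr (p - 2) * (x t \<bullet> (h *\<^sub>R x')))) (at t within S)"
    using has_derivative_compose[OF x[unfolded has_vector_derivative_def] norm_powr_has_derivative[OF p]] .
  then show ?thesis
    unfolding has_field_derivative_def by (rule has_derivative_eq_rhs) (auto simp: fun_eq_iff)
qed

lemma continuous_on_norm_powr_scaleR:
  fixes g :: "'b::topological_space \<Rightarrow> complex"
  assumes p: "1 < p" and g: "continuous_on S g"
  shows "continuous_on S (\<lambda>x. norm (g x) powr (p - 2) *\<^sub>R g x)"
proof -
  have "continuous (at x) (\<lambda>x. norm x powr (p - 2) *\<^sub>R x)" for x :: complex
  proof (cases "x = 0")
    case False
    then show ?thesis by (intro continuous_intros) auto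
  next
    case True
    have "((\<lambda>h. norm h powr (p - 1)) \<longlongrightarrow> 0) (at (0::complex))"
      using p by (intro tendsto_zero_powrI tendsto_norm_zero tendsto_ident_at tendsto_const) auto
    moreover have "\<forall>\<^sub>F h in at (0::complex). norm h powr (p - 1) = norm (norm h powr (p - 2) *\<^sub>R h)"
    proof -
      have "norm h powr (p - 1) = norm h powr (p - 2) * norm h" if "h \<noteq> 0" for h :: complex
        using that powr_add[of "norm h" "p - 2" 1] by simp
      then show ?thesis by (auto simp: eventually_at_filter)
    qed
    ultimately have "((\<lambda>h. norm (norm h powr (p - 2) *\<^sub>R h)) \<longlongrightarrow> 0) (at (0::complex))"
      using tendsto_cong by fastforce
    then have "((\<lambda>h. norm h powr (p - 2) *\<^sub>R h) \<longlongrightarrow> 0) (at (0::complex))"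
      by (rule tendsto_norm_zero_cancel)
    then show ?thesis using True by (simp add: continuous_at)
  qed
  then have "continuous_on UNIV (\<lambda>x::complex. norm x powr (p - 2) *\<^sub>R x)"
    by (simp add: continuous_at_imp_continuous_on)
  then show ?thesis
    using continuous_on_compose2[OF _ g] by blast
qed

text \<open>Distinguish whether \<open>y \<le> \<delta> x\<close>.\<close>

lemma powr_absorb:
  fixes x y \<delta> p :: real
  assumes "1 < p" "0 \<le> x" "0 \<le> y" "0 < \<delta>"
  shows "x powr (p - 1) * y \<le> \<delta> * x powr p + \<delta> powr (1 - p) * y powr p"
proof (cases "y \<le> \<delta> * x")
  case True
  then have "x powr (p - 1) * y \<le> x powr (p - 1) * (\<delta> * x)" by (intro mult_left_mono) auto
  also have "\<dots> = \<delta> * x powr p" using assms powr_add[of x "p - 1" 1] by (cases "x = 0") auto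
  finally show ?thesis using assms by (meson add_increasing2 mult_nonneg_nonneg powr_ge_zero)
next
  case False
  then have "x \<le> y / \<delta>" "0 < y" using assms by (auto simp: field_simps intro: le_less_trans[of 0 "\<delta> * x"])
  then have "x powr (p - 1) * y \<le> (y / \<delta>) powr (p - 1) * y"
    using assms by (intro mult_right_mono powr_mono2) auto
  also have "\<dots> = \<delta> powr (1 - p) * y powr p"
    using assms \<open>0 < y\<close> powr_add[of y "p - 1" 1] powr_minus[of \<delta> "p - 1"] by (simp add: powr_divide field_simps)
  finally show ?thesis using assms by (meson add_increasing mult_nonneg_nonneg powr_ge_zero less_imp_le)
qed

lemma powr_diff_2_inner:
  fixes k w :: complex
  assumes "p > 1"
  shows "norm k powr (p - 2) * norm k = norm k powr (p - 1)" "norm k powr (p - 2) * (norm k)\<^sup>2 = norm k powr p"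
  using assms powr_add[of "norm k" "p - 2" 1] powr_add[of "norm k" "p - 2" 2] by (cases "k = 0"; simp)+

text \<open>The right-hand side is the angular derivative of \<open>Im z |k|\<^sup>p\<close> if \<open>w = z k'\<close>. Its coefficient of
  \<open>|k|\<^sup>p\<close> is \<open>Re z - p \<sigma> (Im z)\<^sup>2 / |1 - z|\<^sup>2 - p \<tau> Im z\<close>. Here \<open>Re z \<ge> 1 - |1 - z|\<close>, \<open>|Im z| \<le> |1 - z|\<close>
  and the quotient is between \<open>0\<close> and \<open>1\<close>, so the coefficient is at least \<open>c - C |1 - z|\<close>, where
  \<open>c > 0\<close> expresses the hypothesis \<open>p \<sigma> < 1\<close>. The factor \<open>Im z\<close> also cancels the singularity of
  \<open>f / (1 - z)\<close>.\<close>

lemma angular_pointwise: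
  fixes p \<sigma> \<tau> :: real and z k f w :: complex
  assumes p: "1 < p" and z: "z \<noteq> 1" and \<sigma>: "p * \<sigma> < 1"
    and w: "w = - k + (of_real \<sigma> / (1 - z) + \<i> * of_real \<tau>) * k + f / (1 - z)"
  defines "c \<equiv> 1 - p * max \<sigma> 0" and "C \<equiv> 1 + p * \<bar>\<tau>\<bar>"
  shows "c / 2 * norm k powr p - C\<^sup>2 / c * ((norm (1 - z))\<^sup>2 * norm k powr p) - p * (c / (4 * p)) powr (1 - p) * norm f powr p
    \<le> Re z * norm k powr p + Im z * (p * norm k powr (p - 2) * (k \<bullet> (\<i> * w)))"
proof -
  define d where "d = norm (1 - z)"
  have d: "0 < d" using z by (simp add: d_def)
  have c: "0 < c" using \<sigma> p by (auto simp: c_def max_def)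
  have dsq: "d\<^sup>2 = (1 - Re z)\<^sup>2 + (Im z)\<^sup>2" by (simp add: d_def cmod_power2)
  have Imz: "\<bar>Im z\<bar> \<le> d" using abs_Im_le_cmod[of "1 - z"] by (simp add: d_def)
  have Rez: "1 - d \<le> Re z" using complex_Re_le_cmod[of "1 - z"] by (simp add: d_def)
  have Im_inv: "Im (1 / (1 - z)) = Im z / d\<^sup>2"
    by (simp add: Im_divide dsq)
  define q where "q = Im (cnj k * f / (1 - z))"
  have "cnj k * w = of_real ((norm k)\<^sup>2) * (- 1 + (of_real \<sigma> * (1 / (1 - z)) + \<i> * of_real \<tau>)) + cnj k * f / (1 - z)"
    unfolding w complex_norm_square by (simp add: algebra_simps)
  then have "Im (cnj k * w) = (norm k)\<^sup>2 * (\<sigma> * (Im z / d\<^sup>2) + \<tau>) + q"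
    by (simp only: Im_inv q_def plus_complex.sel times_complex.sel Im_complex_of_real Re_complex_of_real
        uminus_complex.sel one_complex.sel imaginary_unit.sel) simp
  moreover have "k \<bullet> (\<i> * w) = - Im (cnj k * w)"
    by (simp add: inner_complex_def algebra_simps)
  ultimately have inner: "k \<bullet> (\<i> * w) = - ((norm k)\<^sup>2 * (\<sigma> * (Im z / d\<^sup>2) + \<tau>) + q)" by simp
  have "Im z * (p * norm k powr (p - 2) * (k \<bullet> (\<i> * w)))
      = - (p * (norm k powr (p - 2) * (norm k)\<^sup>2) * (\<sigma> * ((Im z)\<^sup>2 / d\<^sup>2) + \<tau> * Im z))
        - p * (norm k powr (p - 2) * (Im z * q))"
    unfolding inner by (simp add: algebra_simps power2_eq_square add_divide_distrib)
  then have E: "Re z * norm k powr p + Im z * (p * norm k powr (p - 2) * (k \<bullet> (\<i> * w)))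
      = (Re z - p * \<sigma> * ((Im z)\<^sup>2 / d\<^sup>2) - p * \<tau> * Im z) * norm k powr p - p * (norm k powr (p - 2) * (Im z * q))"
    unfolding powr_diff_2_inner(2)[OF p] by (simp add: algebra_simps)
  have lower: "c - C * d \<le> Re z - p * \<sigma> * ((Im z)\<^sup>2 / d\<^sup>2) - p * \<tau> * Im z"
  proof -
    have "(Im z)\<^sup>2 \<le> d\<^sup>2" using dsq by simp
    then have frac: "0 \<le> (Im z)\<^sup>2 / d\<^sup>2" "(Im z)\<^sup>2 / d\<^sup>2 \<le> 1" using d by (simp_all add: divide_le_eq_1)
    have "\<sigma> * ((Im z)\<^sup>2 / d\<^sup>2) \<le> max \<sigma> 0 * ((Im z)\<^sup>2 / d\<^sup>2)" using frac by (intro mult_right_mono) auto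
    also have "\<dots> \<le> max \<sigma> 0 * 1" using frac by (intro mult_left_mono) auto
    finally have "p * (\<sigma> * ((Im z)\<^sup>2 / d\<^sup>2)) \<le> p * (max \<sigma> 0 * 1)"
      using p by (intro mult_left_mono) auto
    moreover have "\<tau> * Im z \<le> \<bar>\<tau>\<bar> * d"
      using abs_ge_self[of "\<tau> * Im z"] mult_left_mono[OF Imz abs_ge_zero[of \<tau>]] by (simp add: abs_mult)
    then have "p * (\<tau> * Im z) \<le> p * (\<bar>\<tau>\<bar> * d)" using p by simp
    ultimately show ?thesis using Rez by (simp add: c_def C_def algebra_simps)
  qed
  have "norm k powr (p - 2) * (Im z * q) \<le> norm k powr (p - 1) * norm f"
  proof -
    have "\<bar>Im z * q\<bar> \<le> d * (norm k * norm f / d)"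
      using abs_Im_le_cmod[of "cnj k * f / (1 - z)"] Imz d unfolding abs_mult
      by (intro mult_mono) (auto simp: q_def norm_mult norm_divide d_def)
    then have "Im z * q \<le> norm k * norm f" using d by simp
    then have "norm k powr (p - 2) * (Im z * q) \<le> norm k powr (p - 2) * (norm k * norm f)"
      by (intro mult_left_mono) auto
    then show ?thesis using powr_diff_2_inner(1)[OF p, of k] by (simp add: mult.assoc[symmetric])
  qed
  also have "\<dots> \<le> c / (4 * p) * norm k powr p + (c / (4 * p)) powr (1 - p) * norm f powr p"
    using p c by (intro powr_absorb) auto
  finally have "p * (norm k powr (p - 2) * (Im z * q))
      \<le> p * (c / (4 * p) * norm k powr p + (c / (4 * p)) powr (1 - p) * norm f powr p)"
    using p by (intro mult_left_mono) auto
  also have "\<dots> = c / 4 * norm k powr p + p * (c / (4 * p)) powr (1 - p) * norm f powr p"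
    using p by (simp add: field_simps)
  finally have forcing: "p * (norm k powr (p - 2) * (Im z * q))
      \<le> c / 4 * norm k powr p + p * (c / (4 * p)) powr (1 - p) * norm f powr p" .
  have "C * d \<le> c / 4 + C\<^sup>2 / c * d\<^sup>2"
  proof -
    have "0 \<le> (c / 2 - C * d)\<^sup>2 / c" using c by simp
    also have "\<dots> = c / 4 + C\<^sup>2 / c * d\<^sup>2 - C * d" using c by (simp add: power2_eq_square field_simps)
    finally show ?thesis by simp
  qed
  then have "3 * c / 4 - C\<^sup>2 / c * d\<^sup>2 \<le> Re z - p * \<sigma> * ((Im z)\<^sup>2 / d\<^sup>2) - p * \<tau> * Im z"
    using lower by simp
  then have "(3 * c / 4 - C\<^sup>2 / c * d\<^sup>2) * norm k powr p
      \<le> (Re z - p * \<sigma> * ((Im z)\<^sup>2 / d\<^sup>2) - p * \<tau> * Im z) * norm k powr p"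
    by (intro mult_right_mono) auto
  then show ?thesis using forcing unfolding E d_def[symmetric] by (simp add: algebra_simps)
qed

text \<open>The left-hand side is the radial derivative, times the radius, of \<open>|1 - z|\<^sup>2 |k|\<^sup>p\<close> if \<open>w = z k'\<close>. The
  weight \<open>|1 - z|\<^sup>2\<close> removes the singularities of the equation at \<open>1\<close>.\<close>

lemma radial_pointwise:
  fixes p \<sigma> \<tau> :: real and z k f w :: complex
  assumes p: "1 < p" and z: "norm z < 1"
    and w: "w = - k + (of_real \<sigma> / (1 - z) + \<i> * of_real \<tau>) * k + f / (1 - z)"
  shows "- 2 * ((1 - z) \<bullet> z) * norm k powr p + (norm (1 - z))\<^sup>2 * (p * norm k powr (p - 2) * (k \<bullet> w))
    \<le> (4 + p * (4 + 2 * \<bar>\<sigma>\<bar> + 4 * \<bar>\<tau>\<bar>) + 2 * p) * (norm k powr p + norm f powr p)"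
proof -
  define d where "d = norm (1 - z)"
  have "1 - z \<noteq> 0" using z by auto
  then have d: "0 < d" "d \<le> 2" using z norm_triangle_ineq4[of 1 z] by (auto simp: d_def)
  have "norm w \<le> norm k + (\<bar>\<sigma>\<bar> / d + \<bar>\<tau>\<bar>) * norm k + norm f / d"
  proof -
    have "norm (of_real \<sigma> / (1 - z) + \<i> * of_real \<tau>) \<le> \<bar>\<sigma>\<bar> / d + \<bar>\<tau>\<bar>"
      using norm_triangle_ineq[of "of_real \<sigma> / (1 - z)" "\<i> * of_real \<tau>"] by (simp add: norm_mult norm_divide d_def)
    then have "norm ((of_real \<sigma> / (1 - z) + \<i> * of_real \<tau>) * k) \<le> (\<bar>\<sigma>\<bar> / d + \<bar>\<tau>\<bar>) * norm k"
      by (simp add: norm_mult mult_right_mono)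
    moreover have "norm w \<le> norm k + norm ((of_real \<sigma> / (1 - z) + \<i> * of_real \<tau>) * k) + norm (f / (1 - z))"
      unfolding w using norm_triangle_ineq[of "- k + (of_real \<sigma> / (1 - z) + \<i> * of_real \<tau>) * k" "f / (1 - z)"]
        norm_triangle_ineq[of "- k" "(of_real \<sigma> / (1 - z) + \<i> * of_real \<tau>) * k"] by simp
    ultimately show ?thesis by (simp add: norm_divide d_def)
  qed
  then have "d\<^sup>2 * norm w \<le> d\<^sup>2 * (norm k + (\<bar>\<sigma>\<bar> / d + \<bar>\<tau>\<bar>) * norm k + norm f / d)"
    by (intro mult_left_mono) auto
  also have "\<dots> = (d\<^sup>2 + d * \<bar>\<sigma>\<bar> + d\<^sup>2 * \<bar>\<tau>\<bar>) * norm k + d * norm f"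
    using d by (simp add: power2_eq_square field_simps)
  also have "\<dots> \<le> (4 + 2 * \<bar>\<sigma>\<bar> + 4 * \<bar>\<tau>\<bar>) * norm k + 2 * norm f"
  proof -
    have "d\<^sup>2 \<le> 4" using d power_mono[of d 2 2] by simp
    then show ?thesis using d by (intro add_mono mult_right_mono) auto
  qed
  finally have dw: "d\<^sup>2 * norm w \<le> (4 + 2 * \<bar>\<sigma>\<bar> + 4 * \<bar>\<tau>\<bar>) * norm k + 2 * norm f" .
  have "d\<^sup>2 * (k \<bullet> w) \<le> norm k * (d\<^sup>2 * norm w)"
    using mult_left_mono[OF norm_cauchy_schwarz[of k w], of "d\<^sup>2"] by (simp add: mult_ac)
  also have "\<dots> \<le> norm k * ((4 + 2 * \<bar>\<sigma>\<bar> + 4 * \<bar>\<tau>\<bar>) * norm k + 2 * norm f)"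
    using dw by (intro mult_left_mono) auto
  finally have "p * norm k powr (p - 2) * (d\<^sup>2 * (k \<bullet> w))
      \<le> p * norm k powr (p - 2) * (norm k * ((4 + 2 * \<bar>\<sigma>\<bar> + 4 * \<bar>\<tau>\<bar>) * norm k + 2 * norm f))"
    using p by (intro mult_left_mono) auto
  also have "\<dots> = p * (4 + 2 * \<bar>\<sigma>\<bar> + 4 * \<bar>\<tau>\<bar>) * (norm k powr (p - 2) * (norm k)\<^sup>2)
      + 2 * p * ((norm k powr (p - 2) * norm k) * norm f)"
    by (simp add: power2_eq_square algebra_simps)
  also have "\<dots> = p * (4 + 2 * \<bar>\<sigma>\<bar> + 4 * \<bar>\<tau>\<bar>) * norm k powr p + 2 * p * (norm k powr (p - 1) * norm f)"
    unfolding powr_diff_2_inner[OF p] ..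
  also have "\<dots> \<le> p * (4 + 2 * \<bar>\<sigma>\<bar> + 4 * \<bar>\<tau>\<bar>) * norm k powr p + 2 * p * (norm k powr p + norm f powr p)"
    using powr_absorb[of p "norm k" "norm f" 1] p by (intro add_mono mult_left_mono) auto
  finally have second: "(norm (1 - z))\<^sup>2 * (p * norm k powr (p - 2) * (k \<bullet> w))
      \<le> p * (4 + 2 * \<bar>\<sigma>\<bar> + 4 * \<bar>\<tau>\<bar>) * norm k powr p + 2 * p * (norm k powr p + norm f powr p)"
    by (simp add: d_def mult_ac)
  have "- 2 * ((1 - z) \<bullet> z) \<le> 4"
  proof -
    have "\<bar>(1 - z) \<bullet> z\<bar> \<le> 2 * 1"
      using Cauchy_Schwarz_ineq2[of "1 - z" z] mult_mono[of "norm (1 - z)" 2 "norm z" 1] d z by (auto simp: d_def)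
    then show ?thesis by linarith
  qed
  then have "- 2 * ((1 - z) \<bullet> z) * norm k powr p \<le> 4 * norm k powr p" by (intro mult_right_mono) auto
  moreover have "0 \<le> (4 + p * (4 + 2 * \<bar>\<sigma>\<bar> + 4 * \<bar>\<tau>\<bar>)) * norm f powr p" using p by simp
  ultimately show ?thesis using second by (simp add: algebra_simps)
qed

lemma Gronwall_linear:
  fixes Z :: "real \<Rightarrow> real"
  assumes deriv: "\<And>r. a \<le> r \<Longrightarrow> r \<le> b \<Longrightarrow> (Z has_real_derivative Z' r) (at r)"
    and le: "\<And>r. a \<le> r \<Longrightarrow> r \<le> b \<Longrightarrow> Z' r \<le> \<alpha> * Z r + \<beta>"
    and "0 \<le> \<alpha>" "0 \<le> \<beta>" "a \<le> b" "b \<le> a + 1"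
    and "0 \<le> Z a"
  shows "Z b \<le> exp \<alpha> * (Z a + \<beta>)"
proof -
  define H where "H r = exp (- \<alpha> * (r - a)) * Z r - \<beta> * r" for r
  have "H b \<le> H a"
  proof (rule DERIV_nonpos_imp_nonincreasing[OF \<open>a \<le> b\<close>])
    fix r assume r: "a \<le> r" "r \<le> b"
    have "(H has_real_derivative exp (- \<alpha> * (r - a)) * (Z' r - \<alpha> * Z r) - \<beta>) (at r)"
      unfolding H_def by (rule derivative_eq_intros deriv r refl | simp add: algebra_simps)+
    moreover have "exp (- \<alpha> * (r - a)) * (Z' r - \<alpha> * Z r) \<le> 1 * \<beta>"
    proof (rule order_trans)
      show "exp (- \<alpha> * (r - a)) * (Z' r - \<alpha> * Z r) \<le> exp (- \<alpha> * (r - a)) * \<beta>"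
        using le[OF r] by (intro mult_left_mono) auto
      show "exp (- \<alpha> * (r - a)) * \<beta> \<le> 1 * \<beta>"
        using assms r by (intro mult_right_mono) auto
    qed
    ultimately show "\<exists>y. (H has_real_derivative y) (at r) \<and> y \<le> 0" by force
  qed
  then have "exp (- \<alpha> * (b - a)) * Z b \<le> Z a + \<beta> * (b - a)" by (simp add: H_def algebra_simps)
  also have "\<dots> \<le> Z a + \<beta> * 1" using assms by (intro add_left_mono mult_left_mono) auto
  finally have "exp (\<alpha> * (b - a)) * (exp (- \<alpha> * (b - a)) * Z b) \<le> exp (\<alpha> * (b - a)) * (Z a + \<beta>)"
    by (intro mult_left_mono) auto
  also have "exp (\<alpha> * (b - a)) * (exp (- \<alpha> * (b - a)) * Z b) = Z b"
    by (simp add: mult.assoc[symmetric] flip: exp_add)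
  also have "exp (\<alpha> * (b - a)) * (Z a + \<beta>) \<le> exp \<alpha> * (Z a + \<beta>)"
    using assms mult_left_mono[of "b - a" 1 \<alpha>] by (intro mult_right_mono) auto
  finally show ?thesis .
qed

definition power_integral :: "real \<Rightarrow> (complex \<Rightarrow> complex) \<Rightarrow> real \<Rightarrow> real"
  where "power_integral p g r = integral {0..2*pi} (\<lambda>t. norm (g (of_real r * cis t)) powr p)"

definition weighted_integral :: "real \<Rightarrow> (complex \<Rightarrow> complex) \<Rightarrow> real \<Rightarrow> real"
  where "weighted_integral p k r = integral {0..2*pi}
    (\<lambda>t. (norm (1 - of_real r * cis t))\<^sup>2 * norm (k (of_real r * cis t)) powr p)"

text \<open>The constant that the proof of \<open>energy_estimate\<close> produces. It matters only that it does not depend on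
  the functions involved.\<close>

definition energy_constant :: "real \<Rightarrow> real \<Rightarrow> real \<Rightarrow> real"
  where "energy_constant p \<sigma> \<tau> =
    (let c = 1 - p * max \<sigma> 0; C = 1 + p * \<bar>\<tau>\<bar>;
         a = 2 / c * (C\<^sup>2 / c); b = 2 / c * (p * (c / (4 * p)) powr (1 - p));
         A = 2 * (4 + p * (4 + 2 * \<bar>\<sigma>\<bar> + 4 * \<bar>\<tau>\<bar>) + 2 * p)
     in 4 * a * exp (A * a) + (a * exp (A * a) * (A * (b + 1)) + b))"

context
  fixes p \<sigma> \<tau> :: real and k f :: "complex \<Rightarrow> complex"
  assumes p: "1 < p" and k: "k holomorphic_on ball 0 1" and f: "f holomorphic_on ball 0 1"
    and ode: "\<And>z. norm z < 1 \<Longrightarrow>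
      z * deriv k z = - k z + (of_real \<sigma> / (1 - z) + \<i> * of_real \<tau>) * k z + f z / (1 - z)"
begin

lemma continuous_on_polar:
  assumes "g holomorphic_on ball 0 1"
  shows "continuous_on ({0<..<1} \<times> S) (\<lambda>(r, t). g (of_real r * cis t))"
proof -
  have "continuous_on ({0<..<1} \<times> S) (\<lambda>x. g (of_real (fst x) * cis (snd x)))"
    by (rule continuous_on_compose2[OF holomorphic_on_imp_continuous_on[OF assms]])
       (auto intro!: continuous_intros simp: norm_mult)
  then show ?thesis by (simp add: case_prod_unfold)
qed

lemma power_continuous:
  assumes "g holomorphic_on ball 0 1" "0 < r" "r < 1"
  shows "continuous_on S (\<lambda>t. norm (g (of_real r * cis t)) powr p)"
  by (intro norm_powr_continuous continuous_on_circle) (use p assms in auto)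

text \<open>\<open>Im z |k|\<^sup>p\<close> vanishes at both ends \<open>t = 0\<close> and \<open>t = 2 \<pi>\<close>, so the integral of its derivative is \<open>0\<close>.\<close>

lemma angular_estimate:
  assumes \<sigma>: "p * \<sigma> < 1" and r: "0 < r" "r < 1"
  defines "c \<equiv> 1 - p * max \<sigma> 0" and "C \<equiv> 1 + p * \<bar>\<tau>\<bar>"
  shows "c / 2 * power_integral p k r
    \<le> C\<^sup>2 / c * weighted_integral p k r + p * (c / (4 * p)) powr (1 - p) * power_integral p f r"
proof -
  define z where "z t = of_real r * cis t" for t
  have z: "norm (z t) < 1" for t using r by (simp add: z_def norm_mult)
  have z': "(z has_vector_derivative \<i> * z t) (at t within S)" for t S
  proof -
    have "(cis has_vector_derivative \<i> * cis t) (at t within S)"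
      using has_derivative_cis[OF has_derivative_ident] by (simp add: has_vector_derivative_def)
    then have "((\<lambda>t. of_real r * cis t) has_vector_derivative of_real r * (\<i> * cis t)) (at t within S)"
      by (rule has_vector_derivative_mult_right)
    then show ?thesis by (simp add: z_def[abs_def] mult.left_commute)
  qed
  have k': "((\<lambda>t. k (z t)) has_vector_derivative \<i> * z t * deriv k (z t)) (at t within S)" for t S
    using field_vector_diff_chain_within[OF z' has_field_derivative_at_within[OF holomorphic_derivI[OF k open_ball]]] z
    by (simp add: o_def)
  define E where "E t = Re (z t) * norm (k (z t)) powr p
    + Im (z t) * (p * norm (k (z t)) powr (p - 2) * (k (z t) \<bullet> (\<i> * (z t * deriv k (z t)))))" for t
  have "((\<lambda>t. Im (z t) * norm (k (z t)) powr p) has_real_derivative E t) (at t within S)" for t S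
  proof -
    have "((\<lambda>t. Im (z t)) has_real_derivative Re (z t)) (at t within S)"
      unfolding z_def by (auto intro!: derivative_eq_intros)
    then have "((\<lambda>t. Im (z t) * norm (k (z t)) powr p) has_real_derivative
        Re (z t) * norm (k (z t)) powr p
        + p * norm (k (z t)) powr (p - 2) * (k (z t) \<bullet> (\<i> * z t * deriv k (z t))) * Im (z t)) (at t within S)"
      by (rule DERIV_mult[OF _ norm_powr_has_real_derivative[OF p k']])
    then show ?thesis by (simp add: E_def mult_ac)
  qed
  then have "(E has_integral Im (z (2 * pi)) * norm (k (z (2 * pi))) powr p - Im (z 0) * norm (k (z 0)) powr p) {0..2*pi}"
    by (intro fundamental_theorem_of_calculus)
       (auto simp: has_real_derivative_iff_has_vector_derivative[symmetric])
  then have E: "(E has_integral 0) {0..2*pi}" by (simp add: z_def)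
  let ?L = "\<lambda>t. c / 2 * norm (k (z t)) powr p - C\<^sup>2 / c * ((norm (1 - z t))\<^sup>2 * norm (k (z t)) powr p)
      - p * (c / (4 * p)) powr (1 - p) * norm (f (z t)) powr p"
  have le: "?L t \<le> E t" for t
    unfolding E_def c_def C_def
  proof (rule angular_pointwise[OF p _ \<sigma>])
    show "z t \<noteq> 1" using z[of t] by auto
    show "z t * deriv k (z t) = - k (z t) + (of_real \<sigma> / (1 - z t) + \<i> * of_real \<tau>) * k (z t) + f (z t) / (1 - z t)"
      by (rule ode[OF z])
  qed
  have I: "((\<lambda>t. norm (k (z t)) powr p) has_integral power_integral p k r) {0..2*pi}"
    "((\<lambda>t. norm (f (z t)) powr p) has_integral power_integral p f r) {0..2*pi}"
    "((\<lambda>t. (norm (1 - z t))\<^sup>2 * norm (k (z t)) powr p) has_integral weighted_integral p k r) {0..2*pi}"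
    unfolding power_integral_def weighted_integral_def z_def
    by (intro integrable_integral integrable_continuous_real continuous_intros power_continuous k f r)+
  have "(?L has_integral c / 2 * power_integral p k r - C\<^sup>2 / c * weighted_integral p k r
      - p * (c / (4 * p)) powr (1 - p) * power_integral p f r) {0..2*pi}"
    by (intro has_integral_diff has_integral_mult_right I)
  from has_integral_le[OF this E] le show ?thesis by simp
qed

lemma radial_estimate:
  assumes r: "0 < r" "r < 1"
  obtains D where "(weighted_integral p k has_real_derivative D) (at r)"
    "r * D \<le> (4 + p * (4 + 2 * \<bar>\<sigma>\<bar> + 4 * \<bar>\<tau>\<bar>) + 2 * p) * (power_integral p k r + power_integral p f r)"
proof -
  define z where "z r t = of_real r * cis t" for r t
  have z: "norm (z r t) < 1" if "r \<in> {0<..<1}" for r t using that by (simp add: z_def norm_mult)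
  have z': "((\<lambda>r. z r t) has_vector_derivative cis t) (at r within S)" for r t S
    unfolding z_def by (auto intro!: derivative_eq_intros)
  have k': "((\<lambda>r. k (z r t)) has_vector_derivative cis t * deriv k (z r t)) (at r within S)"
    if "r \<in> {0<..<1}" for r t S
    using field_vector_diff_chain_within[OF z' has_field_derivative_at_within[OF holomorphic_derivI[OF k open_ball]]] z[OF that]
    by (simp add: o_def)
  define G' where "G' r t = - 2 * ((1 - z r t) \<bullet> cis t) * norm (k (z r t)) powr p
    + (norm (1 - z r t))\<^sup>2 * (p * ((norm (k (z r t)) powr (p - 2) *\<^sub>R k (z r t)) \<bullet> (cis t * deriv k (z r t))))" for r t
  have G': "((\<lambda>r. (norm (1 - z r t))\<^sup>2 * norm (k (z r t)) powr p) has_real_derivative G' r t) (at r within {0<..<1})"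
    if "r \<in> {0<..<1}" for r t
  proof -
    have "((\<lambda>r. (1 - z r t) \<bullet> (1 - z r t)) has_real_derivative - 2 * ((1 - z r t) \<bullet> cis t)) (at r within {0<..<1})"
      unfolding has_real_derivative_iff_has_vector_derivative
      by (rule has_vector_derivative_eq_rhs, rule bounded_bilinear.has_vector_derivative[OF bounded_bilinear_inner])
         (auto intro!: derivative_eq_intros z' simp: inner_commute)
    then have "((\<lambda>r. (norm (1 - z r t))\<^sup>2) has_real_derivative - 2 * ((1 - z r t) \<bullet> cis t)) (at r within {0<..<1})"
      by (simp add: power2_norm_eq_inner)
    from DERIV_mult[OF this norm_powr_has_real_derivative[OF p k'[OF that]]]
    show ?thesis by (simp add: G'_def mult_ac)
  qed
  have cont: "continuous_on ({0<..<1} \<times> cbox 0 (2*pi)) (\<lambda>(r, t). G' r t)"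
  proof -
    have ck: "continuous_on ({0<..<1} \<times> cbox 0 (2*pi)) (\<lambda>x. k (z (fst x) (snd x)))"
      using continuous_on_polar[OF k] by (simp add: z_def case_prod_unfold)
    have cdk: "continuous_on ({0<..<1} \<times> cbox 0 (2*pi)) (\<lambda>x. deriv k (z (fst x) (snd x)))"
      using continuous_on_polar[OF holomorphic_deriv[OF k open_ball]] by (simp add: z_def case_prod_unfold)
    have cz: "continuous_on ({0<..<1} \<times> cbox 0 (2*pi)) (\<lambda>x. z (fst x) (snd x))"
      unfolding z_def by (intro continuous_intros)
    have "continuous_on ({0<..<1} \<times> cbox 0 (2*pi)) (\<lambda>x. G' (fst x) (snd x))"
      unfolding G'_def
      by (intro continuous_intros continuous_on_norm_powr_scaleR continuous_on_powr' ck cdk cz p) (use p in auto)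
    then show ?thesis by (simp add: case_prod_unfold)
  qed
  have "((\<lambda>r. integral (cbox 0 (2*pi)) (\<lambda>t. (norm (1 - z r t))\<^sup>2 * norm (k (z r t)) powr p))
      has_real_derivative integral (cbox 0 (2*pi)) (G' r)) (at r within {0<..<1})"
  proof (rule leibniz_rule_field_derivative[OF G' _ cont])
    show "(\<lambda>t. (norm (1 - z x t))\<^sup>2 * norm (k (z x t)) powr p) integrable_on cbox 0 (2*pi)" if "x \<in> {0<..<1}" for x
      unfolding z_def
      by (intro integrable_continuous continuous_intros power_continuous k) (use that in auto)
  qed (use r in auto)
  then have "((\<lambda>r. integral (cbox 0 (2*pi)) (\<lambda>t. (norm (1 - z r t))\<^sup>2 * norm (k (z r t)) powr p))
      has_real_derivative integral (cbox 0 (2*pi)) (G' r)) (at r)"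
    using r by (simp add: at_within_open[of r "{0<..<1}"])
  then have deriv: "(weighted_integral p k has_real_derivative integral {0..2*pi} (G' r)) (at r)"
    by (simp add: weighted_integral_def[abs_def] z_def)
  let ?A = "4 + p * (4 + 2 * \<bar>\<sigma>\<bar> + 4 * \<bar>\<tau>\<bar>) + 2 * p"
  have "integral {0..2*pi} (\<lambda>t. r * G' r t) \<le> integral {0..2*pi} (\<lambda>t. ?A * (norm (k (z r t)) powr p + norm (f (z r t)) powr p))"
  proof (rule integral_le)
    have "continuous_on {0..2*pi} (\<lambda>t. G' r t)"
    proof -
      have "continuous_on {0..2*pi} (\<lambda>t. (\<lambda>(r, t). G' r t) (r, t))"
        by (rule continuous_on_compose2[OF cont]) (use r in \<open>auto intro!: continuous_intros\<close>)
      then show ?thesis by simp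
    qed
    then show "(\<lambda>t. r * G' r t) integrable_on {0..2*pi}"
      by (intro integrable_continuous_real continuous_intros)
    show "(\<lambda>t. ?A * (norm (k (z r t)) powr p + norm (f (z r t)) powr p)) integrable_on {0..2*pi}"
      unfolding z_def by (intro integrable_continuous_real continuous_intros power_continuous k f r)
    fix t
    have rcis: "of_real r * cis t = z r t" by (simp add: z_def)
    have "r * G' r t = - 2 * ((1 - z r t) \<bullet> (r *\<^sub>R cis t)) * norm (k (z r t)) powr p
      + (norm (1 - z r t))\<^sup>2 * (p * norm (k (z r t)) powr (p - 2) * (k (z r t) \<bullet> (r *\<^sub>R cis t * deriv k (z r t))))"
      by (simp add: G'_def algebra_simps)
    also have "r *\<^sub>R cis t = z r t" by (simp add: z_def scaleR_conv_of_real)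
    also have "- 2 * ((1 - z r t) \<bullet> z r t) * norm (k (z r t)) powr p
      + (norm (1 - z r t))\<^sup>2 * (p * norm (k (z r t)) powr (p - 2) * (k (z r t) \<bullet> (z r t * deriv k (z r t))))
      \<le> ?A * (norm (k (z r t)) powr p + norm (f (z r t)) powr p)"
      using r by (intro radial_pointwise p z ode) auto
    finally show "r * G' r t \<le> ?A * (norm (k (z r t)) powr p + norm (f (z r t)) powr p)" .
  qed
  also have "\<dots> = ?A * (power_integral p k r + power_integral p f r)"
    unfolding power_integral_def z_def
    by (subst integral_mult_right, subst integral_add)
       (auto intro!: integrable_continuous_real power_continuous k f r)
  finally show ?thesis using that[OF deriv] by simp
qed

lemma power_integral_nonneg: "g holomorphic_on ball 0 1 \<Longrightarrow> 0 < r \<Longrightarrow> r < 1 \<Longrightarrow> 0 \<le> power_integral p g r"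
  unfolding power_integral_def
  by (intro integral_nonneg integrable_continuous_real power_continuous) auto

text \<open>\<open>angular_estimate\<close> bounds \<open>Y = \<integral>|k|\<^sup>p\<close> by a multiple of \<open>Z = \<integral>|1 - z|\<^sup>2 |k|\<^sup>p\<close> plus data, and
  \<open>radial_estimate\<close> bounds \<open>Z'\<close> by a multiple of \<open>Y\<close> plus data. Together \<open>Z' \<le> \<alpha> Z + \<beta>\<close>, so
  \<open>Z\<close>, and then \<open>Y\<close>, stays bounded up to the boundary. The radius \<open>1/2\<close> as a starting point keeps
  away from the singularity of polar coordinates.\<close>

lemma energy_estimate:
  assumes \<sigma>: "p * \<sigma> < 1" and \<Phi>: "\<And>r. 0 < r \<Longrightarrow> r < 1 \<Longrightarrow> power_integral p f r \<le> \<Phi>" and \<Phi>0: "0 \<le> \<Phi>"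
    and r: "1/2 \<le> r" "r < 1"
  shows "power_integral p k r \<le> energy_constant p \<sigma> \<tau> * (power_integral p k (1/2) + \<Phi>)"
proof -
  define c where "c = 1 - p * max \<sigma> 0"
  define C where "C = 1 + p * \<bar>\<tau>\<bar>"
  define a where "a = 2 / c * (C\<^sup>2 / c)"
  define b where "b = 2 / c * (p * (c / (4 * p)) powr (1 - p))"
  define A where "A = 2 * (4 + p * (4 + 2 * \<bar>\<sigma>\<bar> + 4 * \<bar>\<tau>\<bar>) + 2 * p)"
  have K: "energy_constant p \<sigma> \<tau> = 4 * a * exp (A * a) + (a * exp (A * a) * (A * (b + 1)) + b)"
    unfolding energy_constant_def Let_def c_def C_def a_def b_def A_def ..
  have c: "0 < c" using \<sigma> p by (auto simp: c_def max_def)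
  have ab: "0 \<le> a" "0 \<le> b" "0 \<le> A" using c p by (auto simp: a_def b_def A_def)
  have Y: "power_integral p k r \<le> a * weighted_integral p k r + b * \<Phi>" if "0 < r" "r < 1" for r
  proof -
    have "2 / c * (c / 2 * power_integral p k r)
        \<le> 2 / c * (C\<^sup>2 / c * weighted_integral p k r + p * (c / (4 * p)) powr (1 - p) * power_integral p f r)"
      using angular_estimate[OF \<sigma> that] c unfolding c_def C_def by (intro mult_left_mono) auto
    then have "power_integral p k r \<le> a * weighted_integral p k r + b * power_integral p f r"
      using c by (simp add: a_def b_def distrib_left mult.assoc)
    moreover have "b * power_integral p f r \<le> b * \<Phi>" using \<Phi>[OF that] ab by (intro mult_left_mono)
    ultimately show ?thesis by linarith
  qed
  have "\<forall>r. \<exists>D. 1/2 \<le> r \<and> r < 1 \<longrightarrow> (weighted_integral p k has_real_derivative D) (at r) \<and>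
      D \<le> (A * a) * weighted_integral p k r + A * (b + 1) * \<Phi>"
  proof
    fix r :: real
    show "\<exists>D. 1/2 \<le> r \<and> r < 1 \<longrightarrow> (weighted_integral p k has_real_derivative D) (at r) \<and>
      D \<le> (A * a) * weighted_integral p k r + A * (b + 1) * \<Phi>"
    proof (cases "1/2 \<le> r \<and> r < 1")
      case True
      then have r: "0 < r" "r < 1" by auto
      obtain D where deriv: "(weighted_integral p k has_real_derivative D) (at r)"
        and D': "r * D \<le> (4 + p * (4 + 2 * \<bar>\<sigma>\<bar> + 4 * \<bar>\<tau>\<bar>) + 2 * p) * (power_integral p k r + power_integral p f r)"
        by (rule radial_estimate[OF r])
      then have D: "r * D \<le> A / 2 * (power_integral p k r + power_integral p f r)"
      proof -
        have "A / 2 = 4 + p * (4 + 2 * \<bar>\<sigma>\<bar> + 4 * \<bar>\<tau>\<bar>) + 2 * p" by (simp add: A_def)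
        then show ?thesis by (simp only: D')
      qed
      have nn: "0 \<le> power_integral p k r + power_integral p f r"
        using power_integral_nonneg[OF k r] power_integral_nonneg[OF f r] by simp
      have "D \<le> A * (power_integral p k r + power_integral p f r)"
      proof (cases "0 \<le> D")
        case True
        have "1/2 * D \<le> r * D" using True \<open>1/2 \<le> r \<and> r < 1\<close> by (intro mult_right_mono) auto
        then show ?thesis using D by simp
      next
        case False
        then show ?thesis using mult_nonneg_nonneg[OF ab(3) nn] by linarith
      qed
      also have "\<dots> \<le> A * ((a * weighted_integral p k r + b * \<Phi>) + \<Phi>)"
        using Y[OF r] \<Phi>[OF r] ab by (intro mult_left_mono add_mono) auto
      finally show ?thesis using deriv by (intro exI[of _ D]) (simp add: algebra_simps)
    qed auto
  qed
  then obtain Z' where Z': "\<And>r. 1/2 \<le> r \<Longrightarrow> r < 1 \<Longrightarrow> (weighted_integral p k has_real_derivative Z' r) (at r)"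
    "\<And>r. 1/2 \<le> r \<Longrightarrow> r < 1 \<Longrightarrow> Z' r \<le> (A * a) * weighted_integral p k r + A * (b + 1) * \<Phi>"
    by metis
  have wk: "(\<lambda>t. (norm (1 - of_real r * cis t))\<^sup>2 * norm (k (of_real r * cis t)) powr p) integrable_on {0..2*pi}"
    if "0 < r" "r < 1" for r
    by (intro integrable_continuous_real continuous_intros power_continuous k that)
  have w0: "0 \<le> weighted_integral p k (1/2)"
    unfolding weighted_integral_def by (intro integral_nonneg wk) auto
  have w4: "weighted_integral p k (1/2) \<le> 4 * power_integral p k (1/2)"
  proof -
    have "weighted_integral p k (1/2) \<le> integral {0..2*pi} (\<lambda>t. 4 * norm (k (of_real (1/2) * cis t)) powr p)"
      unfolding weighted_integral_def
    proof (intro integral_le wk)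
      show "(\<lambda>t. 4 * norm (k (of_real (1/2) * cis t)) powr p) integrable_on {0..2*pi}"
        by (intro integrable_continuous_real continuous_intros power_continuous k) auto
      fix t :: real
      have "norm (1 - of_real (1/2) * cis t) \<le> 2"
        using norm_triangle_ineq4[of 1 "of_real (1/2) * cis t"] by (simp add: norm_mult)
      then have "(norm (1 - of_real (1/2) * cis t))\<^sup>2 \<le> 2\<^sup>2" by (intro power_mono) auto
      then show "(norm (1 - of_real (1/2) * cis t))\<^sup>2 * norm (k (of_real (1/2) * cis t)) powr p
          \<le> 4 * norm (k (of_real (1/2) * cis t)) powr p"
        by (intro mult_right_mono) auto
    qed auto
    then show ?thesis by (simp add: power_integral_def)
  qed
  have "weighted_integral p k r \<le> exp (A * a) * (weighted_integral p k (1/2) + A * (b + 1) * \<Phi>)"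
    by (rule Gronwall_linear[where Z' = Z' and a = "1/2"]) (use Z' r ab \<Phi>0 w0 in auto)
  also have "\<dots> \<le> exp (A * a) * (4 * power_integral p k (1/2) + A * (b + 1) * \<Phi>)"
    using w4 by (intro mult_left_mono) auto
  finally have "a * weighted_integral p k r \<le> a * (exp (A * a) * (4 * power_integral p k (1/2) + A * (b + 1) * \<Phi>))"
    using ab by (intro mult_left_mono)
  then have "power_integral p k r
      \<le> a * (exp (A * a) * (4 * power_integral p k (1/2) + A * (b + 1) * \<Phi>)) + b * \<Phi>"
    using Y[of r] r by linarith
  also have "\<dots> = 4 * a * exp (A * a) * power_integral p k (1/2) + (a * exp (A * a) * (A * (b + 1)) + b) * \<Phi>"
    by (simp add: algebra_simps)
  also have "\<dots> \<le> energy_constant p \<sigma> \<tau> * power_integral p k (1/2) + energy_constant p \<sigma> \<tau> * \<Phi>"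
    using ab \<Phi>0 power_integral_nonneg[OF k, of "1/2"]
    by (intro add_mono mult_right_mono) (auto simp: K)
  finally show ?thesis by (simp add: distrib_left)
qed

end

lemma energy_constant_nonneg:
  assumes "1 < p" "p * \<sigma> < 1"
  shows "0 \<le> energy_constant p \<sigma> \<tau>"
proof -
  have "0 < 1 - p * max \<sigma> 0" using assms by (auto simp: max_def)
  then show ?thesis using assms unfolding energy_constant_def Let_def by simp
qed

section \<open>The resolvent outside the spectral disc\<close>

lemma norm_powr_le:
  fixes w a :: complex
  shows "norm (w powr a) \<le> norm w powr Re a * exp (pi * \<bar>Im a\<bar>)"
proof (cases "w = 0")
  case False
  have "\<bar>Im a * Im (Ln w)\<bar> \<le> \<bar>Im a\<bar> * pi"
    unfolding abs_mult using mpi_less_Im_Ln[OF False] Im_Ln_le_pi[OF False] by (intro mult_left_mono) auto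
  then have "- (Im a * Im (Ln w)) \<le> pi * \<bar>Im a\<bar>" by (simp add: mult.commute)
  then show ?thesis using False
    by (simp add: powr_def exp_add[symmetric] algebra_simps)
qed simp

lemma norm_powr_imaginary_le: "norm ((w::complex) powr (\<i> * of_real \<tau>)) \<le> exp (pi * \<bar>\<tau>\<bar>)"
  using norm_powr_le[of w "\<i> * of_real \<tau>"] by (cases "w = 0") auto

text \<open>\<open>energy_estimate\<close> is applied to \<open>k = (1 - z)\<^sup>i\<^sup>\<tau> resolvent_kernel s f\<close>, where \<open>\<tau> = Im s\<close>. For
  \<open>|z| \<le> 1/2\<close> the solution is bounded directly by \<open>Euler_solution_bound\<close>.\<close>

lemma resolvent_kernel_bounded:
  fixes s :: complex
  assumes p: "1 < p" and s: "p * Re s < 1"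
  shows "\<exists>K\<ge>0. \<forall>f\<in>hardy_space p. resolvent_kernel s f \<in> hardy_space p \<and>
    hardy_norm p (resolvent_kernel s f) \<le> K * hardy_norm p f"
proof -
  define \<sigma> where "\<sigma> = Re s"
  define \<tau> where "\<tau> = Im s"
  have s_eq: "s = of_real \<sigma> + \<i> * of_real \<tau>" by (simp add: \<sigma>_def \<tau>_def complex_eq_iff)
  have s1: "Re s < 1"
  proof (cases "Re s \<le> 0")
    case False
    then have "1 * Re s < p * Re s" using p by (intro mult_strict_right_mono) auto
    then show ?thesis using s by simp
  qed simp
  define M where "M = exp (pi * \<bar>\<tau>\<bar>)"
  have M: "1 \<le> M" by (simp add: M_def)
  define B where "B = 2 powr \<bar>\<sigma>\<bar> * (3 * (4 powr \<bar>\<sigma> - 1\<bar> * M * 8) / (1 - \<sigma>))"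
  have B: "0 \<le> B" using s1 M by (simp add: B_def \<sigma>_def)
  define E where "E = energy_constant p \<sigma> \<tau>"
  have E0: "0 \<le> E" unfolding E_def \<sigma>_def by (rule energy_constant_nonneg[OF p s])
  define L where "L = (E * (B powr p + M powr p)) powr (1 / p)"
  have L: "0 \<le> L" by (simp add: L_def)
  have powr_between: "x powr q \<le> c powr \<bar>q\<bar>" if "1 / c \<le> x" "x \<le> c" "0 < c" for x c q :: real
  proof -
    have x: "0 < x" using that by (meson divide_pos_pos less_le_trans zero_less_one)
    have "ln x \<le> ln c" "- ln c \<le> ln x"
      using that x ln_mono[of "1 / c" x] by (simp_all add: ln_div)
    then have "\<bar>q\<bar> * \<bar>ln x\<bar> \<le> \<bar>q\<bar> * ln c" by (intro mult_left_mono) auto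
    then have "q * ln x \<le> \<bar>q\<bar> * ln c"
      using abs_ge_self[of "q * ln x"] by (simp add: abs_mult)
    then show ?thesis using x that by (simp add: powr_def)
  qed
  have main: "resolvent_kernel s f \<in> hardy_space p \<and>
      hardy_norm p (resolvent_kernel s f) \<le> (M * (L + B)) * hardy_norm p f" if f: "f \<in> hardy_space p" for f
  proof -
    define n where "n = hardy_norm p f"
    have n: "0 \<le> n" using hardy_norm_nonneg[OF p f] by (simp add: n_def)
    note fh = hardy_spaceD(1)[OF p f]
    define P where "P = Euler_solution s (\<lambda>w. (1 - w) powr (s - 1) * f w)"
    define k where "k z = (1 - z) powr (- of_real \<sigma>) * P z" for z
    define g where "g z = (1 - z) powr (\<i> * of_real \<tau>) * f z" for z
    have diff: "s - of_real \<sigma> = \<i> * of_real \<tau>" by (simp add: s_eq)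
    have k: "k holomorphic_on ball 0 1"
      using weighted_Euler_solution_ode(1)[OF s1 fh, of 0 "of_real \<sigma>"] by (simp add: k_def[abs_def] P_def)
    have ode: "z * deriv k z = - k z + (of_real \<sigma> / (1 - z) + \<i> * of_real \<tau>) * k z + g z / (1 - z)" if "norm z < 1" for z
      using weighted_Euler_solution_ode(2)[OF s1 fh that, of "of_real \<sigma>"]
      unfolding diff by (simp add: k_def[abs_def] P_def g_def)
    have g: "g holomorphic_on ball 0 1"
      unfolding g_def by (intro holomorphic_intros holomorphic_one_minus_powr fh)
    have rk: "resolvent_kernel s f z = (1 - z) powr (\<i> * of_real (- \<tau>)) * k z" if "norm z < 1" for z
    proof -
      have "1 - z \<noteq> 0" using that by auto
      moreover have "- s = \<i> * of_real (- \<tau>) + - of_real \<sigma>" by (simp add: s_eq)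
      ultimately have "(1 - z) powr (- s) = (1 - z) powr (\<i> * of_real (- \<tau>)) * (1 - z) powr (- of_real \<sigma>)"
        by (simp only: powr_add[symmetric])
      then show ?thesis using that by (simp add: resolvent_kernel_def k_def P_def)
    qed
    have kB: "norm (k z) \<le> B * n" if z: "norm z \<le> 1/2" for z
    proof -
      have "norm (P z) \<le> 3 * (4 powr \<bar>\<sigma> - 1\<bar> * M * 8 * n) / (1 - Re s)"
        unfolding P_def
      proof (rule Euler_solution_bound[OF s1 _ _ z])
        show "(\<lambda>w. (1 - w) powr (s - 1) * f w) holomorphic_on ball 0 1"
          by (intro holomorphic_intros holomorphic_one_minus_powr fh)
        fix w :: complex assume w: "norm w = 3/4"
        have "norm (1 - w) powr (\<sigma> - 1) \<le> 4 powr \<bar>\<sigma> - 1\<bar>"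
          using norm_triangle_ineq2[of 1 w] norm_triangle_ineq4[of 1 w] w by (intro powr_between) auto
        then have wM: "norm (1 - w) powr (\<sigma> - 1) * M \<le> 4 powr \<bar>\<sigma> - 1\<bar> * M" using M by (intro mult_right_mono) auto
        have "norm ((1 - w) powr (s - 1)) \<le> 4 powr \<bar>\<sigma> - 1\<bar> * M"
        proof -
          have "norm ((1 - w) powr (s - 1)) \<le> norm (1 - w) powr (\<sigma> - 1) * M"
            using norm_powr_le[of "1 - w" "s - 1"] by (simp add: \<sigma>_def \<tau>_def M_def)
          then show ?thesis using wM by (rule order_trans)
        qed
        moreover have "norm (f w) \<le> 8 * n"
          using hardy_point_bound[OF p f, of w] w by (simp add: n_def)
        ultimately show "norm ((1 - w) powr (s - 1) * f w) \<le> 4 powr \<bar>\<sigma> - 1\<bar> * M * 8 * n"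
          unfolding norm_mult mult.assoc[of _ 8] using M by (intro mult_mono) auto
      qed
      moreover have "norm ((1 - z) powr (- of_real \<sigma>)) \<le> 2 powr \<bar>\<sigma>\<bar>"
      proof -
        have "norm (1 - z) powr (- \<sigma>) \<le> 2 powr \<bar>- \<sigma>\<bar>"
          using norm_triangle_ineq2[of 1 z] norm_triangle_ineq4[of 1 z] z by (intro powr_between) auto
        then show ?thesis using norm_powr_le[of "1 - z" "- of_real \<sigma>"] by simp
      qed
      ultimately have "norm (k z) \<le> 2 powr \<bar>\<sigma>\<bar> * (3 * (4 powr \<bar>\<sigma> - 1\<bar> * M * 8 * n) / (1 - Re s))"
        unfolding k_def norm_mult by (intro mult_mono) auto
      then show ?thesis by (simp add: B_def \<sigma>_def mult_ac)
    qed
    have mean_le: "integral_mean p r (resolvent_kernel s f) \<le> M * integral_mean p r k" if r: "0 \<le> r" "r < 1" for r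
      unfolding integral_mean_eq
    proof (rule circle_mean_mono[OF p])
      show "continuous_on {0..2*pi} (\<lambda>t. resolvent_kernel s f (of_real r * cis t))"
        by (intro continuous_on_circle resolvent_kernel_holomorphic s1 fh r)
      show "continuous_on {0..2*pi} (\<lambda>t. k (of_real r * cis t))" by (intro continuous_on_circle k r)
      show "norm (resolvent_kernel s f (of_real r * cis t)) \<le> M * norm (k (of_real r * cis t))" for t
      proof -
        have "norm (of_real r * cis t) < 1" using r by (simp add: norm_mult)
        then show ?thesis using norm_powr_imaginary_le[of "1 - of_real r * cis t" "- \<tau>"]
          by (simp add: rk norm_mult M_def mult_right_mono)
      qed
    qed (use M in auto)
    have half: "integral_mean p r k \<le> B * n" if r: "0 \<le> r" "r \<le> 1/2" for r
      unfolding integral_mean_eq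
      by (rule circle_mean_le_sup[OF p continuous_on_circle[OF k]])
         (use r B n in \<open>auto intro!: kB simp: norm_mult\<close>)
    have power_eq: "power_integral p h r = 2 * pi * integral_mean p r h powr p" for h r
      by (simp add: power_integral_def integral_mean_eq integral_powr_eq[OF p])
    have outer: "integral_mean p r k \<le> L * n" if r: "1/2 \<le> r" "r < 1" for r
    proof -
      have "power_integral p k r \<le> E * (power_integral p k (1/2) + 2 * pi * (M * n) powr p)"
        unfolding E_def
      proof (rule energy_estimate[OF p k g ode _ _ _ r])
        show "p * \<sigma> < 1" using s by (simp add: \<sigma>_def)
        fix r :: real assume r: "0 < r" "r < 1"
        have "integral_mean p r g \<le> M * integral_mean p r f"
          unfolding integral_mean_eq
        proof (rule circle_mean_mono[OF p])
          show "norm (g (of_real r * cis t)) \<le> M * norm (f (of_real r * cis t))" for t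
            using norm_powr_imaginary_le[of "1 - of_real r * cis t" \<tau>]
            by (simp add: g_def norm_mult M_def mult_right_mono)
        qed (use M r in \<open>auto intro!: continuous_on_circle g fh\<close>)
        also have "\<dots> \<le> M * n"
          using hardy_spaceD(3)[OF p f] r M by (intro mult_left_mono) (auto simp: n_def)
        finally show "power_integral p g r \<le> 2 * pi * (M * n) powr p"
          unfolding power_eq using p integral_mean_nonneg[OF p] by (intro mult_left_mono powr_mono2) auto
      qed auto
      also have "\<dots> \<le> E * (2 * pi * (B * n) powr p + 2 * pi * (M * n) powr p)"
        unfolding power_eq using E0 p integral_mean_nonneg[OF p] half[of "1/2"]
        by (intro mult_left_mono add_right_mono powr_mono2) auto
      also have "\<dots> = 2 * pi * (E * (B powr p + M powr p) * n powr p)"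
        using B M n by (simp add: powr_mult algebra_simps)
      also have "E * (B powr p + M powr p) * n powr p = (L * n) powr p"
        using E0 p n by (simp add: L_def powr_mult powr_powr)
      finally have "power_integral p k r \<le> 2 * pi * (L * n) powr p" .
      then show ?thesis
        unfolding integral_mean_eq power_integral_def by (intro circle_mean_leI[OF p] mult_nonneg_nonneg L n)
    qed
    have k_mean: "integral_mean p r k \<le> (L + B) * n" if r: "0 \<le> r" "r < 1" for r
    proof (cases "r \<le> 1/2")
      case True
      then show ?thesis using half[of r] r L n by (simp add: distrib_right add_increasing)
    next
      case False
      then show ?thesis using outer[of r] r B n by (simp add: distrib_right add_increasing2)
    qed
    have "integral_mean p r (resolvent_kernel s f) \<le> (M * (L + B)) * n" if r: "0 \<le> r" "r < 1" for r
    proof -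
      have "M * integral_mean p r k \<le> M * ((L + B) * n)" using k_mean[OF r] M by (intro mult_left_mono) auto
      then show ?thesis using mean_le[OF r] by (simp only: mult.assoc)
    qed
    then show ?thesis
      using hardy_spaceI[OF p resolvent_kernel_holomorphic[OF s1 fh], of "(M * (L + B)) * n"]
      by (auto simp: n_def resolvent_kernel_def)
  qed
  show ?thesis
    by (rule exI[of _ "M * (L + B)"]) (use main M L B in auto)
qed

lemma cesaro_eq_resolvent_kernel_0:
  assumes "f holomorphic_on ball 0 1"
  shows "cesaro f = resolvent_kernel 0 f"
  using resolvent_kernel_eq[OF _ assms, of 0] by simp

lemma cesaro_bounded:
  assumes p: "1 < p"
  shows "\<exists>K\<ge>0. \<forall>f\<in>hardy_space p. cesaro f \<in> hardy_space p \<and> hardy_norm p (cesaro f) \<le> K * hardy_norm p f"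
proof -
  have "cesaro f = resolvent_kernel 0 f" if "f \<in> hardy_space p" for f
    using cesaro_eq_resolvent_kernel_0[OF hardy_spaceD(1)[OF p that]] .
  then show ?thesis using resolvent_kernel_bounded[OF p, of 0] by simp
qed

lemma cesaro_function_operator:
  assumes p: "1 < p"
  shows "function_operator (hardy_space p) (hardy_norm p) cesaro"
proof -
  interpret function_banach "hardy_space p" "hardy_norm p" by (rule hardy_function_banach[OF p])
  show ?thesis
  proof
    show "cesaro f \<in> hardy_space p" if "f \<in> hardy_space p" for f
      using cesaro_bounded[OF p] that by blast
    show "cesaro (f + g) = cesaro f + cesaro g" if "f \<in> hardy_space p" "g \<in> hardy_space p" for f g
      using cesaro_linear[OF hardy_spaceD(1)[OF p that(1)] hardy_spaceD(1)[OF p that(2)], of 1 1]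
      by (simp add: plus_fun_def)
    show "cesaro (cscale c f) = cscale c (cesaro f)" if "f \<in> hardy_space p" for f c
      using cesaro_linear[OF hardy_spaceD(1)[OF p that] hardy_spaceD(1)[OF p that], of c 0]
      by (simp add: cscale_def)
  qed
qed

lemma cesaro_regular_outside_disc:
  assumes p: "1 < p" and \<mu>: "\<mu> \<noteq> 0" "p * Re (1 / \<mu>) < 1"
  shows "\<exists>K. function_operator.regular_point (hardy_space p) (hardy_norm p) cesaro \<mu> K"
proof -
  interpret function_operator "hardy_space p" "hardy_norm p" cesaro
    by (rule cesaro_function_operator[OF p])
  define s where "s = 1 / \<mu>"
  have s: "s \<noteq> 0" "p * Re s < 1" "\<mu> = 1 / s" using \<mu> by (auto simp: s_def)
  have s1: "Re s < 1"
  proof (cases "Re s \<le> 0")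
    case False
    then have "1 * Re s < p * Re s" using p by (intro mult_strict_right_mono) auto
    then show ?thesis using s by simp
  qed simp
  obtain K where K: "0 \<le> K" "\<And>f. f \<in> hardy_space p \<Longrightarrow> resolvent_kernel s f \<in> hardy_space p"
    "\<And>f. f \<in> hardy_space p \<Longrightarrow> hardy_norm p (resolvent_kernel s f) \<le> K * hardy_norm p f"
    using resolvent_kernel_bounded[OF p s(2)] by blast
  define R where "R f = cscale (- s) f + cscale (- s\<^sup>2) (resolvent_kernel s f)" for f
  have R_mem: "R f \<in> hardy_space p" if "f \<in> hardy_space p" for f
    unfolding R_def by (intro add_mem scale_mem K that)
  have R_norm: "hardy_norm p (R f) \<le> (norm s + norm s ^ 2 * K) * hardy_norm p f" if f: "f \<in> hardy_space p" for f
  proof -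
    have "hardy_norm p (R f) \<le> norm s * hardy_norm p f + norm s ^ 2 * hardy_norm p (resolvent_kernel s f)"
      unfolding R_def using norm_add[OF scale_mem[OF f] scale_mem[OF K(2)[OF f]], of "- s" "- s\<^sup>2"]
      by (simp add: norm_scale f K norm_power)
    also have "\<dots> \<le> norm s * hardy_norm p f + norm s ^ 2 * (K * hardy_norm p f)"
      using K(3)[OF f] by (intro add_left_mono mult_left_mono) auto
    finally show ?thesis by (simp add: algebra_simps)
  qed
  have R_sol: "cesaro (R f) - cscale \<mu> (R f) = f" if f: "f \<in> hardy_space p" for f
  proof
    fix z
    have "R f = (\<lambda>z. - s * f z + - s\<^sup>2 * resolvent_kernel s f z)" by (simp add: R_def fun_eq_iff)
    then show "(cesaro (R f) - cscale \<mu> (R f)) z = f z"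
      using resolvent_solution[OF s1 s(1) hardy_spaceD(1)[OF p f], of z] by (simp add: s(3))
  qed
  have unique: "g = R (cesaro g - cscale \<mu> g)" if g: "g \<in> hardy_space p" for g
  proof -
    let ?f = "cesaro g - cscale \<mu> g"
    let ?d = "g - R ?f"
    have f: "?f \<in> hardy_space p" by (rule shift_mem[OF g])
    have d: "?d \<in> hardy_space p" by (intro diff_mem g R_mem f)
    have "cesaro ?d - cscale \<mu> ?d = 0"
      using shift_diff[OF g R_mem[OF f], of \<mu>] R_sol[OF f] by simp
    then have "cesaro ?d z = 1 / s * ?d z" for z
      by (simp add: fun_eq_iff s(3))
    then have "?d = 0"
      using cesaro_eigenfunction_trivial[OF s1 s(1) hardy_spaceD(1)[OF p d]] hardy_spaceD(2)[OF p d] by blast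
    then show ?thesis by simp
  qed
  have "regular_point \<mu> (norm s + norm s ^ 2 * K)"
    unfolding regular_point_def
  proof (intro conjI ballI)
    show "\<exists>g\<in>hardy_space p. cesaro g - cscale \<mu> g = f" if "f \<in> hardy_space p" for f
      using R_mem R_sol that by blast
    show "hardy_norm p g \<le> (norm s + norm s ^ 2 * K) * hardy_norm p (cesaro g - cscale \<mu> g)"
      if g: "g \<in> hardy_space p" for g
      using R_norm[OF shift_mem[OF g, of \<mu>]] unique[OF g] by metis
  qed (use K in auto)
  then show ?thesis by blast
qed

section \<open>Eigenvectors of the adjoint inside the spectral disc\<close>

lemma Jordan_inequality:
  fixes x :: real
  assumes "0 \<le> x" "x \<le> pi / 2"
  shows "2 / pi * x \<le> sin x"
proof -
  have "concave_on {0..pi/2} sin"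
    by (rule f''_le0_imp_concave[where f' = cos and f'' = "\<lambda>x. - sin x"])
       (auto intro!: derivative_eq_intros sin_ge_zero)
  then have "sin ((1 - 2 / pi * x) *\<^sub>R 0 + (2 / pi * x) *\<^sub>R (pi / 2)) \<ge> (1 - 2 / pi * x) * sin 0 + 2 / pi * x * sin (pi / 2)"
    using assms by (intro concave_onD[of "{0..pi/2}"]) (auto simp: field_simps)
  then show ?thesis by simp
qed

lemma norm_one_minus_polar: "(norm (1 - of_real r * cis t))\<^sup>2 = (1 - r)\<^sup>2 + 4 * r * (sin (t / 2))\<^sup>2"
proof -
  have c: "cos t = 1 - 2 * (sin (t / 2))\<^sup>2" using cos_double_sin[of "t / 2"] by simp
  have "(norm (1 - of_real r * cis t))\<^sup>2 = (1 - r * cos t)\<^sup>2 + (r * sin t)\<^sup>2"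
    by (simp add: cmod_power2)
  also have "\<dots> = 1 - 2 * r * cos t + r\<^sup>2 * ((sin t)\<^sup>2 + (cos t)\<^sup>2)"
    by algebra
  also have "\<dots> = (1 - r)\<^sup>2 + 4 * r * (sin (t / 2))\<^sup>2"
    unfolding sin_cos_squared_add unfolding c by (simp add: power2_eq_square algebra_simps)
  finally show ?thesis .
qed

lemma norm_one_minus_polar_ge:
  assumes r: "1/2 \<le> r" "r < 1" and t: "0 \<le> t" "t \<le> pi"
  shows "((1 - r) + t) / pi \<le> norm (1 - of_real r * cis t)"
proof (rule power2_le_imp_le)
  have "t / pi \<le> sin (t / 2)" using Jordan_inequality[of "t / 2"] t by simp
  then have "(t / pi)\<^sup>2 \<le> (sin (t / 2))\<^sup>2" using t by (intro power_mono) auto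
  then have "2 * (t / pi)\<^sup>2 \<le> 4 * r * (sin (t / 2))\<^sup>2" using r by (intro mult_mono) auto
  moreover have "2 * ((1 - r) / pi)\<^sup>2 \<le> (1 - r)\<^sup>2"
  proof -
    have "2 / pi\<^sup>2 \<le> 1" using pi_ge_two power_mono[of 2 pi 2] by simp
    then have "2 / pi\<^sup>2 * (1 - r)\<^sup>2 \<le> 1 * (1 - r)\<^sup>2" by (intro mult_right_mono) auto
    then show ?thesis by (simp add: power_divide)
  qed
  moreover have "(((1 - r) + t) / pi)\<^sup>2 \<le> 2 * ((1 - r) / pi)\<^sup>2 + 2 * (t / pi)\<^sup>2"
  proof -
    have "(x + y)\<^sup>2 \<le> 2 * x\<^sup>2 + 2 * y\<^sup>2" for x y :: real
      using zero_le_power2[of "x - y"] by (simp add: power2_eq_square algebra_simps)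
    then show ?thesis unfolding add_divide_distrib .
  qed
  ultimately show "(((1 - r) + t) / pi)\<^sup>2 \<le> (norm (1 - of_real r * cis t))\<^sup>2"
    unfolding norm_one_minus_polar by linarith
qed simp

lemma integral_shifted_powr_le:
  fixes q \<delta> L :: real
  assumes q: "1 < q" and \<delta>: "0 < \<delta>" and L: "0 \<le> L"
  shows "((\<lambda>t. (\<delta> + t) powr (- q)) has_integral ((\<delta> powr (1 - q) - (\<delta> + L) powr (1 - q)) / (q - 1))) {0..L}"
    "((\<lambda>t. (\<delta> + (L - t)) powr (- q)) has_integral ((\<delta> powr (1 - q) - (\<delta> + L) powr (1 - q)) / (q - 1))) {0..L}"
proof -
  have "((\<lambda>t. (\<delta> + t) powr (- q)) has_integral ((\<delta> + L) powr (1 - q) / (1 - q) - (\<delta> + 0) powr (1 - q) / (1 - q))) {0..L}"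
    by (intro fundamental_theorem_of_calculus)
       (use q \<delta> L in \<open>auto intro!: derivative_eq_intros simp: has_real_derivative_iff_has_vector_derivative[symmetric]\<close>)
  moreover have "(\<delta> + L) powr (1 - q) / (1 - q) - (\<delta> + 0) powr (1 - q) / (1 - q) = (\<delta> powr (1 - q) - (\<delta> + L) powr (1 - q)) / (q - 1)"
    using q by (simp add: divide_simps) (simp add: algebra_simps)
  ultimately show "((\<lambda>t. (\<delta> + t) powr (- q)) has_integral ((\<delta> powr (1 - q) - (\<delta> + L) powr (1 - q)) / (q - 1))) {0..L}"
    by simp
  have "((\<lambda>t. (\<delta> + (L - t)) powr (- q)) has_integral
      (- ((\<delta> + (L - L)) powr (1 - q) / (1 - q)) - - ((\<delta> + (L - 0)) powr (1 - q) / (1 - q)))) {0..L}"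
    by (intro fundamental_theorem_of_calculus)
       (use q \<delta> L in \<open>auto intro!: derivative_eq_intros simp: has_real_derivative_iff_has_vector_derivative[symmetric]\<close>)
  moreover have "- ((\<delta> + (L - L)) powr (1 - q) / (1 - q)) - - ((\<delta> + (L - 0)) powr (1 - q) / (1 - q)) = (\<delta> powr (1 - q) - (\<delta> + L) powr (1 - q)) / (q - 1)"
    using q by (simp add: divide_simps) (simp add: algebra_simps)
  ultimately show "((\<lambda>t. (\<delta> + (L - t)) powr (- q)) has_integral ((\<delta> powr (1 - q) - (\<delta> + L) powr (1 - q)) / (q - 1))) {0..L}"
    by simp
qed

text \<open>On the circle of radius \<open>r\<close> the distance to \<open>1\<close> is comparable to \<open>1 - r\<close> plus the angular distance,
  measured from \<open>0\<close> on the first half of the interval and from \<open>2 \<pi>\<close> on the second.\<close>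

lemma integral_one_minus_powr_le:
  assumes q: "1 < q" and r: "1/2 \<le> r" "r < 1"
  shows "integral {0..2*pi} (\<lambda>t. norm (1 - of_real r * cis t) powr (- q)) \<le> 2 * pi powr q / (q - 1) * (1 - r) powr (1 - q)"
proof -
  define \<delta> where "\<delta> = 1 - r"
  have \<delta>: "0 < \<delta>" using r by (simp add: \<delta>_def)
  have nz: "1 - of_real r * cis t \<noteq> 0" for t
  proof
    assume "1 - of_real r * cis t = 0"
    then have "norm (of_real r * cis t) = 1" by simp
    then show False using r by (simp add: norm_mult)
  qed
  let ?g = "\<lambda>t. pi powr q * ((\<delta> + t) powr (- q) + (\<delta> + (2 * pi - t)) powr (- q))"
  define I where "I = (\<delta> powr (1 - q) - (\<delta> + 2 * pi) powr (1 - q)) / (q - 1)"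
  have g: "(?g has_integral pi powr q * (I + I)) {0..2*pi}"
    unfolding I_def by (intro has_integral_mult_right has_integral_add integral_shifted_powr_le q \<delta>) auto
  have ge: "(\<delta> + t) / pi \<le> norm (1 - of_real r * cis t) \<or> (\<delta> + (2 * pi - t)) / pi \<le> norm (1 - of_real r * cis t)"
    if t: "t \<in> {0..2*pi}" for t
  proof (cases "t \<le> pi")
    case True
    then show ?thesis using norm_one_minus_polar_ge[OF r, of t] t by (simp add: \<delta>_def)
  next
    case False
    have "(norm (1 - of_real r * cis (2 * pi - t)))\<^sup>2 = (norm (1 - of_real r * cis t))\<^sup>2"
      unfolding norm_one_minus_polar by (simp add: diff_divide_distrib)
    then have "norm (1 - of_real r * cis (2 * pi - t)) = norm (1 - of_real r * cis t)" by simp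
    then show ?thesis using norm_one_minus_polar_ge[OF r, of "2 * pi - t"] t False by (simp add: \<delta>_def)
  qed
  have "integral {0..2*pi} (\<lambda>t. norm (1 - of_real r * cis t) powr (- q)) \<le> integral {0..2*pi} ?g"
  proof (rule integral_le)
    show "(\<lambda>t. norm (1 - of_real r * cis t) powr (- q)) integrable_on {0..2*pi}"
      by (intro integrable_continuous_real continuous_intros) (use nz in auto)
    show "?g integrable_on {0..2*pi}" using g by (rule has_integral_integrable)
    fix t assume t: "t \<in> {0..2*pi}"
    have *: "norm (1 - of_real r * cis t) powr (- q) \<le> pi powr q * x powr (- q)"
      if "0 < x" "x / pi \<le> norm (1 - of_real r * cis t)" for x
    proof -
      have "norm (1 - of_real r * cis t) powr (- q) \<le> (x / pi) powr (- q)"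
        using that q by (intro powr_mono2') auto
      also have "\<dots> = pi powr q * x powr (- q)" using that by (simp add: powr_divide powr_minus field_simps)
      finally show ?thesis .
    qed
    have pos: "0 < \<delta> + t" "0 < \<delta> + (2 * pi - t)" using \<delta> t by auto
    show "norm (1 - of_real r * cis t) powr (- q) \<le> ?g t"
      using ge[OF t]
    proof
      assume "(\<delta> + t) / pi \<le> norm (1 - of_real r * cis t)"
      from *[OF pos(1) this] show ?thesis by (simp add: distrib_left add_increasing2)
    next
      assume "(\<delta> + (2 * pi - t)) / pi \<le> norm (1 - of_real r * cis t)"
      from *[OF pos(2) this] show ?thesis by (simp add: distrib_left add_increasing)
    qed
  qed
  also have "\<dots> = pi powr q * (I + I)" using g by (rule integral_unique)
  also have "\<dots> \<le> pi powr q * (\<delta> powr (1 - q) / (q - 1) + \<delta> powr (1 - q) / (q - 1))"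
    using q by (intro mult_left_mono add_mono) (auto simp: I_def intro!: divide_right_mono)
  finally show ?thesis by (simp add: \<delta>_def mult_ac)
qed

text \<open>The partial sums are the Taylor coefficients of \<open>f / (1 - z)\<close>. They are estimated by the Cauchy integral
  on the circle of radius \<open>1 - 1/(n+2)\<close>, where Hoelder's inequality brings in the mean of
  \<open>|1 - z|\<^sup>-\<^sup>q\<close> with the conjugate exponent \<open>q\<close>; it contributes the factor \<open>n\<^sup>1\<^sup>/\<^sup>p\<close>.\<close>

lemma partial_sum_growth:
  assumes p: "1 < p"
  shows "\<exists>K\<ge>0. \<forall>f\<in>hardy_space p. \<forall>n.
    norm (\<Sum>k\<le>n. taylor_coeff f k) \<le> K * hardy_norm p f * real (n + 1) powr (1 / p)"
proof -
  define q where "q = p / (p - 1)"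
  have q: "1 < q" "p * (- 1 / (p - 1)) = - q" "(1 - q) * ((p - 1) / p) = - (1 / p)"
    using p by (auto simp: q_def field_simps)
  define A where "A = (pi powr q / (pi * (q - 1))) powr ((p - 1) / p)"
  have A: "0 \<le> A" by (simp add: A_def)
  have "norm (\<Sum>k\<le>n. taylor_coeff f k) \<le> (exp 1 * A * 2) * hardy_norm p f * real (n + 1) powr (1 / p)"
    if f: "f \<in> hardy_space p" for f n
  proof -
    note fh = hardy_spaceD(1)[OF p f]
    \<comment> \<open>\<open>n + 2\<close> instead of \<open>n + 1\<close> ensures \<open>r \<ge> 1/2\<close> also for \<open>n = 0\<close>.\<close>
    define r where "r = 1 - 1 / (real n + 2)"
    have r: "1/2 \<le> r" "r < 1" "0 < r" by (auto simp: r_def field_simps)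
    have nz: "1 - of_real r * cis t \<noteq> 0" for t
    proof
      assume "1 - of_real r * cis t = 0"
      then have "norm (of_real r * cis t) = 1" by simp
      then show False using r by (simp add: norm_mult)
    qed
    \<comment> \<open>Chosen so that \<open>|v|\<^sup>p\<^sup>-\<^sup>1 = 1 / |1 - z|\<close> in Hoelder's inequality.\<close>
    define v where "v t = complex_of_real (norm (1 - of_real r * cis t) powr (- 1 / (p - 1)))" for t
    have v: "continuous_on {0..2*pi} v"
      unfolding v_def by (intro continuous_intros) (use nz in auto)
    have vp: "norm (v t) powr (p - 1) = 1 / norm (1 - of_real r * cis t)" for t
    proof -
      have "norm (v t) = norm (1 - of_real r * cis t) powr (- 1 / (p - 1))"
        unfolding v_def norm_of_real by (rule abs_of_nonneg) simp
      moreover have "- 1 / (p - 1) * (p - 1) = - 1" using p by simp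
      ultimately show ?thesis by (simp only: powr_powr) (simp add: powr_minus_divide)
    qed
    have mean_v: "circle_mean p v powr (p - 1) \<le> A * (1 - r) powr (- (1 / p))"
    proof -
      have "circle_mean p v powr (p - 1)
          = (1 / (2 * pi) * integral {0..2*pi} (\<lambda>t. norm (1 - of_real r * cis t) powr (- q))) powr ((p - 1) / p)"
        using q(2) by (simp add: circle_mean_def v_def powr_powr mult.commute)
      also have "\<dots> \<le> (1 / (2 * pi) * (2 * pi powr q / (q - 1) * (1 - r) powr (1 - q))) powr ((p - 1) / p)"
      proof (rule powr_mono2)
        show "1 / (2 * pi) * integral {0..2*pi} (\<lambda>t. norm (1 - of_real r * cis t) powr (- q))
            \<le> 1 / (2 * pi) * (2 * pi powr q / (q - 1) * (1 - r) powr (1 - q))"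
          using integral_one_minus_powr_le[OF q(1) r(1,2)] by (intro mult_left_mono) auto
        have "0 \<le> integral {0..2*pi} (\<lambda>t. norm (1 - of_real r * cis t) powr (- q))"
          by (intro integral_nonneg integrable_continuous_real continuous_intros) (use nz in auto)
        then show "0 \<le> 1 / (2 * pi) * integral {0..2*pi} (\<lambda>t. norm (1 - of_real r * cis t) powr (- q))" by simp
      qed (use p in auto)
      also have "1 / (2 * pi) * (2 * pi powr q / (q - 1) * (1 - r) powr (1 - q))
          = (pi powr q / (pi * (q - 1))) * (1 - r) powr (1 - q)" by simp
      also have "\<dots> powr ((p - 1) / p) = A * (1 - r) powr ((1 - q) * ((p - 1) / p))"
        using q(1) by (simp only: A_def powr_powr[symmetric]) (rule powr_mult)
      finally show ?thesis by (simp only: q(3))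
    qed
    have "norm (\<Sum>k\<le>n. taylor_coeff f k) * r ^ n
        \<le> integral {0..2*pi} (\<lambda>t. norm (f (of_real r * cis t) / (1 - of_real r * cis t))) / (2 * pi)"
      unfolding sum_taylor_coeff[OF fh] by (rule taylor_coeff_bound[OF holomorphic_div_1_minus[OF fh] r(3,2)])
    also have "\<dots> \<le> 2 * pi * (integral_mean p r f * circle_mean p v powr (p - 1)) / (2 * pi)"
      using circle_mean_Holder[OF p continuous_on_circle[OF fh] v, of r] r
      by (intro divide_right_mono) (simp_all add: vp norm_divide integral_mean_eq)
    also have "\<dots> = integral_mean p r f * circle_mean p v powr (p - 1)" by simp
    also have "\<dots> \<le> hardy_norm p f * (A * (1 - r) powr (- (1 / p)))"
      using hardy_spaceD(3)[OF p f, of r] r mean_v hardy_norm_nonneg[OF p f] integral_mean_nonneg[OF p]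
      by (intro mult_mono) auto
    finally have main: "norm (\<Sum>k\<le>n. taylor_coeff f k) * r ^ n \<le> hardy_norm p f * (A * (1 - r) powr (- (1 / p)))" .
    have rn: "1 \<le> exp 1 * r ^ n"
    proof -
      have "1 / r = 1 + 1 / (real n + 1)" by (simp add: r_def field_simps)
      also have "\<dots> \<le> exp (1 / (real n + 1))" by (rule exp_ge_add_one_self)
      finally have "(1 / r) ^ n \<le> exp (1 / (real n + 1)) ^ n" using r by (intro power_mono) auto
      also have "\<dots> = exp (real n / (real n + 1))" by (simp flip: exp_of_nat_mult)
      also have "\<dots> \<le> exp 1" by simp
      finally show ?thesis using r by (simp add: field_simps)
    qed
    have pw: "(1 - r) powr (- (1 / p)) \<le> 2 * real (n + 1) powr (1 / p)"
    proof -
      have "(1 - r) powr (- (1 / p)) = (real n + 2) powr (1 / p)"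
        by (simp add: r_def powr_minus_divide powr_divide)
      also have "\<dots> \<le> (2 * real (n + 1)) powr (1 / p)" using p by (intro powr_mono2) auto
      also have "\<dots> = 2 powr (1 / p) * real (n + 1) powr (1 / p)" by (rule powr_mult)
      also have "\<dots> \<le> 2 powr 1 * real (n + 1) powr (1 / p)" using p by (intro mult_right_mono powr_mono) auto
      finally show ?thesis by simp
    qed
    have "norm (\<Sum>k\<le>n. taylor_coeff f k) \<le> norm (\<Sum>k\<le>n. taylor_coeff f k) * (exp 1 * r ^ n)"
      using mult_left_mono[OF rn norm_ge_zero[of "\<Sum>k\<le>n. taylor_coeff f k"]] by simp
    also have "\<dots> = exp 1 * (norm (\<Sum>k\<le>n. taylor_coeff f k) * r ^ n)" by simp
    also have "\<dots> \<le> exp 1 * (hardy_norm p f * (A * (2 * real (n + 1) powr (1 / p))))"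
      using order_trans[OF main mult_left_mono[OF mult_left_mono[OF pw A] hardy_norm_nonneg[OF p f]]]
      by (intro mult_left_mono) auto
    finally show ?thesis by (simp add: mult_ac)
  qed
  then show ?thesis using A by (intro exI[of _ "exp 1 * A * 2"]) auto
qed

text \<open>The Taylor coefficients of \<open>(1 - z)\<^sup>s\<^sup>-\<^sup>1\<close>, the eigenvector to the eigenvalue \<open>1/s\<close> of the adjoint of
  the Cesaro operator.\<close>

definition adjoint_coeff :: "complex \<Rightarrow> nat \<Rightarrow> complex"
  where "adjoint_coeff s n = (\<Prod>k=1..n. 1 - s / of_nat k)"

lemma adjoint_coeff_Suc: "adjoint_coeff s (Suc n) = adjoint_coeff s n * (1 - s / of_nat (Suc n))"
  by (simp add: adjoint_coeff_def)

lemma adjoint_coeff_0 [simp]: "adjoint_coeff s 0 = 1"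
  by (simp add: adjoint_coeff_def)

lemma sum_inverse_squares_le: "(\<Sum>k=1..n. 1 / (real k)\<^sup>2) \<le> 2"
proof -
  have le: "(\<Sum>k=1..Suc n. 1 / (real k)\<^sup>2) \<le> 2 - 1 / real (Suc n)" for n
  proof (induction n)
    case (Suc n)
    have "1 / (real (Suc (Suc n)))\<^sup>2 \<le> 1 / (real (Suc n) * real (Suc (Suc n)))"
      by (intro divide_left_mono) (auto simp: power2_eq_square)
    also have "\<dots> = 1 / real (Suc n) - 1 / real (Suc (Suc n))" by (simp add: field_simps)
    finally show ?case using Suc by simp
  qed simp
  show ?thesis
  proof (cases n)
    case (Suc m)
    then show ?thesis using order_trans[OF le[of m], of 2] by simp
  qed simp
qed

text \<open>\<open>|1 - s/k|\<^sup>2 = 1 - 2 Re s / k + |s|\<^sup>2 / k\<^sup>2\<close> is estimated by the exponential function; the sum of the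
  terms \<open>1/k\<close> is at least \<open>ln (n + 1)\<close>.\<close>

lemma adjoint_coeff_bound:
  assumes "0 \<le> Re s"
  shows "norm (adjoint_coeff s n) \<le> exp ((norm s)\<^sup>2) * real (n + 1) powr (- Re s)"
proof -
  have factor: "norm (1 - s / of_nat k) \<le> exp ((norm s)\<^sup>2 / 2 * (1 / (real k)\<^sup>2) - Re s * (1 / real k))"
    if "k \<ge> 1" for k
  proof (rule power2_le_imp_le)
    have "(norm (1 - s / of_nat k))\<^sup>2 = 1 + ((norm s)\<^sup>2 * (1 / (real k)\<^sup>2) - 2 * Re s * (1 / real k))"
      using that unfolding cmod_power2 by (simp add: power2_eq_square field_simps)
    also have "\<dots> \<le> exp ((norm s)\<^sup>2 * (1 / (real k)\<^sup>2) - 2 * Re s * (1 / real k))"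
      by (rule exp_ge_add_one_self)
    also have "\<dots> = (exp ((norm s)\<^sup>2 / 2 * (1 / (real k)\<^sup>2) - Re s * (1 / real k)))\<^sup>2"
      by (simp flip: exp_double)
    finally show "(norm (1 - s / of_nat k))\<^sup>2 \<le> (exp ((norm s)\<^sup>2 / 2 * (1 / (real k)\<^sup>2) - Re s * (1 / real k)))\<^sup>2" .
  qed simp
  have "norm (adjoint_coeff s n) \<le> (\<Prod>k=1..n. exp ((norm s)\<^sup>2 / 2 * (1 / (real k)\<^sup>2) - Re s * (1 / real k)))"
    unfolding adjoint_coeff_def prod_norm[symmetric] by (intro prod_mono) (use factor in auto)
  also have "\<dots> = exp ((norm s)\<^sup>2 / 2 * (\<Sum>k=1..n. 1 / (real k)\<^sup>2) - Re s * (\<Sum>k=1..n. 1 / real k))"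
    by (simp only: exp_sum[OF finite_atLeastAtMost, symmetric] sum_subtractf sum_distrib_left)
  also have "\<dots> \<le> exp ((norm s)\<^sup>2 - Re s * ln (real n + 1))"
  proof -
    have "(norm s)\<^sup>2 / 2 * (\<Sum>k=1..n. 1 / (real k)\<^sup>2) \<le> (norm s)\<^sup>2 / 2 * 2"
      by (intro mult_left_mono sum_inverse_squares_le) auto
    moreover have "ln (real n + 1) \<le> (\<Sum>k=1..n. 1 / real k)"
      using ln_le_harm[of n] by (simp add: harm_def divide_inverse)
    then have "Re s * ln (real n + 1) \<le> Re s * (\<Sum>k=1..n. 1 / real k)"
      using assms by (intro mult_left_mono)
    ultimately show ?thesis by simp
  qed
  also have "\<dots> = exp ((norm s)\<^sup>2) * real (n + 1) powr (- Re s)"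
    by (simp add: powr_def exp_diff exp_minus field_simps)
  finally show ?thesis .
qed

text \<open>The eigenvector equation \<open>b\<^sub>n / (n + 1) = (b\<^sub>n - b\<^sub>n\<^sub>+\<^sub>1) / s\<close> makes the sum telescope, both against
  the sequence \<open>f\<close> itself and against its averaged partial sums. Only a boundary term survives.\<close>

lemma adjoint_summation:
  fixes g :: "nat \<Rightarrow> complex"
  assumes s: "s \<noteq> 0" and f: "\<And>n. f n = (\<Sum>k\<le>n. g k) / of_nat (n + 1) - 1 / s * g n"
  shows "(\<Sum>n\<le>N. adjoint_coeff s n * ((\<Sum>k\<le>n. f k) / of_nat (n + 1)))
    = - (adjoint_coeff s (Suc N) * ((\<Sum>k\<le>N. g k) / s + (\<Sum>k\<le>N. f k))) / s"
proof -
  have step: "adjoint_coeff s n / of_nat (n + 1) = (adjoint_coeff s n - adjoint_coeff s (Suc n)) / s" for n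
  proof -
    have "adjoint_coeff s n - adjoint_coeff s (Suc n) = adjoint_coeff s n * s / of_nat (n + 1)"
      by (simp add: adjoint_coeff_Suc right_diff_distrib)
    then show ?thesis using s by simp
  qed
  have first: "(\<Sum>n\<le>N. adjoint_coeff s n * f n) = - (adjoint_coeff s (Suc N) * (\<Sum>k\<le>N. g k)) / s" for N
  proof (induction N)
    case 0
    then show ?case using s by (simp add: f adjoint_coeff_Suc field_simps)
  next
    case (Suc N)
    let ?b = "adjoint_coeff s (Suc N)" and ?b' = "adjoint_coeff s (Suc (Suc N))" and ?S = "\<Sum>k\<le>N. g k"
    have "?b * f (Suc N) = ?b / of_nat (Suc N + 1) * (?S + g (Suc N)) - ?b * g (Suc N) / s"
      unfolding f by (simp add: right_diff_distrib)
    also have "\<dots> = (?b - ?b') / s * (?S + g (Suc N)) - ?b * g (Suc N) / s" by (simp only: step)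
    finally have "?b * f (Suc N) = (?b - ?b') / s * (?S + g (Suc N)) - ?b * g (Suc N) / s" .
    moreover have "- (?b * ?S) / s + ((?b - ?b') / s * (?S + g (Suc N)) - ?b * g (Suc N) / s)
        = - (?b' * (?S + g (Suc N))) / s"
      using s by (simp add: divide_simps) (simp add: algebra_simps)
    ultimately show ?case by (simp only: sum.atMost_Suc Suc)
  qed
  have second: "(\<Sum>n\<le>N. adjoint_coeff s n * ((\<Sum>k\<le>n. f k) / of_nat (n + 1)))
      = ((\<Sum>n\<le>N. adjoint_coeff s n * f n) - adjoint_coeff s (Suc N) * (\<Sum>k\<le>N. f k)) / s" for N
  proof (induction N)
    case 0
    then show ?case using s by (simp add: adjoint_coeff_Suc field_simps)
  next
    case (Suc N)
    let ?b = "adjoint_coeff s (Suc N)" and ?b' = "adjoint_coeff s (Suc (Suc N))" and ?S = "\<Sum>k\<le>N. f k"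
    have "?b * ((?S + f (Suc N)) / of_nat (Suc N + 1)) = ?b / of_nat (Suc N + 1) * (?S + f (Suc N))" by simp
    also have "\<dots> = (?b - ?b') / s * (?S + f (Suc N))" by (simp only: step)
    finally have "?b * ((?S + f (Suc N)) / of_nat (Suc N + 1)) = (?b - ?b') / s * (?S + f (Suc N))" .
    moreover have "(F - ?b * ?S) / s + (?b - ?b') / s * (?S + f (Suc N))
        = (F + ?b * f (Suc N) - ?b' * (?S + f (Suc N))) / s" for F
      using s by (simp add: divide_simps) (simp add: algebra_simps)
    ultimately show ?case by (simp only: sum.atMost_Suc Suc)
  qed
  show ?thesis unfolding second first by (simp add: algebra_simps add_divide_distrib diff_divide_distrib)
qed

lemma mem_ball_iff_Re_inverse:
  assumes "0 < p"
  shows "w \<in> ball (of_real (p / 2)) (p / 2) \<longleftrightarrow> w \<noteq> 0 \<and> 1 < p * Re (1 / w)"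
    and "w \<in> cball (of_real (p / 2)) (p / 2) \<longleftrightarrow> w = 0 \<or> 1 \<le> p * Re (1 / w)"
proof -
  have Re: "p * Re (1 / w) = p * Re w / (norm w)\<^sup>2"
    by (simp add: Re_divide cmod_power2)
  have dist: "(dist (of_real (p / 2)) w)\<^sup>2 = (norm w)\<^sup>2 - p * Re w + (p / 2)\<^sup>2"
    unfolding dist_norm cmod_power2 by (simp add: power2_eq_square algebra_simps)
  have "dist (of_real (p / 2)) w < p / 2 \<longleftrightarrow> (dist (of_real (p / 2)) w)\<^sup>2 < (p / 2)\<^sup>2"
    unfolding not_le[symmetric] using power_mono_iff[of "p / 2" "dist (of_real (p / 2)) w" 2] assms by simp
  then have less: "dist (of_real (p / 2)) w < p / 2 \<longleftrightarrow> (norm w)\<^sup>2 < p * Re w" unfolding dist by auto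
  have "dist (of_real (p / 2)) w \<le> p / 2 \<longleftrightarrow> (dist (of_real (p / 2)) w)\<^sup>2 \<le> (p / 2)\<^sup>2"
    using assms by (auto intro: power_mono power2_le_imp_le)
  then have le: "dist (of_real (p / 2)) w \<le> p / 2 \<longleftrightarrow> (norm w)\<^sup>2 \<le> p * Re w" unfolding dist by auto
  show "w \<in> ball (of_real (p / 2)) (p / 2) \<longleftrightarrow> w \<noteq> 0 \<and> 1 < p * Re (1 / w)"
    unfolding mem_ball less Re by (cases "w = 0") (simp_all add: field_simps)
  show "w \<in> cball (of_real (p / 2)) (p / 2) \<longleftrightarrow> w = 0 \<or> 1 \<le> p * Re (1 / w)"
    unfolding mem_cball le Re by (cases "w = 0") (simp_all add: field_simps)
qed

text \<open>The pairing of the eigenvector with \<open>C f\<close> instead of \<open>f\<close>, which only multiplies it by \<open>1/s\<close>. The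
  averages have coefficients \<open>O(n\<^sup>1\<^sup>/\<^sup>p\<^sup>-\<^sup>1)\<close>, so this series converges absolutely for
  \<open>Re s > 1/p\<close>.\<close>

definition adjoint_pairing :: "(complex \<Rightarrow> complex) \<Rightarrow> complex \<Rightarrow> complex"
  where "adjoint_pairing f s = (\<Sum>n. adjoint_coeff s n * ((\<Sum>k\<le>n. taylor_coeff f k) / of_nat (n + 1)))"

lemma adjoint_pairing_term_bound:
  assumes K: "norm S \<le> K * real (n + 1) powr (1 / p)" "0 \<le> K" and p: "0 < p"
    and d: "0 \<le> d" "1 / p + d \<le> Re s" and R: "norm s \<le> R"
  shows "norm (adjoint_coeff s n * (S / of_nat (n + 1))) \<le> exp (R\<^sup>2) * K * real (n + 1) powr (- 1 - d)"
proof -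
  let ?m = "real (n + 1)"
  have "norm (adjoint_coeff s n) \<le> exp ((norm s)\<^sup>2) * ?m powr (- Re s)"
    using d p by (intro adjoint_coeff_bound) (auto intro: order_trans[rotated])
  also have "\<dots> \<le> exp (R\<^sup>2) * ?m powr (- (1 / p + d))"
    using R d by (intro mult_mono powr_mono) (auto intro: power_mono)
  finally have "norm (adjoint_coeff s n) * (norm S / ?m)
      \<le> exp (R\<^sup>2) * ?m powr (- (1 / p + d)) * (K * ?m powr (1 / p) / ?m)"
    using K by (intro mult_mono divide_right_mono) auto
  also have "\<dots> = exp (R\<^sup>2) * K * (?m powr (- (1 / p + d)) * ?m powr (1 / p) * ?m powr (- 1))"
    by (simp add: powr_minus_divide)
  also have "\<dots> = exp (R\<^sup>2) * K * ?m powr (- 1 - d)"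
  proof -
    have "- (1 / p + d) + 1 / p + - 1 = - 1 - d" by simp
    then show ?thesis by (simp only: powr_add[symmetric])
  qed
  finally show ?thesis by (simp add: norm_mult norm_divide del: of_nat_add of_nat_Suc)
qed

lemma summable_shifted_powr: "0 < d \<Longrightarrow> summable (\<lambda>n. C * real (n + 1) powr (- 1 - d))"
  using summable_real_powr_iff[of "- 1 - d"] summable_iff_shift[of "\<lambda>n. real n powr (- 1 - d)" 1]
  by (intro summable_mult) simp

context
  fixes p :: real
  assumes p: "1 < p"
begin

lemma adjoint_coeff_holomorphic: "(\<lambda>s. adjoint_coeff s n) holomorphic_on S"
  unfolding adjoint_coeff_def by (intro holomorphic_intros) auto

lemma adjoint_pairing_limit:
  assumes f: "f \<in> hardy_space p" and s: "1 < p * Re s"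
  shows "(\<lambda>N. \<Sum>n<N. adjoint_coeff s n * ((\<Sum>k\<le>n. taylor_coeff f k) / of_nat (n + 1))) \<longlonglongrightarrow> adjoint_pairing f s"
proof -
  obtain K where K: "0 \<le> K" "\<And>n. norm (\<Sum>k\<le>n. taylor_coeff f k) \<le> K * real (n + 1) powr (1 / p)"
    using partial_sum_growth[OF p] f hardy_norm_nonneg[OF p f] by (metis mult_nonneg_nonneg)
  define d where "d = Re s - 1 / p"
  have d: "0 < d" using s p by (simp add: d_def field_simps)
  have "summable (\<lambda>n. adjoint_coeff s n * ((\<Sum>k\<le>n. taylor_coeff f k) / of_nat (n + 1)))"
  proof (rule summable_comparison_test'[OF summable_shifted_powr[OF d], of 0])
    show "norm (adjoint_coeff s n * ((\<Sum>k\<le>n. taylor_coeff f k) / of_nat (n + 1)))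
        \<le> exp ((norm s)\<^sup>2) * K * real (n + 1) powr (- 1 - d)" for n
      by (rule adjoint_pairing_term_bound[OF K(2) K(1)]) (use p d in \<open>auto simp: d_def\<close>)
  qed
  then show ?thesis unfolding adjoint_pairing_def by (rule summable_LIMSEQ)
qed

lemma adjoint_pairing_holomorphic:
  assumes f: "f \<in> hardy_space p"
  shows "adjoint_pairing f holomorphic_on {s. 1 < p * Re s}"
proof -
  obtain K where K: "0 \<le> K" "\<And>n. norm (\<Sum>k\<le>n. taylor_coeff f k) \<le> K * real (n + 1) powr (1 / p)"
    using partial_sum_growth[OF p] f hardy_norm_nonneg[OF p f] by (metis mult_nonneg_nonneg)
  let ?P = "\<lambda>N s. \<Sum>n<N. adjoint_coeff s n * ((\<Sum>k\<le>n. taylor_coeff f k) / of_nat (n + 1))"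
  show ?thesis
  proof (rule holomorphic_uniform_sequence[where f = ?P])
    show "open {s. 1 < p * Re s}" by (intro open_Collect_less continuous_intros)
    show "?P N holomorphic_on {s. 1 < p * Re s}" for N
      by (intro holomorphic_intros adjoint_coeff_holomorphic)
    fix s assume s: "s \<in> {s. 1 < p * Re s}"
    define d where "d = (Re s - 1 / p) / 2"
    have d: "0 < d" using s p by (simp add: d_def field_simps)
    have near: "1 / p + d \<le> Re w \<and> norm w \<le> norm s + d" if "w \<in> cball s d" for w
    proof -
      have "norm (s - w) \<le> d" using that by (simp add: dist_norm)
      moreover have "Re s - Re w \<le> norm (s - w)" using complex_Re_le_cmod[of "s - w"] by simp
      moreover have "norm w \<le> norm s + norm (s - w)" using norm_triangle_sub[of w s] by (simp add: norm_minus_commute)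
      moreover have "2 * d = Re s - 1 / p" unfolding d_def by simp
      ultimately show ?thesis by linarith
    qed
    have sub: "cball s d \<subseteq> {s. 1 < p * Re s}"
    proof
      fix w assume "w \<in> cball s d"
      then have "1 / p < Re w" using near[of w] d by simp
      then show "w \<in> {s. 1 < p * Re s}" using p by (simp add: field_simps)
    qed
    have "uniform_limit (cball s d) ?P (\<lambda>w. \<Sum>n. adjoint_coeff w n * ((\<Sum>k\<le>n. taylor_coeff f k) / of_nat (n + 1))) sequentially"
    proof (rule Weierstrass_m_test[OF _ summable_shifted_powr[OF d]])
      show "norm (adjoint_coeff w n * ((\<Sum>k\<le>n. taylor_coeff f k) / of_nat (n + 1)))
          \<le> exp ((norm s + d)\<^sup>2) * K * real (n + 1) powr (- 1 - d)" if "w \<in> cball s d" for n w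
        by (rule adjoint_pairing_term_bound[OF K(2) K(1)]) (use p d near[OF that] in auto)
    qed
    then show "\<exists>d>0. cball s d \<subseteq> {s. 1 < p * Re s} \<and> uniform_limit (cball s d) ?P (adjoint_pairing f) sequentially"
      using d sub unfolding adjoint_pairing_def[abs_def] by blast
  qed
qed

text \<open>By \<open>adjoint_summation\<close> the partial sums of the pairing equal a boundary term of order
  \<open>N powr (1/p - Re s)\<close>.\<close>

lemma adjoint_pairing_range:
  assumes f: "f \<in> hardy_space p" and g: "g \<in> hardy_space p" and s: "1 < p * Re s"
    and eq: "cesaro g - cscale (1 / s) g = f"
  shows "adjoint_pairing f s = 0"
proof -
  have s0: "s \<noteq> 0" using s by auto
  note fh = hardy_spaceD(1)[OF p f] and gh = hardy_spaceD(1)[OF p g]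
  have coeff: "taylor_coeff f n = (\<Sum>k\<le>n. taylor_coeff g k) / of_nat (n + 1) - 1 / s * taylor_coeff g n" for n
  proof -
    have "f = (\<lambda>z. 1 * cesaro g z + (- 1 / s) * g z)" unfolding eq[symmetric] by (auto simp: fun_eq_iff)
    then have "taylor_coeff f n = 1 * taylor_coeff (cesaro g) n + (- 1 / s) * taylor_coeff g n"
      using taylor_coeff_linear[OF cesaro_holomorphic[OF gh] gh] by metis
    then show ?thesis by (simp add: taylor_coeff_cesaro[OF gh])
  qed
  obtain K where K: "0 \<le> K" "\<And>h n. h \<in> hardy_space p \<Longrightarrow>
      norm (\<Sum>k\<le>n. taylor_coeff h k) \<le> K * hardy_norm p h * real (n + 1) powr (1 / p)"
    using partial_sum_growth[OF p] by blast
  define d where "d = Re s - 1 / p"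
  have d: "0 < d" using s p by (simp add: d_def field_simps)
  let ?A = "K * hardy_norm p g / norm s + K * hardy_norm p f"
  let ?P = "\<lambda>N. \<Sum>n<N. adjoint_coeff s n * ((\<Sum>k\<le>n. taylor_coeff f k) / of_nat (n + 1))"
  have bound: "norm (?P (Suc N)) \<le> exp ((norm s)\<^sup>2) * ?A / norm s * real (N + 1) powr (- d)" for N
  proof -
    let ?m = "real (N + 1)"
    have "?P (Suc N) = - (adjoint_coeff s (Suc N) * ((\<Sum>k\<le>N. taylor_coeff g k) / s + (\<Sum>k\<le>N. taylor_coeff f k))) / s"
      unfolding lessThan_Suc_atMost using adjoint_summation[where f = "taylor_coeff f" and g = "taylor_coeff g", OF s0 coeff] .
    then have eq: "norm (?P (Suc N)) = norm (adjoint_coeff s (Suc N)) * norm ((\<Sum>k\<le>N. taylor_coeff g k) / s + (\<Sum>k\<le>N. taylor_coeff f k)) / norm s"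
      by (simp only: norm_divide norm_minus_cancel norm_mult)
    have "norm (adjoint_coeff s (Suc N)) \<le> exp ((norm s)\<^sup>2) * real (Suc N + 1) powr (- Re s)"
      by (rule adjoint_coeff_bound) (use d p in \<open>auto simp: d_def intro: order_trans[of 0 "1 / p"]\<close>)
    also have "\<dots> \<le> exp ((norm s)\<^sup>2) * ?m powr (- Re s)"
      using d p by (intro mult_left_mono powr_mono2') (auto simp: d_def intro: order_trans[of 0 "1 / p"])
    finally have b: "norm (adjoint_coeff s (Suc N)) \<le> exp ((norm s)\<^sup>2) * ?m powr (- Re s)" .
    have "norm ((\<Sum>k\<le>N. taylor_coeff g k) / s + (\<Sum>k\<le>N. taylor_coeff f k))
        \<le> K * hardy_norm p g * ?m powr (1 / p) / norm s + K * hardy_norm p f * ?m powr (1 / p)"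
      using K(2)[OF g, of N] K(2)[OF f, of N]
      by (intro norm_triangle_le) (auto simp: norm_divide intro!: add_mono divide_right_mono)
    also have "\<dots> = ?A * ?m powr (1 / p)" by (simp add: distrib_right)
    finally have S: "norm ((\<Sum>k\<le>N. taylor_coeff g k) / s + (\<Sum>k\<le>N. taylor_coeff f k)) \<le> ?A * ?m powr (1 / p)" .
    have "norm (?P (Suc N)) \<le> (exp ((norm s)\<^sup>2) * ?m powr (- Re s)) * (?A * ?m powr (1 / p)) / norm s"
      unfolding eq by (intro divide_right_mono mult_mono b S) auto
    also have "\<dots> = exp ((norm s)\<^sup>2) * ?A / norm s * (?m powr (- Re s) * ?m powr (1 / p))" by simp
    also have "?m powr (- Re s) * ?m powr (1 / p) = ?m powr (- d)" by (simp add: d_def flip: powr_add)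
    finally show ?thesis .
  qed
  have top: "filterlim (\<lambda>N. real (N + 1)) at_top sequentially"
    using filterlim_compose[OF filterlim_real_sequentially filterlim_Suc] by simp
  have "(\<lambda>N. exp ((norm s)\<^sup>2) * ?A / norm s * real (N + 1) powr (- d)) \<longlonglongrightarrow> exp ((norm s)\<^sup>2) * ?A / norm s * 0"
    by (intro tendsto_mult tendsto_const tendsto_neg_powr[OF _ top]) (use d in simp)
  then have "(\<lambda>N. ?P (Suc N)) \<longlonglongrightarrow> 0"
    by (intro Lim_null_comparison[OF always_eventually[OF allI[OF bound]]]) simp
  then have "?P \<longlonglongrightarrow> 0" by (rule LIMSEQ_imp_Suc)
  then show ?thesis using adjoint_pairing_limit[OF f s] LIMSEQ_unique by blast
qed

text \<open>The pairing, as an analytic function of \<open>w = 1/s\<close> on the open disc, vanishes on \<open>U\<close> and hence everywhere.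
  At \<open>s = n + 1\<close> the coefficients \<open>adjoint_coeff s m\<close> with \<open>m > n\<close> are \<open>0\<close>, so the pairings at
  these points determine the partial sums of the Taylor coefficients one after the other.\<close>

lemma solvable_on_open_set_imp_zero:
  assumes f: "f \<in> hardy_space p" and U: "open U" "U \<noteq> {}" "U \<subseteq> ball (of_real (p / 2)) (p / 2)"
    and sol: "\<And>w. w \<in> U \<Longrightarrow> \<exists>g\<in>hardy_space p. cesaro g - cscale w g = f"
  shows "f = 0"
proof -
  let ?D = "ball (complex_of_real (p / 2)) (p / 2)"
  have p0: "0 < p" using p by simp
  note D = mem_ball_iff_Re_inverse(1)[OF p0]
  have hol: "(\<lambda>w. adjoint_pairing f (1 / w)) holomorphic_on ?D"
  proof (rule holomorphic_on_compose_gen[where g = "adjoint_pairing f", unfolded o_def])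
    show "(\<lambda>w. 1 / w) holomorphic_on ?D" by (intro holomorphic_intros) (use D in blast)
    show "adjoint_pairing f holomorphic_on {s. 1 < p * Re s}" by (rule adjoint_pairing_holomorphic[OF f])
    show "(\<lambda>w. 1 / w) ` ?D \<subseteq> {s. 1 < p * Re s}" using D by blast
  qed
  have vanish: "adjoint_pairing f (1 / w) = 0" if "w \<in> ?D" for w
  proof (rule analytic_continuation_open[where f = "\<lambda>w. adjoint_pairing f (1 / w)" and s = U and s' = ?D and g = "\<lambda>_. 0"])
    fix v assume v: "v \<in> U"
    then have vD: "v \<noteq> 0" "1 < p * Re (1 / v)" using D U by blast+
    obtain g where "g \<in> hardy_space p" "cesaro g - cscale v g = f" using sol[OF v] by blast
    then show "adjoint_pairing f (1 / v) = 0"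
      using adjoint_pairing_range[OF f _ vD(2), of g] by simp
  qed (use U hol that in \<open>auto intro: holomorphic_intros\<close>)
  have "(\<Sum>k\<le>n. taylor_coeff f k) = 0" for n
  proof (induction n rule: less_induct)
    case (less n)
    define s where "s = complex_of_nat (Suc n)"
    have s0: "s \<noteq> 0" by (simp add: s_def del: of_nat_Suc)
    have "1 < p * Re s"
      using p mult_mono[of 1 p 1 "real (Suc n)"] less_le_trans[of 1 p "p * real (Suc n)"] by (simp add: s_def)
    then have "1 / s \<in> ?D" using D[of "1 / s"] s0 by simp
    then have zero: "adjoint_pairing f s = 0" using vanish[of "1 / s"] by simp
    let ?t = "\<lambda>m. adjoint_coeff s m * ((\<Sum>k\<le>m. taylor_coeff f k) / of_nat (m + 1))"
    have "?t m = 0" if "m \<noteq> n" for m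
    proof (cases "m < n")
      case False
      then have "Suc n \<in> {1..m}" using that by simp
      then have "adjoint_coeff s m = 0" unfolding adjoint_coeff_def s_def by (intro prod_zero) (auto simp del: of_nat_Suc)
      then show ?thesis by simp
    qed (simp add: less)
    then have "adjoint_pairing f s = ?t n"
      unfolding adjoint_pairing_def using suminf_finite[of "{n}" ?t] by simp
    moreover have "adjoint_coeff s n \<noteq> 0"
    proof -
      have "1 - s / of_nat k \<noteq> 0" if "k \<in> {1..n}" for k
      proof
        assume "1 - s / of_nat k = 0"
        then have "s = of_nat k" using that by (simp add: field_simps)
        then have "Suc n = k" unfolding s_def by (simp only: of_nat_eq_iff)
        then show False using that by simp
      qed
      then show ?thesis unfolding adjoint_coeff_def by (simp add: prod_zero_iff)
    qed
    ultimately show ?case using zero by (simp del: of_nat_add of_nat_Suc)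
  qed
  note sums = this
  have "taylor_coeff f n = 0" for n
  proof (cases n)
    case 0
    then show ?thesis using sums[of 0] by simp
  next
    case (Suc m)
    then show ?thesis using sums[of m] sums[of "Suc m"] by (simp only: sum.atMost_Suc) simp
  qed
  moreover have "taylor_coeff 0 n = 0" for n
    by (subst taylor_coeff_eqI[of _ 0]) (auto simp: zero_fun_def)
  ultimately show ?thesis
    using hardy_spaceD(1,2)[OF p f] by (intro disc_function_eqI) (auto simp: zero_fun_def)
qed

end

section \<open>Spectrum, local spectra and invariant subspaces\<close>

context
  fixes p :: real
  assumes p: "1 < p"
begin

interpretation H: function_operator "hardy_space p" "hardy_norm p" cesaro
  by (rule cesaro_function_operator[OF p])

abbreviation (input) "spectral_disc \<equiv> cball (complex_of_real (p / 2)) (p / 2)"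

lemma spectral_disc_inner_dense:
  assumes "open U" "w \<in> U" "w \<in> spectral_disc"
  shows "open (U \<inter> ball (of_real (p / 2)) (p / 2))" "U \<inter> ball (of_real (p / 2)) (p / 2) \<noteq> {}"
proof -
  show "open (U \<inter> ball (of_real (p / 2)) (p / 2))" using assms by auto
  have "w \<in> closure (ball (of_real (p / 2)) (p / 2))" using assms p by simp
  then show "U \<inter> ball (of_real (p / 2)) (p / 2) \<noteq> {}"
    using assms open_Int_closure_eq_empty[OF assms(1)] by blast
qed

text \<open>A neighbourhood of a boundary point of the disc meets the interior, so boundary points need no separate
  argument.\<close>

lemma no_local_solution:
  assumes f: "f \<in> hardy_space p" and U: "open U" "w \<in> U" "w \<in> spectral_disc"
    and sol: "\<And>v. v \<in> U \<Longrightarrow> \<exists>g\<in>hardy_space p. cesaro g - cscale v g = f"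
  shows "f = 0"
  by (rule solvable_on_open_set_imp_zero[OF p f spectral_disc_inner_dense[OF U]]) (use sol in auto)

lemma regular_outside_spectral_disc:
  assumes "w \<notin> spectral_disc"
  shows "\<exists>K. H.regular_point w K"
proof -
  have "w \<noteq> 0" "p * Re (1 / w) < 1"
    using assms mem_ball_iff_Re_inverse(2)[of p w] p by auto
  then show ?thesis by (rule cesaro_regular_outside_disc[OF p])
qed

lemma spectral_disc_subset_spectrum:
  assumes op: "function_operator M (hardy_norm p) cesaro" and M: "M \<subseteq> hardy_space p"
    and f: "f \<in> M" "f \<noteq> 0"
  shows "spectral_disc \<subseteq> op_spectrum M (hardy_norm p) cesaro"
proof (rule ccontr)
  assume "\<not> ?thesis"
  then obtain w where w: "w \<in> spectral_disc" "w \<notin> op_spectrum M (hardy_norm p) cesaro" by blast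
  obtain U F where U: "open U" "w \<in> U" and F: "analytic_into M (hardy_norm p) U F"
    "\<forall>v\<in>U. cesaro (F v) - cscale v (F v) = f"
    using function_operator.local_solution[OF op w(2) f(1)] by blast
  have "f = 0"
  proof (rule no_local_solution[OF _ U w(1)])
    show "f \<in> hardy_space p" using f M by blast
    show "\<exists>g\<in>hardy_space p. cesaro g - cscale v g = f" if "v \<in> U" for v
      using F that M unfolding analytic_into_def by blast
  qed
  then show False using f by simp
qed

lemma hardy_space_nontrivial: "\<exists>f\<in>hardy_space p. f \<noteq> 0"
proof -
  define f where "f z = (if z \<in> ball 0 1 then 1 else 0 :: complex)" for z :: complex
  have hol: "f holomorphic_on ball 0 1"
    by (rule holomorphic_transform[of "\<lambda>_. 1"]) (auto simp: f_def)
  have "f \<in> hardy_space p"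
  proof (rule hardy_spaceI(1)[OF p hol, of 1])
    show "integral_mean p r f \<le> 1" if "0 \<le> r" "r < 1" for r
      unfolding integral_mean_eq
      by (rule circle_mean_le_sup[OF p continuous_on_circle[OF hol that]]) (auto simp: f_def)
  qed (auto simp: f_def)
  moreover have "f 0 \<noteq> 0" by (simp add: f_def)
  then have "f \<noteq> 0" by (auto simp: fun_eq_iff)
  ultimately show ?thesis by blast
qed

lemma cesaro_spectrum: "op_spectrum (hardy_space p) (hardy_norm p) cesaro = spectral_disc"
proof
  show "op_spectrum (hardy_space p) (hardy_norm p) cesaro \<subseteq> spectral_disc"
    using regular_outside_spectral_disc H.not_in_spectrum_iff by blast
  show "spectral_disc \<subseteq> op_spectrum (hardy_space p) (hardy_norm p) cesaro"
    using hardy_space_nontrivial spectral_disc_subset_spectrum[OF H.function_operator_axioms] by blast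
qed

lemma cesaro_local_spectrum:
  assumes f: "f \<in> hardy_space p" "f \<noteq> 0"
  shows "local_spectrum (hardy_space p) (hardy_norm p) cesaro f = spectral_disc"
proof
  show "local_spectrum (hardy_space p) (hardy_norm p) cesaro f \<subseteq> spectral_disc"
  proof
    fix w assume w: "w \<in> local_spectrum (hardy_space p) (hardy_norm p) cesaro f"
    show "w \<in> spectral_disc"
    proof (rule ccontr)
      assume "w \<notin> spectral_disc"
      then obtain U F where "open U" "w \<in> U" "analytic_into (hardy_space p) (hardy_norm p) U F"
        "\<forall>v\<in>U. cesaro (F v) - cscale v (F v) = f"
        using H.local_solution[OF _ f(1), of w] cesaro_spectrum by blast
      then show False using w unfolding local_spectrum_def local_resolvent_def by blast
    qed
  qed
  show "spectral_disc \<subseteq> local_spectrum (hardy_space p) (hardy_norm p) cesaro f"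
  proof
    fix w assume w: "w \<in> spectral_disc"
    show "w \<in> local_spectrum (hardy_space p) (hardy_norm p) cesaro f"
    proof (rule ccontr)
      assume "w \<notin> local_spectrum (hardy_space p) (hardy_norm p) cesaro f"
      then obtain U F where U: "open U" "w \<in> U" and F: "analytic_into (hardy_space p) (hardy_norm p) U F"
        "\<forall>v\<in>U. cesaro (F v) - cscale v (F v) = f"
        unfolding local_spectrum_def local_resolvent_def by blast
      have "f = 0"
        by (rule no_local_solution[OF f(1) U w]) (use F in \<open>auto simp: analytic_into_def\<close>)
      then show False using f by simp
    qed
  qed
qed

lemma zero_local_spectrum: "local_spectrum (hardy_space p) (hardy_norm p) cesaro 0 = {}"
proof -
  have "analytic_into (hardy_space p) (hardy_norm p) UNIV (\<lambda>_. 0)"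
    unfolding analytic_into_def using H.zero_mem H.norm_zero
    by (auto simp: cscale_simps intro!: bexI[of _ 0])
  moreover have "cesaro 0 - cscale z 0 = 0" for z using H.T_zero by (simp add: cscale_simps)
  ultimately have "UNIV \<subseteq> local_resolvent (hardy_space p) (hardy_norm p) cesaro 0"
    unfolding local_resolvent_def by (intro Union_upper) (auto intro!: exI[of _ "\<lambda>_. 0"])
  then show ?thesis by (auto simp: local_spectrum_def)
qed

lemma closed_subspace_operator:
  assumes M: "closed_subspace (hardy_space p) (hardy_norm p) M" and inv: "\<And>f. f \<in> M \<Longrightarrow> cesaro f \<in> M"
  shows "function_operator M (hardy_norm p) cesaro"
proof -
  have sub: "M \<subseteq> hardy_space p" and closed: "\<And>f. f \<in> hardy_space p \<Longrightarrow> (\<And>e. 0 < e \<Longrightarrow> \<exists>g\<in>M. hardy_norm p (f - g) < e) \<Longrightarrow> f \<in> M"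
    and lin: "module.subspace cscale M"
    using M unfolding closed_subspace_def by blast+
  have mem: "0 \<in> M" "\<And>f g. f \<in> M \<Longrightarrow> g \<in> M \<Longrightarrow> f + g \<in> M" "\<And>c f. f \<in> M \<Longrightarrow> cscale c f \<in> M"
    using lin unfolding module.subspace_def[OF module_cscale] by blast+
  show ?thesis
  proof
    show "\<exists>g\<in>M. (\<lambda>n. hardy_norm p (u n - g)) \<longlonglongrightarrow> 0"
      if u: "\<And>n. u n \<in> M" and Cauchy: "\<And>e. e > 0 \<Longrightarrow> \<exists>K. \<forall>m\<ge>K. \<forall>n\<ge>K. hardy_norm p (u m - u n) < e" for u
    proof -
      have uH: "u n \<in> hardy_space p" for n using u sub by blast
      obtain g where g: "g \<in> hardy_space p" "(\<lambda>n. hardy_norm p (u n - g)) \<longlonglongrightarrow> 0"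
        using H.complete[OF uH Cauchy] by blast
      have "g \<in> M"
      proof (rule closed[OF g(1)])
        fix e :: real assume "0 < e"
        then have "\<forall>\<^sub>F n in sequentially. hardy_norm p (u n - g) < e"
          by (rule order_tendstoD(2)[OF g(2)])
        then obtain n where "hardy_norm p (u n - g) < e"
          using eventually_happens'[OF sequentially_bot] by blast
        then show "\<exists>h\<in>M. hardy_norm p (g - h) < e"
          using u[of n] H.norm_diff_commute[OF uH g(1), of n] by auto
      qed
      then show ?thesis using g(2) by blast
    qed
    show "0 \<in> M" "\<And>f g. f \<in> M \<Longrightarrow> g \<in> M \<Longrightarrow> f + g \<in> M" "\<And>c f. f \<in> M \<Longrightarrow> cscale c f \<in> M"
      by (fact mem)+
    show "hardy_norm p (f + g) \<le> hardy_norm p f + hardy_norm p g" "cesaro (f + g) = cesaro f + cesaro g"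
      if "f \<in> M" "g \<in> M" for f g
      using that by (simp_all add: H.norm_add H.T_add subsetD[OF sub])
    show "hardy_norm p (cscale c f) = norm c * hardy_norm p f" "cesaro (cscale c f) = cscale c (cesaro f)"
      if "f \<in> M" for c f
      using that by (simp_all add: H.norm_scale H.T_scale subsetD[OF sub])
    show "f = 0" if "f \<in> M" "hardy_norm p f = 0" for f
      using subsetD[OF sub that(1)] that(2) by (rule H.norm_eq_0)
    show "cesaro f \<in> M" if "f \<in> M" for f by (rule inv[OF that])
  qed
qed

lemma cesaro_spectrum_invariant_subspace:
  assumes M: "closed_subspace (hardy_space p) (hardy_norm p) M" and inv: "\<And>f. f \<in> M \<Longrightarrow> cesaro f \<in> M"
    and nz: "M \<noteq> {0}"
  shows "op_spectrum M (hardy_norm p) cesaro = spectral_disc"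
proof
  note op = closed_subspace_operator[OF M inv]
  interpret M: function_operator M "hardy_norm p" cesaro by (rule op)
  have sub: "M \<subseteq> hardy_space p" using M by (simp add: closed_subspace_def)
  obtain f where "f \<in> M" "f \<noteq> 0" using nz M.zero_mem by blast
  then show "spectral_disc \<subseteq> op_spectrum M (hardy_norm p) cesaro"
    using spectral_disc_subset_spectrum[OF op sub] by simp
  obtain K where K: "0 \<le> K" "\<And>f. f \<in> hardy_space p \<Longrightarrow> hardy_norm p (cesaro f) \<le> K * hardy_norm p f"
    using cesaro_bounded[OF p] by blast
  \<comment> \<open>A point outside the disc beyond the norm of the operator, from which regularity is continued.\<close>
  define a where "a = complex_of_real (- (K + 1))"
  have a_nz: "a \<noteq> 0" unfolding a_def of_real_eq_0_iff using K(1) by simp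
  have "1 / a = of_real (1 / (- (K + 1)))" by (simp only: a_def of_real_divide of_real_1)
  then have "Re (1 / a) = 1 / (- (K + 1))" by (simp only: Re_complex_of_real)
  also have "\<dots> \<le> 0" using K(1) by simp
  finally have "p * Re (1 / a) \<le> 0" using p by (simp add: mult_nonneg_nonpos)
  then have a: "a \<in> - spectral_disc"
    using mem_ball_iff_Re_inverse(2)[of p a] p a_nz by simp
  have norm_a: "norm a = K + 1" unfolding a_def norm_of_real using K(1) by simp
  have reg_a: "\<exists>L. M.regular_point a L"
    by (rule M.regular_point_outside[OF K(1)]) (use K(2) sub norm_a in auto)
  have conn: "connected (- spectral_disc)"
    by (rule connected_complement_bounded_convex) auto
  have "\<exists>L. M.regular_point w L" if "w \<notin> spectral_disc" for w
    by (rule H.regular_point_subspace[OF op sub conn _ a reg_a])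
       (use that regular_outside_spectral_disc in auto)
  then show "op_spectrum M (hardy_norm p) cesaro \<subseteq> spectral_disc"
    using M.not_in_spectrum_iff by blast
qed

text \<open>On a circle of radius \<open>r\<close> the functional \<open>h \<mapsto> \<integral> h cnj (|F|\<^sup>p\<^sup>-\<^sup>2 F)\<close> with \<open>F = C\<^sup>n f\<close> attains the norm of \<open>F\<close>
  in \<open>L\<^sup>p\<close>; inserting it into \<open>iterate_functional_bound\<close> bounds this norm uniformly in \<open>r\<close>.\<close>

lemma cesaro_iterates_growth:
  assumes R: "p < R" and f: "f \<in> hardy_space p"
  shows "\<exists>B\<ge>0. \<forall>n. hardy_norm p ((cesaro ^^ n) f) \<le> B * R ^ n"
proof -
  obtain K where K: "0 \<le> K" "\<And>f. f \<in> hardy_space p \<Longrightarrow> hardy_norm p (cesaro f) \<le> K * hardy_norm p f"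
    using cesaro_bounded[OF p] by blast
  have reg: "\<exists>L. H.regular_point w L" if "p < norm w" for w
  proof (rule regular_outside_spectral_disc)
    show "w \<notin> spectral_disc"
      using that p norm_triangle_ineq[of "w - of_real (p / 2)" "of_real (p / 2)"]
      by (auto simp: dist_norm norm_minus_commute)
  qed
  have p0: "0 < p" using p by simp
  obtain B where B: "0 \<le> B" and main: "\<forall>\<phi> A n. 0 \<le> A \<longrightarrow>
      (\<forall>h\<in>hardy_space p. \<forall>h'\<in>hardy_space p. \<phi> (h + h') = \<phi> h + \<phi> h') \<longrightarrow>
      (\<forall>c. \<forall>h\<in>hardy_space p. \<phi> (cscale c h) = c * \<phi> h) \<longrightarrow>
      (\<forall>h\<in>hardy_space p. norm (\<phi> h :: complex) \<le> A * hardy_norm p h) \<longrightarrow>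
      norm (\<phi> ((cesaro ^^ n) f)) \<le> A * B * R ^ n"
    using H.iterate_functional_bound[OF K reg p0 R f] by blast
  have "hardy_norm p ((cesaro ^^ n) f) \<le> B * R ^ n" for n
  proof (rule hardy_spaceI(2)[OF p])
    define F where "F = (cesaro ^^ n) f"
    have F: "F \<in> hardy_space p" unfolding F_def by (rule H.iterate_mem[OF K f])
    show "(cesaro ^^ n) f holomorphic_on ball 0 1" "\<And>z. z \<notin> ball 0 1 \<Longrightarrow> (cesaro ^^ n) f z = 0"
      using hardy_spaceD(1,2)[OF p F] by (auto simp: F_def)
    fix r :: real assume r: "0 \<le> r" "r < 1"
    let ?z = "\<lambda>t. of_real r * cis t"
    define m where "m = integral_mean p r F"
    have m: "0 \<le> m" using integral_mean_nonneg[OF p] by (simp add: m_def)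
    define g where "g t = cnj (norm (F (?z t)) powr (p - 2) *\<^sub>R F (?z t))" for t
    define \<phi> where "\<phi> h = integral {0..2*pi} (\<lambda>t. h (?z t) * g t)" for h :: "complex \<Rightarrow> complex"
    have ch: "continuous_on {0..2*pi} (\<lambda>t. h (?z t))" if "h \<in> hardy_space p" for h
      by (rule continuous_on_circle[OF hardy_spaceD(1)[OF p that] r])
    have cg: "continuous_on {0..2*pi} g"
      unfolding g_def by (intro continuous_intros continuous_on_norm_powr_scaleR p ch F)
    have int: "(\<lambda>t. h (?z t) * g t) integrable_on {0..2*pi}" if "h \<in> hardy_space p" for h
      by (intro integrable_continuous_real continuous_on_mult ch that cg)
    have norm_g: "norm (g t) = norm (F (?z t)) powr (p - 1)" for t
      using powr_diff_2_inner(1)[OF p, of "F (?z t)"] by (simp add: g_def)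
    have add: "\<phi> (h + h') = \<phi> h + \<phi> h'" if "h \<in> hardy_space p" "h' \<in> hardy_space p" for h h'
      using integral_add[OF int[OF that(1)] int[OF that(2)]] by (simp add: \<phi>_def distrib_right)
    have scale: "\<phi> (cscale c h) = c * \<phi> h" for c h
      by (simp add: \<phi>_def mult.assoc)
    have bound: "norm (\<phi> h) \<le> (2 * pi * m powr (p - 1)) * hardy_norm p h" if h: "h \<in> hardy_space p" for h
    proof -
      have cF: "continuous_on {0..2*pi} (\<lambda>t. norm (F (?z t)) powr (p - 1))"
        by (intro continuous_on_powr' continuous_on_norm ch F continuous_on_const) (use p in auto)
      have "norm (\<phi> h) \<le> integral {0..2*pi} (\<lambda>t. norm (h (?z t)) * norm (F (?z t)) powr (p - 1))"
        unfolding \<phi>_def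
        by (intro integral_norm_bound_integral int h integrable_continuous_real continuous_on_mult continuous_on_norm ch cF)
           (simp add: norm_mult norm_g)
      also have "\<dots> \<le> 2 * pi * (integral_mean p r h * m powr (p - 1))"
        using circle_mean_Holder[OF p ch[OF h] ch[OF F]] by (simp add: integral_mean_eq m_def)
      also have "\<dots> \<le> 2 * pi * (hardy_norm p h * m powr (p - 1))"
        using hardy_spaceD(3)[OF p h r] by (intro mult_left_mono mult_right_mono) auto
      finally show ?thesis by (simp add: mult_ac)
    qed
    have "norm (\<phi> F) \<le> (2 * pi * m powr (p - 1)) * B * R ^ n"
      using main[rule_format, of "2 * pi * m powr (p - 1)" \<phi> n] add scale bound by (simp add: F_def)
    moreover have \<phi>F: "\<phi> F = of_real (2 * pi * m powr p)"
    proof -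
      have "F (?z t) * g t = of_real (norm (F (?z t)) powr p)" for t
      proof -
        have "F (?z t) * g t = of_real (norm (F (?z t)) powr (p - 2)) * (F (?z t) * cnj (F (?z t)))"
          by (simp add: g_def scaleR_conv_of_real)
        also have "F (?z t) * cnj (F (?z t)) = of_real ((norm (F (?z t)))\<^sup>2)"
          by (rule complex_norm_square[symmetric])
        finally show ?thesis using powr_diff_2_inner(2)[OF p, of "F (?z t)"] by (metis of_real_mult)
      qed
      then have "\<phi> F = integral {0..2*pi} (\<lambda>t. complex_of_real (norm (F (?z t)) powr p))" by (simp add: \<phi>_def)
      also have "\<dots> = of_real (integral {0..2*pi} (\<lambda>t. norm (F (?z t)) powr p))"
        by (rule integral_unique[OF has_integral_of_real[OF integrable_integral[OF norm_powr_integrable(2)[OF p ch[OF F]]]]])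
      also have "integral {0..2*pi} (\<lambda>t. norm (F (?z t)) powr p) = 2 * pi * m powr p"
        by (simp only: integral_powr_eq[OF p] m_def integral_mean_eq)
      finally show ?thesis .
    qed
    moreover have "norm (\<phi> F) = 2 * pi * m powr p"
      unfolding \<phi>F norm_of_real by (rule abs_of_nonneg) simp
    ultimately have "2 * pi * m powr p \<le> (2 * pi * m powr (p - 1)) * B * R ^ n" by simp
    then have le: "m powr (p - 1) * m \<le> m powr (p - 1) * (B * R ^ n)"
      using powr_add[of m "p - 1" 1] m by (cases "m = 0") (simp_all add: mult_ac)
    have "m \<le> B * R ^ n"
    proof (cases "m = 0")
      case True
      then show ?thesis using B R p by simp
    next
      case False
      then show ?thesis using le m by simp
    qed
    then show "integral_mean p r ((cesaro ^^ n) f) \<le> B * R ^ n" by (simp add: m_def F_def)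
  qed
  then show ?thesis using B by blast
qed

lemma cesaro_spectral_radius: "spectral_radius (hardy_space p) (hardy_norm p) cesaro = ereal p"
  unfolding spectral_radius_def cesaro_spectrum
proof (rule antisym)
  show "(SUP z\<in>spectral_disc. ereal (norm z)) \<le> ereal p"
  proof (rule SUP_least)
    fix z assume "z \<in> spectral_disc"
    then show "ereal (norm z) \<le> ereal p"
      using norm_triangle_ineq[of "z - of_real (p / 2)" "of_real (p / 2)"] p
      by (simp add: dist_norm norm_minus_commute)
  qed
  have "of_real p \<in> spectral_disc" using p by (simp add: dist_norm flip: of_real_diff)
  then show "ereal p \<le> (SUP z\<in>spectral_disc. ereal (norm z))"
    using p by (intro SUP_upper2[of "of_real p"]) auto
qed

text \<open>If the upper limit were below \<open>p\<close>, \<open>Neumann_solution\<close> would solve \<open>(C - v) g = f\<close> for all \<open>v\<close> in a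
  neighbourhood of \<open>p\<close>, which is a point of the disc.\<close>

lemma cesaro_local_spectral_radius:
  assumes f: "f \<in> hardy_space p" "f \<noteq> 0"
  shows "local_spectral_radius (hardy_norm p) cesaro f = ereal p"
proof (rule antisym)
  obtain K where K: "0 \<le> K" "\<And>f. f \<in> hardy_space p \<Longrightarrow> hardy_norm p (cesaro f) \<le> K * hardy_norm p f"
    using cesaro_bounded[OF p] by blast
  define N where "N n = hardy_norm p ((cesaro ^^ n) f)" for n
  have N: "0 \<le> N n" for n
    unfolding N_def by (rule H.norm_nonneg[OF H.iterate_mem[OF K f(1)]])
  have upper: "local_spectral_radius (hardy_norm p) cesaro f \<le> ereal R" if R: "p < R" for R
  proof -
    obtain B where B: "0 \<le> B" "\<And>n. N n \<le> B * R ^ n"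
      using cesaro_iterates_growth[OF R f(1)] unfolding N_def by blast
    have "root n (N n) \<le> root n (B + 1) * R" if n: "0 < n" for n
    proof -
      have "N n \<le> (B + 1) * R ^ n" using B(2)[of n] R p by (simp add: distrib_right add_increasing2)
      then have "root n (N n) \<le> root n ((B + 1) * R ^ n)" using n by (rule real_root_le_mono[rotated])
      also have "\<dots> = root n (B + 1) * R" using n R p by (simp add: real_root_mult real_root_power_cancel)
      finally show ?thesis .
    qed
    then have "limsup (\<lambda>n. ereal (root n (N n))) \<le> limsup (\<lambda>n. ereal (root n (B + 1) * R))"
      by (intro Limsup_mono) (auto simp: eventually_sequentially intro!: exI[of _ 1])
    also have "\<dots> = ereal (1 * R)"
      using B by (intro lim_imp_Limsup tendsto_ereal tendsto_mult LIMSEQ_root_const tendsto_const) auto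
    finally show ?thesis by (simp add: local_spectral_radius_def N_def)
  qed
  show "local_spectral_radius (hardy_norm p) cesaro f \<le> ereal p"
    by (rule ereal_le_epsilon2) (use upper[of "p + _"] in \<open>simp add: plus_ereal.simps\<close>)
  show "ereal p \<le> local_spectral_radius (hardy_norm p) cesaro f"
  proof (rule ccontr)
    assume "\<not> ?thesis"
    then have "limsup (\<lambda>n. ereal (root n (N n))) < ereal p"
      by (simp add: local_spectral_radius_def N_def not_le)
    then obtain c where c: "limsup (\<lambda>n. ereal (root n (N n))) < ereal c" "ereal c < ereal p"
      using ereal_dense2 by blast
    define R where "R = max c (p / 2)"
    have R: "0 < R" "R < p" using c p by (auto simp: R_def)
    have "\<forall>\<^sub>F n in sequentially. ereal (root n (N n)) < ereal c" using c(1) by (rule Limsup_lessD)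
    then have "\<forall>\<^sub>F n in sequentially. N n \<le> R ^ n"
      using eventually_gt_at_top[of 0]
    proof eventually_elim
      case (elim n)
      then have "root n (N n) \<le> R" by (simp add: R_def)
      then have "root n (N n) ^ n \<le> R ^ n" using elim N by (intro power_mono) auto
      then show ?case using elim N[of n] by simp
    qed
    then obtain n0 where n0: "\<And>n. n \<ge> n0 \<Longrightarrow> N n \<le> R ^ n" by (auto simp: eventually_sequentially)
    define B where "B = 1 + (\<Sum>i<n0. N i / R ^ i)"
    have growth: "N n \<le> B * R ^ n" for n
    proof (cases "n < n0")
      case True
      then have "N n / R ^ n \<le> (\<Sum>i<n0. N i / R ^ i)" using N R by (intro member_le_sum) auto
      then have "N n / R ^ n \<le> B" by (simp add: B_def)
      then show ?thesis using R by (simp add: divide_le_eq)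
    next
      case False
      have "1 \<le> B" unfolding B_def using N R by (simp add: sum_nonneg)
      then have "1 * R ^ n \<le> B * R ^ n" using R by (intro mult_right_mono) auto
      then show ?thesis using n0[of n] False by simp
    qed
    have "f = 0"
    proof (rule no_local_solution[OF f(1)])
      show "open {w::complex. R < norm w}" by (intro open_Collect_less continuous_intros)
      show "complex_of_real p \<in> {w. R < norm w}" using R by simp
      show "complex_of_real p \<in> spectral_disc" using p by (simp add: dist_norm flip: of_real_diff)
      show "\<exists>g\<in>hardy_space p. cesaro g - cscale v g = f" if "v \<in> {w. R < norm w}" for v
        by (rule H.Neumann_solution[OF K f(1) growth[unfolded N_def] R(1)]) (use that in auto)
    qed
    then show False using f by simp
  qed
qed

end

theorem theorem4p7:
  fixes p :: real
  assumes "1 < p"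
  shows
    "(\<forall>f \<in> hardy_space p - {0}.
        local_spectrum (hardy_space p) (hardy_norm p) cesaro f
          = op_spectrum (hardy_space p) (hardy_norm p) cesaro)
     \<and> (\<forall>f \<in> hardy_space p - {0}.
        local_spectral_radius (hardy_norm p) cesaro f
          = spectral_radius (hardy_space p) (hardy_norm p) cesaro)
     \<and> (\<forall>F. closed F \<and> F \<subset> op_spectrum (hardy_space p) (hardy_norm p) cesaro \<longrightarrow>
        spectral_subspace (hardy_space p) (hardy_norm p) cesaro F = {0})
     \<and> (\<forall>M. closed_subspace (hardy_space p) (hardy_norm p) M
          \<and> (\<forall>f\<in>M. cesaro f \<in> M) \<and> M \<noteq> {0} \<and> M \<noteq> hardy_space p \<longrightarrow>
        op_spectrum M (hardy_norm p) cesaro = op_spectrum (hardy_space p) (hardy_norm p) cesaro)"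
proof (intro conjI)
  note spec = cesaro_spectrum[OF assms] and local = cesaro_local_spectrum[OF assms]
  show "\<forall>f \<in> hardy_space p - {0}.
      local_spectrum (hardy_space p) (hardy_norm p) cesaro f = op_spectrum (hardy_space p) (hardy_norm p) cesaro"
    by (simp add: spec local)
  show "\<forall>f \<in> hardy_space p - {0}.
      local_spectral_radius (hardy_norm p) cesaro f = spectral_radius (hardy_space p) (hardy_norm p) cesaro"
    by (simp add: cesaro_spectral_radius[OF assms] cesaro_local_spectral_radius[OF assms])
  show "\<forall>F. closed F \<and> F \<subset> op_spectrum (hardy_space p) (hardy_norm p) cesaro \<longrightarrow>
      spectral_subspace (hardy_space p) (hardy_norm p) cesaro F = {0}"
  proof (intro allI impI)
    fix F assume "closed F \<and> F \<subset> op_spectrum (hardy_space p) (hardy_norm p) cesaro"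
    then have "\<not> op_spectrum (hardy_space p) (hardy_norm p) cesaro \<subseteq> F" by blast
    then have "f = 0" if "f \<in> hardy_space p" "local_spectrum (hardy_space p) (hardy_norm p) cesaro f \<subseteq> F" for f
      using local[OF that(1)] that(2) spec by metis
    moreover have "0 \<in> hardy_space p"
      using function_banach.zero_mem[OF hardy_function_banach[OF assms]] .
    ultimately show "spectral_subspace (hardy_space p) (hardy_norm p) cesaro F = {0}"
      using zero_local_spectrum[OF assms] by (auto simp: spectral_subspace_def)
  qed
  show "\<forall>M. closed_subspace (hardy_space p) (hardy_norm p) M
      \<and> (\<forall>f\<in>M. cesaro f \<in> M) \<and> M \<noteq> {0} \<and> M \<noteq> hardy_space p \<longrightarrow>
      op_spectrum M (hardy_norm p) cesaro = op_spectrum (hardy_space p) (hardy_norm p) cesaro"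
    using cesaro_spectrum_invariant_subspace[OF assms] spec by simp
qed

end
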